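(* (i) For every element $\psi=\sum a_\lambda\sigma_\lambda\in\mathscr R$, the series $\widehat\psi(\omega):=\sum a_\lambda\widehat\sigma_\lambda(\omega)$ converges absolutely at every point $\omega\in\Omega$. Moreover, the resulting function on $\Omega$ is bounded and its supremum norm does not exceed $\Vert\psi\Vert$. (ii) The map $\psi\mapsto\widehat\psi(\,\cdot\,)$ is an algebra homomorphism $\mathscr R\to C(\Omega)$, where $C(\Omega)$ is the algebra of bounded continuous functions on $\Omega$. (iii) The kernel of this homomorphism is the principal ideal $\mathscr J\subset\mathscr R$ generated (in $\mathscr R$) by the element $\varphi-1$. This ideal coincides with $J\cap\mathscr R$.
   Context: For $N\ge1$, $\mathbb S_N$ is the set of signatures of length $N$: vectors $\lambda=(\lambda_1\ge\dots\ge\lambda_N)\in\mathbb Z^N$; $\mathbb S_0=\{\varnothing\}$. Let $\varphi_n$, $n\in\mathbb Z$, be commuting formal variables of degree $1$, and $\varphi_\lambda=\varphi_{\lambda_1}\cdots\varphi_{\lambda_N}$. $R=\bigoplus_{N\ge0}R_N$ is the commutative graded complex algebra of formal power series of bounded degree in the $\varphi_n$; $R_N$ consists of all formal sums $\sum_{\lambda\in\mathbb S_N}a_\lambda\varphi_\lambda$, $a_\lambda\in\mathbb C$ arbitrary. Set $\sigma_\lambda=\det[\varphi_{\lambda_i-i+j}]_{i,j=1}^N$ for $\lambda\in\mathbb S_N$, $\sigma_\varnothing=1$. Each monomial occurs in only finitely many $\sigma_\lambda$ and every element of $R_N$ is uniquely a (possibly infinite) sum $\sum_{\lambda\in\mathbb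 S_N}a_\lambda\sigma_\lambda$. Put $\varphi=\sum_{n\in\mathbb Z}\varphi_n\in R$ and let $J\subset R$ be the principal ideal of $R$ generated by $\varphi-1$. Let $\mathrm{Dim}_N\lambda=\prod_{1\le i<j\le N}\frac{\lambda_i-\lambda_j-i+j}{j-i}$. For $\psi=\sum_{\lambda\in\mathbb S_N}a_\lambda\sigma_\lambda\in R_N$ put $\Vert\psi\Vert=\sup_{\lambda\in\mathbb S_N}|a_\lambda|/\mathrm{Dim}_N\lambda\in[0,+\infty]$ (with $\Vert1\Vert=1$), and for $\psi=\sum_N\psi_N$ with $\psi_N\in R_N$ put $\Vert\psi\Vert=\sum_N\Vert\psi_N\Vert$. $\mathscr R\subset R$ is the set of elements of finite norm; it is a subalgebra and contains $\varphi$. $\Omega$ is the set of $\omega=(\alpha^+,\beta^+;\alpha^-,\beta^-;\delta^+,\delta^-)\in\mathbb R_+^\infty\times\mathbb R_+^\infty\times\mathbb R_+^\infty\times\mathbb R_+^\infty\times\mathbb R_+\times\mathbb R_+$ with $\alpha^\pm=(\alpha^\pm_1\ge\alpha^\pm_2\ge\dots\ge0)$, $\beta^\pm=(\beta_1^\pm\ge\beta_2^\pm\ge\dots\ge0)$, $\sum_i(\alpha_i^\pm+\beta_i^\pm)\le\delta^\pm$, $\beta^+_1+\beta^-_1\le1$, with the topology induced by the product topology. With $\gamma^\pm=\delta^\pm-\sum_i(\alpha_i^\pm+\beta_i^\pm)$ set $$\Phi(u;\omega)=e^{\gamma^+(u-1)+\gamma^-(u^{-1}-1)}\prod_{i=1}^\infty\frac{1+\beta_i^+(u-1)}{1-\alpha_i^+(u-1)}\,\frac{1+\beta_i^-(u^{-1}-1)}{1-\alpha_i^-(u^{-1}-1)},$$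 which is holomorphic near $|u|=1$; let $\Phi(u;\omega)=\sum_{n\in\mathbb Z}\widehat\varphi_n(\omega)u^n$ be its Laurent expansion there, and $\widehat\sigma_\lambda(\omega)=\det[\widehat\varphi_{\lambda_i-i+j}(\omega)]_{i,j=1}^N$ for $\lambda\in\mathbb S_N$, $\widehat\sigma_\varnothing=1$. *)

theory Defs
  imports
    "HOL-Analysis.Analysis"
    "HOL-Library.Multiset"
    "Jordan_Normal_Form.Determinant"
begin

text \<open>Both HOL-Analysis and Jordan_Normal_Form define \<open>det\<close> and \<open>mat\<close>; below they are those of
  Jordan_Normal_Form, whose matrices carry their size as a natural number and are indexed from 0.\<close>

section \<open>The graded algebra of formal power series of bounded degree\<close>

text \<open>A monomial in the variables \<open>\<phi>\<^sub>n\<close> (\<open>n \<in> \<int>\<close>) is a multiset of integers; its degree is its size.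
  A series of bounded degree is an arbitrary family of coefficients vanishing in large degrees.\<close>

typedef bseries = "{f :: int multiset \<Rightarrow> complex. \<exists>d. \<forall>M. size M > d \<longrightarrow> f M = 0}"
  morphisms coeff Abs_bseries
  by (rule exI[of _ "\<lambda>_. 0"]) auto

setup_lifting type_definition_bseries

lemma bseries_eqI: "(\<And>M. coeff f M = coeff g M) \<Longrightarrow> f = g"
  by (simp add: coeff_inject[symmetric] fun_eq_iff)

lemma finite_decompositions: "finite {(A, B). A + B = (M :: 'a multiset)}"
proof (rule finite_subset)
  let ?S = "mset ` {xs. set xs \<subseteq> set_mset M \<and> length xs \<le> size M}"
  have S: "A \<in> ?S" if "A \<subseteq># M" for A
  proof -
    obtain xs where xs: "A = mset xs" by (metis ex_mset)
    have "set xs \<subseteq> set_mset M" "length xs \<le> size M"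
      using set_mset_mono[OF that] size_mset_mono[OF that] by (auto simp: xs)
    then show ?thesis using xs by auto
  qed
  show "{(A, B). A + B = M} \<subseteq> ?S \<times> ?S"
    using S by (auto simp del: image_iff)
  show "finite (?S \<times> ?S)"
    by (intro finite_cartesian_product finite_imageI finite_lists_length_le) auto
qed

instantiation bseries :: comm_ring_1
begin

lift_definition zero_bseries :: bseries is "\<lambda>_. 0" by auto

lift_definition one_bseries :: bseries is "\<lambda>M. if M = {#} then 1 else 0"
  by (rule exI[of _ 0]) auto

lift_definition plus_bseries :: "bseries \<Rightarrow> bseries \<Rightarrow> bseries" is "\<lambda>f g M. f M + g M"
proof -
  fix f g :: "int multiset \<Rightarrow> complex"
  assume "\<exists>d. \<forall>M. size M > d \<longrightarrow> f M = 0" "\<exists>d. \<forall>M. size M > d \<longrightarrow> g M = 0"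
  then obtain d e where "\<forall>M. size M > d \<longrightarrow> f M = 0" "\<forall>M. size M > e \<longrightarrow> g M = 0" by blast
  then show "\<exists>d. \<forall>M. size M > d \<longrightarrow> f M + g M = 0" by (intro exI[of _ "max d e"]) auto
qed

lift_definition uminus_bseries :: "bseries \<Rightarrow> bseries" is "\<lambda>f M. - f M" by auto

definition minus_bseries :: "bseries \<Rightarrow> bseries \<Rightarrow> bseries"
  where "minus_bseries f g = f + - g"

lift_definition times_bseries :: "bseries \<Rightarrow> bseries \<Rightarrow> bseries"
  is "\<lambda>f g M. \<Sum>(A, B)\<in>{(A, B). A + B = M}. f A * g B"
proof -
  fix f g :: "int multiset \<Rightarrow> complex"
  assume "\<exists>d. \<forall>M. size M > d \<longrightarrow> f M = 0" "\<exists>d. \<forall>M. size M > d \<longrightarrow> g M = 0"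
  then obtain d e where de: "\<forall>M. size M > d \<longrightarrow> f M = 0" "\<forall>M. size M > e \<longrightarrow> g M = 0" by blast
  show "\<exists>d. \<forall>M. size M > d \<longrightarrow> (\<Sum>(A, B)\<in>{(A, B). A + B = M}. f A * g B) = 0"
  proof (intro exI[of _ "d + e"] allI impI sum.neutral ballI)
    fix M p assume "d + e < size M" and p: "p \<in> {(A, B). A + B = (M :: int multiset)}"
    then have "d < size (fst p) \<or> e < size (snd p)" by auto
    then show "(case p of (A, B) \<Rightarrow> f A * g B) = 0" using de by (auto simp: split_beta)
  qed
qed

instance
proof
  fix a b c :: bseries
  show "a * b * c = a * (b * c)"
  proof (rule bseries_eqI)
    fix M
    let ?D = "\<lambda>M. {(A, B). A + B = (M :: int multiset)}"
    have "coeff (a * b * c) M =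
        (\<Sum>p\<in>?D M. \<Sum>q\<in>?D (fst p). coeff a (fst q) * coeff b (snd q) * coeff c (snd p))"
      by (simp add: times_bseries.rep_eq split_beta sum_distrib_right)
    also have "\<dots> = (\<Sum>(p, q)\<in>Sigma (?D M) (\<lambda>p. ?D (fst p)).
        coeff a (fst q) * coeff b (snd q) * coeff c (snd p))"
      by (rule sum.Sigma) (auto intro: finite_decompositions)
    also have "\<dots> = (\<Sum>(p, q)\<in>Sigma (?D M) (\<lambda>p. ?D (snd p)).
        coeff a (fst p) * (coeff b (fst q) * coeff c (snd q)))"
      by (rule sum.reindex_bij_witness[where
            i = "\<lambda>(p, q). ((fst p + fst q, snd q), (fst p, fst q))" and
            j = "\<lambda>(p, q). ((fst q, snd q + snd p), (snd q, snd p))"])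
        (auto simp: ac_simps)
    also have "\<dots> = (\<Sum>p\<in>?D M. \<Sum>q\<in>?D (snd p).
        coeff a (fst p) * (coeff b (fst q) * coeff c (snd q)))"
      by (rule sum.Sigma[symmetric]) (auto intro: finite_decompositions)
    also have "\<dots> = coeff (a * (b * c)) M"
      by (simp add: times_bseries.rep_eq split_beta sum_distrib_left)
    finally show "coeff (a * b * c) M = coeff (a * (b * c)) M" .
  qed
  show "a * b = b * a"
  proof (rule bseries_eqI)
    fix M
    show "coeff (a * b) M = coeff (b * a) M"
      unfolding times_bseries.rep_eq
      by (rule sum.reindex_bij_witness[where i = prod.swap and j = prod.swap])
        (auto simp: ac_simps)
  qed
  show "1 * a = a"
  proof (rule bseries_eqI)
    fix M
    have "coeff (1 * a) M = (\<Sum>p\<in>{({#}, M)}. coeff 1 (fst p) * coeff a (snd p))"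
      unfolding times_bseries.rep_eq split_beta
      by (rule sum.mono_neutral_right)
        (auto simp: one_bseries.rep_eq finite_decompositions[unfolded split_beta] split_beta)
    then show "coeff (1 * a) M = coeff a M" by (simp add: one_bseries.rep_eq)
  qed
  show "(a + b) * c = a * c + b * c"
    by (rule bseries_eqI)
      (simp add: times_bseries.rep_eq plus_bseries.rep_eq split_beta ring_distribs sum.distrib)
  show "a + b + c = a + (b + c)" "a + b = b + a" "0 + a = a" "- a + a = 0"
    by (rule bseries_eqI;
        simp add: plus_bseries.rep_eq zero_bseries.rep_eq uminus_bseries.rep_eq)+
  show "a - b = a + - b" by (rule minus_bseries_def)
  show "(0 :: bseries) \<noteq> 1"
  proof
    assume "(0 :: bseries) = 1"
    then have "coeff 0 {#} = coeff 1 {#}" by simp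
    then show False by (simp add: zero_bseries.rep_eq one_bseries.rep_eq)
  qed
qed

end

lift_definition bscale :: "complex \<Rightarrow> bseries \<Rightarrow> bseries" is "\<lambda>c f M. c * f M" by auto

lift_definition var :: "int \<Rightarrow> bseries" is "\<lambda>n M. if M = {#n#} then 1 else 0"
  by (rule exI[of _ 1]) auto

text \<open>Formal (coefficientwise) convergence of possibly infinite sums: every monomial occurs in only
  finitely many summands.\<close>

definition has_formal_sum :: "('a \<Rightarrow> bseries) \<Rightarrow> 'a set \<Rightarrow> bseries \<Rightarrow> bool" where
  "has_formal_sum F I \<psi> \<longleftrightarrow>
     (\<forall>M. finite {i \<in> I. coeff (F i) M \<noteq> 0} \<and>
          coeff \<psi> M = (\<Sum>i | i \<in> I \<and> coeff (F i) M \<noteq> 0. coeff (F i) M))"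

lift_definition phi :: bseries is "\<lambda>M. if size M = 1 then 1 else 0"
  by (rule exI[of _ 1]) auto

lemma has_formal_sum_phi: "has_formal_sum var UNIV phi"
  unfolding has_formal_sum_def
proof
  fix M :: "int multiset"
  show "finite {i \<in> UNIV. coeff (var i) M \<noteq> 0} \<and>
        coeff phi M = (\<Sum>i | i \<in> UNIV \<and> coeff (var i) M \<noteq> 0. coeff (var i) M)"
  proof (cases "size M = 1")
    case True
    then obtain n where n: "M = {#n#}" using size_1_singleton_mset by blast
    then have "{i \<in> UNIV. coeff (var i) M \<noteq> 0} = {n}" by (auto simp: var.rep_eq)
    then show ?thesis using n by (simp add: var.rep_eq phi.rep_eq)
  next
    case False
    then have "{i \<in> UNIV. coeff (var i) M \<noteq> 0} = {}" by (auto simp: var.rep_eq)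
    then show ?thesis using False by (simp add: phi.rep_eq)
  qed
qed

text \<open>The principal ideal generated by \<open>a\<close> in a subring \<open>S\<close> of a commutative ring.\<close>

definition principal_ideal :: "'a :: comm_ring_1 set \<Rightarrow> 'a \<Rightarrow> 'a set" where
  "principal_ideal S a = {x * a | x. x \<in> S}"

section \<open>Signatures, the elements \<open>\<sigma>\<^sub>\<lambda>\<close> and the norm\<close>

definition signatures_of :: "nat \<Rightarrow> int list set" where
  "signatures_of N = {l. length l = N \<and> sorted_wrt (\<ge>) l}"

definition signatures :: "int list set" where
  "signatures = (\<Union>N. signatures_of N)"

text \<open>The determinants \<open>det [p\<^bsub>\<lambda>\<^sub>i - i + j\<^esub>]\<close>; for the empty signature this is the empty
  determinant, which is 1.\<close>

definition jacobi_trudi :: "(int \<Rightarrow> 'a :: comm_ring_1) \<Rightarrow> int list \<Rightarrow> 'a" where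
  "jacobi_trudi p l =
     Determinant.det (Matrix.mat (length l) (length l) (\<lambda>(i, j). p (l ! i - int i + int j)))"

definition sigma :: "int list \<Rightarrow> bseries" where
  "sigma l = jacobi_trudi var l"

text \<open>The family \<open>a\<close> in the unique expansion \<open>\<psi> = \<Sum> a\<^sub>\<lambda> \<sigma>\<^sub>\<lambda>\<close>, extended by 0 to integer lists that are
  not signatures. As \<open>\<sigma>\<^sub>\<lambda>\<close> is homogeneous of degree \<open>length \<lambda>\<close>, the part with \<open>\<lambda>\<close> of length \<open>N\<close> expands
  the component of \<open>\<psi>\<close> of degree \<open>N\<close>.\<close>

definition sigma_coeff :: "bseries \<Rightarrow> int list \<Rightarrow> complex" where
  "sigma_coeff \<psi> =
     (THE a. (\<forall>l. l \<notin> signatures \<longrightarrow> a l = 0) \<and>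
             has_formal_sum (\<lambda>l. bscale (a l) (sigma l)) signatures \<psi>)"

definition Dim :: "int list \<Rightarrow> real" where
  "Dim l = (\<Prod>(i, j) | i < j \<and> j < length l.
     of_int (l ! i - l ! j - int i + int j) / of_int (int j - int i))"

definition component_norm :: "nat \<Rightarrow> bseries \<Rightarrow> ennreal" where
  "component_norm N \<psi> = (SUP l\<in>signatures_of N. ennreal (cmod (sigma_coeff \<psi> l) / Dim l))"

definition bnorm :: "bseries \<Rightarrow> ennreal" where
  "bnorm \<psi> = (\<Sum>N. component_norm N \<psi>)"

definition finite_norm :: "bseries set" where
  "finite_norm = {\<psi>. bnorm \<psi> < \<infinity>}"

section \<open>The space \<open>\<Omega>\<close> and the functions on it\<close>

text \<open>Points are tuples \<open>(\<alpha>\<^sup>+, \<beta>\<^sup>+, \<alpha>\<^sup>-, \<beta>\<^sup>-, \<delta>\<^sup>+, \<delta>\<^sup>-)\<close>, with sequences indexed from 0. The standard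
  topology on this type is the product topology.\<close>

type_synonym point =
  "(nat \<Rightarrow> real) \<times> (nat \<Rightarrow> real) \<times> (nat \<Rightarrow> real) \<times> (nat \<Rightarrow> real) \<times> real \<times> real"

definition Omega :: "point set" where
  "Omega = {(ap, bp, am, bm, dp, dm).
     (\<forall>x\<in>{ap, bp, am, bm}. decseq x \<and> (\<forall>i. 0 \<le> x i)) \<and>
     summable (\<lambda>i. ap i + bp i) \<and> (\<Sum>i. ap i + bp i) \<le> dp \<and>
     summable (\<lambda>i. am i + bm i) \<and> (\<Sum>i. am i + bm i) \<le> dm \<and>
     bp 0 + bm 0 \<le> 1}"

definition Phi :: "complex \<Rightarrow> point \<Rightarrow> complex" where
  "Phi u = (\<lambda>(ap, bp, am, bm, dp, dm).
     (let gp = dp - (\<Sum>i. ap i + bp i);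
          gm = dm - (\<Sum>i. am i + bm i)
      in exp (of_real gp * (u - 1) + of_real gm * (inverse u - 1)) *
         (\<Prod>i. (1 + of_real (bp i) * (u - 1)) / (1 - of_real (ap i) * (u - 1)) *
               ((1 + of_real (bm i) * (inverse u - 1)) / (1 - of_real (am i) * (inverse u - 1))))))"

text \<open>\<open>f(u) = \<Sum> c\<^sub>n u\<^sup>n\<close> (\<open>n \<in> \<int>\<close>) in some annulus around the unit circle.\<close>

definition laurent_expansion :: "(complex \<Rightarrow> complex) \<Rightarrow> (int \<Rightarrow> complex) \<Rightarrow> bool" where
  "laurent_expansion f c \<longleftrightarrow>
     (\<exists>e>0. \<forall>u. 1 - e < cmod u \<and> cmod u < 1 + e \<longrightarrow> ((\<lambda>n. c n * u powi n) has_sum f u) UNIV)"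

definition phi_hat :: "point \<Rightarrow> int \<Rightarrow> complex" where
  "phi_hat \<omega> = (THE c. laurent_expansion (\<lambda>u. Phi u \<omega>) c)"

definition sigma_hat :: "int list \<Rightarrow> point \<Rightarrow> complex" where
  "sigma_hat l \<omega> = jacobi_trudi (phi_hat \<omega>) l"

text \<open>The value at \<open>\<omega>\<close> of the series \<open>\<Sum> a\<^sub>\<lambda> \<sigma>\<^sub>\<lambda>(\<omega>)\<close>; its absolute convergence is part of the
  theorem.\<close>

definition hat :: "bseries \<Rightarrow> point \<Rightarrow> complex" where
  "hat \<psi> \<omega> = (\<Sum>\<^sub>\<infinity>l\<in>signatures. sigma_coeff \<psi> l * sigma_hat l \<omega>)"

text \<open>The bounded continuous functions on \<open>S\<close>, represented by functions on the whole type whose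
  values outside \<open>S\<close> are irrelevant.\<close>

definition bounded_continuous_on :: "'a :: topological_space set \<Rightarrow> ('a \<Rightarrow> complex) \<Rightarrow> bool" where
  "bounded_continuous_on S f \<longleftrightarrow> continuous_on S f \<and> bounded (f ` S)"

end

theory Submission
  imports
    Defs
    "HOL-Combinatorics.Multiset_Permutations"
    "HOL-Complex_Analysis.Cauchy_Integral_Formula"
begin

text \<open>
  The structure constants of the basis \<open>\<sigma>\<^sub>\<lambda>\<close> (Littlewood-Richardson coefficients) can be avoided. Only
  multiplication by \<open>\<phi>\<close> is needed in this basis: the Pieri rule \<open>\<phi> \<sigma>\<^sub>\<lambda> = \<Sum> \<sigma>\<^sub>\<nu>\<close>, summed over the \<open>\<nu>\<close>
  interlacing \<open>\<lambda>\<close>, and the matching branching rule for \<open>Dim\<close> show that \<open>\<phi>\<close> does not increase the norm and that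
  \<open>\<phi>\<^sup>N = \<Sum> Dim \<lambda> \<sigma>\<^sub>\<lambda>\<close>. General products are evaluated in the monomial basis instead: the
  coefficients of elements of finite norm grow subexponentially in both bases, while the Laurent
  coefficients of \<open>\<Phi>(u; \<omega>)\<close> decay exponentially, so that the function of \<open>\<psi>\<close> on \<open>\<Omega>\<close> is obtained by
  substituting these coefficients for the variables.

  The Laurent coefficients are totally positive, because \<open>\<Phi>\<close> is a limit of products of factors
  \<open>1 + \<beta>(u - 1)\<close> and \<open>1/(1 - \<alpha>(u - 1))\<close> in \<open>u\<close> or \<open>1/u\<close>. Hence the numbers \<open>Dim \<lambda> \<sigma>\<^sub>\<lambda>(\<omega>)\<close>, for \<open>\<lambda>\<close> of
  length \<open>N\<close>, form a probability distribution depending continuously on \<open>\<omega>\<close>, which gives the bound and,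
  by Scheffe's lemma, the continuity.

  For the kernel, multiplying homogeneous components by powers of \<open>\<phi>\<close> makes an element homogeneous
  without changing it modulo \<open>(\<phi> - 1)\<close>. A homogeneous element vanishing on \<open>\<Omega>\<close> is zero: already the points
  with \<open>\<Phi>(u; \<omega>) = u\<^sup>-\<^sup>k \<Prod> (1 - b\<^sub>i + b\<^sub>i u)\<close> detect all coefficients. Homogenizing \<open>(\<phi> - 1) x\<close> gives a
  telescoping sum, so multiples of \<open>\<phi> - 1\<close> by arbitrary series are covered as well.
\<close>

section \<open>Determinants\<close>

text \<open>The expansion coefficients and the Laurent coefficients are given by definite
  descriptions, so existence and uniqueness must come with usable formulas. In the \<sigma> basis
  uniqueness is triangularity, while existence comes from reading the iterated Pieri rule with
  noncommuting letters: a Gelfand-Tsetlin pattern with top row v spells a word, namely the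
  differences of its row sums, and summing a function of words over patterns inverts the passage to
  monomials. A pattern sum has \<open>Dim v\<close> terms, and no word in it has a larger absolute
  sum than v; so subexponential growth passes from the monomial coefficients to the \<sigma>
  coefficients. The opposite direction rests on the fact that in bounded degree each \<sigma> has
  boundedly many monomials, all close to its signature. This control in both directions allows the
  double series over signatures and monomials to be summed in either order. For continuity the
  obstacle is that termwise convergence of infinite sums lets mass escape to infinity; the total
  mass being 1 at every point, the limit point included, excludes this.\<close>

abbreviation detm :: "nat \<Rightarrow> (nat \<Rightarrow> nat \<Rightarrow> 'a) \<Rightarrow> 'a :: comm_ring_1" where
  "detm n f \<equiv> Determinant.det (Matrix.mat n n (\<lambda>(i, j). f i j))"

lemma detm_leibniz:
  "detm n f = (\<Sum>p | p permutes {0..<n}. signof p * (\<Prod>i = 0..<n. f i (p i)))"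
proof -
  have "detm n f = (\<Sum>p | p permutes {0..<n}. signof p *
      (\<Prod>i = 0..<n. Matrix.mat n n (\<lambda>(i, j). f i j) $$ (i, p i)))"
    by (rule det_def') simp
  also have "\<dots> = (\<Sum>p | p permutes {0..<n}. signof p * (\<Prod>i = 0..<n. f i (p i)))"
    by (intro sum.cong refl arg_cong2[where f = "(*)"] prod.cong)
      (auto dest: permutes_in_image)
  finally show ?thesis .
qed

lemma detm_cong:
  assumes "\<And>i j. i < n \<Longrightarrow> j < n \<Longrightarrow> f i j = g i j"
  shows "detm n f = detm n g"
proof -
  have "Matrix.mat n n (\<lambda>(i, j). f i j) = Matrix.mat n n (\<lambda>(i, j). g i j)"
    by (rule Matrix.eq_matI) (use assms in auto)
  then show ?thesis by simp
qed

lemma detm_mult: "detm n (\<lambda>i j. \<Sum>k<n. f i k * g k j) = detm n f * detm n g"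
proof -
  have "Matrix.mat n n (\<lambda>(i, j). \<Sum>k<n. f i k * g k j) =
      Matrix.mat n n (\<lambda>(i, j). f i j) * Matrix.mat n n (\<lambda>(i, j). g i j)"
    by (rule Matrix.eq_matI) (auto simp: scalar_prod_def lessThan_atLeast0)
  then show ?thesis by (simp add: det_mult[of _ n])
qed

lemma detm_upper_triangular:
  assumes "\<And>i j. j < i \<Longrightarrow> i < n \<Longrightarrow> f i j = 0"
  shows "detm n f = (\<Prod>i<n. f i i)"
proof -
  have "detm n f = prod_list (diag_mat (Matrix.mat n n (\<lambda>(i, j). f i j)))"
    by (rule det_upper_triangular) (use assms in auto)
  also have "\<dots> = (\<Prod>i<n. f i i)"
    by (simp add: diag_mat_def prod.list_conv_set_nth atLeast0LessThan)
  finally show ?thesis .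
qed

lemma detm_lower_triangular:
  assumes "\<And>i j. i < j \<Longrightarrow> j < n \<Longrightarrow> f i j = 0"
  shows "detm n f = (\<Prod>i<n. f i i)"
proof -
  have "detm n f = prod_list (diag_mat (Matrix.mat n n (\<lambda>(i, j). f i j)))"
    by (rule det_lower_triangular[of n]) (use assms in auto)
  also have "\<dots> = (\<Prod>i<n. f i i)"
    by (simp add: diag_mat_def prod.list_conv_set_nth atLeast0LessThan)
  finally show ?thesis .
qed

lemma detm_identical_rows:
  assumes "i < n" "i' < n" "i \<noteq> i'" "\<And>j. j < n \<Longrightarrow> f i j = f i' j"
  shows "detm n f = 0"
  by (rule det_identical_rows[of _ n i i']) (use assms in \<open>auto intro!: Matrix.eq_vecI\<close>)

text \<open>All row operations are carried out at once by a unitriangular left factor, so every row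
  receives a multiple of the original next row, with a weight of its own.\<close>

lemma detm_add_next_row:
  "detm n (\<lambda>i j. f i j + (if Suc i < n then w i * f (Suc i) j else 0)) = detm n f"
proof -
  define U where "U i k = (if k = i then 1 else if k = Suc i then w i else 0)" for i k
  have "detm n (\<lambda>i j. f i j + (if Suc i < n then w i * f (Suc i) j else 0)) =
      detm n (\<lambda>i j. \<Sum>k<n. U i k * f k j)"
  proof (rule detm_cong)
    fix i j assume i: "i < n"
    have "(\<Sum>k<n. U i k * f k j) =
        (\<Sum>k<n. (if k = i then f i j else 0) + (if k = Suc i then w i * f (Suc i) j else 0))"
      by (rule sum.cong) (auto simp: U_def)
    also have "\<dots> = f i j + (if Suc i < n then w i * f (Suc i) j else 0)"
      using i by (simp add: sum.distrib)
    finally show "f i j + (if Suc i < n then w i * f (Suc i) j else 0) = (\<Sum>k<n. U i k * f k j)" ..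
  qed
  also have "\<dots> = detm n U * detm n f" by (rule detm_mult)
  also have "detm n U = 1"
    by (subst detm_upper_triangular) (auto simp: U_def)
  finally show ?thesis by simp
qed

lemma detm_add_previous_row:
  "detm n (\<lambda>i j. f i j + (if i = 0 then 0 else w i * f (i - 1) j)) = detm n f"
proof -
  define U where "U i k = (if k = i then 1 else if Suc k = i then w i else 0)" for i k
  have "detm n (\<lambda>i j. f i j + (if i = 0 then 0 else w i * f (i - 1) j)) =
      detm n (\<lambda>i j. \<Sum>k<n. U i k * f k j)"
  proof (rule detm_cong)
    fix i j assume i: "i < n"
    have "(\<Sum>k<n. U i k * f k j) =
        (\<Sum>k<n. (if k = i then f i j else 0) +
          (if k = i - 1 then (if i = 0 then 0 else w i * f (i - 1) j) else 0))"
      by (rule sum.cong) (auto simp: U_def)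
    also have "\<dots> = f i j + (if i = 0 then 0 else w i * f (i - 1) j)"
      using i by (simp add: sum.distrib)
    finally show "f i j + (if i = 0 then 0 else w i * f (i - 1) j) = (\<Sum>k<n. U i k * f k j)" ..
  qed
  also have "\<dots> = detm n U * detm n f" by (rule detm_mult)
  also have "detm n U = 1"
    by (subst detm_lower_triangular) (auto simp: U_def)
  finally show ?thesis by simp
qed

lemma detm_transpose: "detm n (\<lambda>i j. f j i) = detm n f"
proof -
  have "Matrix.mat n n (\<lambda>(i, j). f j i) = transpose_mat (Matrix.mat n n (\<lambda>(i, j). f i j))"
    by (rule Matrix.eq_matI) auto
  then show ?thesis by (simp add: det_transpose[of _ n])
qed

lemma detm_add_next_column:
  "detm n (\<lambda>i j. f i j + (if Suc j < n then w j * f i (Suc j) else 0)) = detm n f"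
  using detm_add_next_row[of n "\<lambda>i j. f j i" w]
  unfolding detm_transpose[of n "\<lambda>j i. f j i + (if Suc i < n then w i * f j (Suc i) else 0)"]
    detm_transpose[of n f] .

lemma detm_last_row:
  assumes "\<And>j. j < n \<Longrightarrow> f n j = 0"
  shows "detm (Suc n) f = f n n * detm n f"
proof -
  let ?A = "Matrix.mat (Suc n) (Suc n) (\<lambda>(i, j). f i j)"
  have "detm (Suc n) f = (\<Sum>j<Suc n. ?A $$ (n, j) * cofactor ?A n j)"
    by (rule laplace_expansion_row) auto
  also have "\<dots> = f n n * cofactor ?A n n"
    using assms by simp
  also have "cofactor ?A n n = detm n f"
    unfolding cofactor_def mat_delete_def
    by (simp add: power_add[symmetric] flip: power_mult_distrib)
      (rule detm_cong, simp)
  finally show ?thesis .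
qed

lemma detm_first_column:
  assumes "\<And>i. 0 < i \<Longrightarrow> i \<le> n \<Longrightarrow> f i 0 = 0"
  shows "detm (Suc n) f = f 0 0 * detm n (\<lambda>i j. f (Suc i) (Suc j))"
proof -
  let ?A = "Matrix.mat (Suc n) (Suc n) (\<lambda>(i, j). f i j)"
  have "detm (Suc n) f = (\<Sum>i<Suc n. ?A $$ (i, 0) * cofactor ?A i 0)"
    by (rule laplace_expansion_column) auto
  also have "\<dots> = f 0 0 * cofactor ?A 0 0"
    using assms by (subst sum.lessThan_Suc_shift) simp
  also have "cofactor ?A 0 0 = detm n (\<lambda>i j. f (Suc i) (Suc j))"
    unfolding cofactor_def mat_delete_def by simp (rule detm_cong, simp)
  finally show ?thesis .
qed

section \<open>Multilinear expansion of determinants\<close>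

definition boxes :: "nat \<Rightarrow> (nat \<Rightarrow> 'a set) \<Rightarrow> 'a list set" where
  "boxes n S = {xs. length xs = n \<and> (\<forall>i<n. xs ! i \<in> S i)}"

lemma boxesI: "length xs = n \<Longrightarrow> (\<And>i. i < n \<Longrightarrow> xs ! i \<in> S i) \<Longrightarrow> xs \<in> boxes n S"
  by (simp add: boxes_def)

lemma bij_betw_boxes: "bij_betw (\<lambda>g. map g [0..<n]) (PiE {0..<n} S) (boxes n S)"
proof (rule bij_betw_byWitness[where f' = "\<lambda>xs. restrict ((!) xs) {0..<n}"])
  show "\<forall>g\<in>PiE {0..<n} S. restrict ((!) (map g [0..<n])) {0..<n} = g"
    by (auto simp: fun_eq_iff restrict_def PiE_def extensional_def)
  show "\<forall>xs\<in>boxes n S. map (restrict ((!) xs) {0..<n}) [0..<n] = xs"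
    by (auto simp: boxes_def intro!: nth_equalityI)
qed (auto simp: boxes_def)

lemma sum_boxes_prod:
  fixes f :: "nat \<Rightarrow> 'a \<Rightarrow> 'b :: comm_semiring_1"
  assumes "\<And>i. i < n \<Longrightarrow> finite (S i)"
  shows "(\<Sum>xs\<in>boxes n S. \<Prod>i = 0..<n. f i (xs ! i)) = (\<Prod>i = 0..<n. \<Sum>x\<in>S i. f i x)"
proof -
  have "(\<Prod>i = 0..<n. \<Sum>x\<in>S i. f i x) = (\<Sum>g\<in>PiE {0..<n} S. \<Prod>i = 0..<n. f i (g i))"
    by (rule prod_sum_PiE) (use assms in auto)
  also have "\<dots> = (\<Sum>g\<in>PiE {0..<n} S. \<Prod>i = 0..<n. f i (map g [0..<n] ! i))"
    by (intro sum.cong refl prod.cong) auto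
  also have "\<dots> = (\<Sum>xs\<in>boxes n S. \<Prod>i = 0..<n. f i (xs ! i))"
    by (rule sum.reindex_bij_betw[OF bij_betw_boxes])
  finally show ?thesis ..
qed

lemma finite_boxes: "(\<And>i. i < n \<Longrightarrow> finite (S i)) \<Longrightarrow> finite (boxes n S)"
  using bij_betw_finite[OF bij_betw_boxes, of n S] finite_PiE[of "{0..<n}" S] by auto

text \<open>A sum in every row expands into a sum over independent choices, one per row. The choices
  are encoded as lists, because signatures are lists: when interlacing signatures fill a box, a sum
  over them becomes a single determinant.\<close>

lemma detm_multilinear:
  assumes "\<And>i. i < n \<Longrightarrow> finite (S i)"
  shows "detm n (\<lambda>i j. \<Sum>k\<in>S i. g i k j) = (\<Sum>xs\<in>boxes n S. detm n (\<lambda>i j. g i (xs ! i) j))"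
proof -
  have "detm n (\<lambda>i j. \<Sum>k\<in>S i. g i k j) =
      (\<Sum>p | p permutes {0..<n}. signof p * (\<Sum>xs\<in>boxes n S. \<Prod>i = 0..<n. g i (xs ! i) (p i)))"
    unfolding detm_leibniz
    by (subst sum_boxes_prod[of n S "\<lambda>i k. g i k (p i)" for p, symmetric]) (use assms in auto)
  also have "\<dots> = (\<Sum>xs\<in>boxes n S. detm n (\<lambda>i j. g i (xs ! i) j))"
    unfolding detm_leibniz sum_distrib_left by (rule sum.swap)
  finally show ?thesis .
qed

lemma jacobi_trudi_detm:
  "jacobi_trudi c l = detm (length l) (\<lambda>i j. c (l ! i - int i + int j))"
  by (simp add: jacobi_trudi_def)

section \<open>Interlacing signatures and the dimension formula\<close>

definition interlaces :: "int list \<Rightarrow> int list \<Rightarrow> bool" where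
  "interlaces l n \<longleftrightarrow> length n = Suc (length l) \<and> (\<forall>i<length l. n ! Suc i \<le> l ! i \<and> l ! i \<le> n ! i)"

lemma signatures_of_iff:
  "l \<in> signatures_of N \<longleftrightarrow> length l = N \<and> (\<forall>i j. i \<le> j \<longrightarrow> j < N \<longrightarrow> l ! j \<le> l ! i)"
  unfolding signatures_of_def sorted_wrt_iff_nth_less
  by (auto simp: le_less)

lemma signatures_of_I:
  assumes "length l = N" "\<And>i. Suc i < N \<Longrightarrow> l ! Suc i \<le> l ! i"
  shows "l \<in> signatures_of N"
  unfolding signatures_of_iff
proof (intro conjI allI impI)
  show "l ! j \<le> l ! i" if "i \<le> j" "j < N" for i j
    using that by (induction j rule: dec_induct) (auto intro: order.trans assms(2))
qed (rule assms(1))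

lemma interlaces_signature:
  assumes "interlaces l n"
  shows "l \<in> signatures" "n \<in> signatures"
proof -
  have "n \<in> signatures_of (Suc (length l))"
    by (rule signatures_of_I) (use assms in \<open>auto simp: interlaces_def intro: order.trans\<close>)
  then show "n \<in> signatures" by (auto simp: signatures_def)
  have "l \<in> signatures_of (length l)"
  proof (rule signatures_of_I)
    fix i assume "Suc i < length l"
    then have "l ! Suc i \<le> n ! Suc i" "n ! Suc i \<le> l ! i"
      using assms by (auto simp: interlaces_def)
    then show "l ! Suc i \<le> l ! i" by simp
  qed simp
  then show "l \<in> signatures" by (auto simp: signatures_def)
qed

lemma signatures_of_length: "l \<in> signatures_of N \<Longrightarrow> length l = N"
  by (simp add: signatures_of_iff)

lemma signatures_iff: "l \<in> signatures \<longleftrightarrow> l \<in> signatures_of (length l)"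
  by (auto simp: signatures_def signatures_of_iff)

text \<open>Given the upper row, the conditions on the entries of the lower row are independent of
  each other and already force it to be a signature, so it ranges over a full box.\<close>

lemma interlaces_below:
  assumes "length n = Suc N"
  shows "{l. interlaces l n} = boxes N (\<lambda>i. {n ! Suc i..n ! i})"
  using assms by (auto simp: interlaces_def boxes_def)

lemma finite_interlaces: "finite {l. interlaces l n}"
proof (cases "length n")
  case 0
  then show ?thesis by (simp add: interlaces_def)
next
  case (Suc N)
  then show ?thesis by (simp add: interlaces_below finite_boxes)
qed

section \<open>Vandermonde and binomial determinants\<close>

lemma detm_poly:
  fixes p :: "nat \<Rightarrow> 'a :: idom poly"
  assumes "\<And>j. degree (p j) \<le> j"
  shows "detm n (\<lambda>i j. poly (p j) (x i)) = (\<Prod>j<n. poly.coeff (p j) j) * detm n (\<lambda>i j. x i ^ j)"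
proof -
  have "detm n (\<lambda>i j. poly (p j) (x i)) = detm n (\<lambda>i j. \<Sum>k<n. x i ^ k * poly.coeff (p j) k)"
  proof (rule detm_cong)
    fix i j assume "j < n"
    have "poly (p j) (x i) = (\<Sum>k\<le>degree (p j). poly.coeff (p j) k * x i ^ k)"
      by (rule poly_altdef)
    also have "\<dots> = (\<Sum>k<n. poly.coeff (p j) k * x i ^ k)"
      using assms[of j] \<open>j < n\<close> by (intro sum.mono_neutral_left) (auto simp: coeff_eq_0)
    finally show "poly (p j) (x i) = (\<Sum>k<n. x i ^ k * poly.coeff (p j) k)"
      by (simp add: mult.commute)
  qed
  also have "\<dots> = detm n (\<lambda>i j. x i ^ j) * detm n (\<lambda>k j. poly.coeff (p j) k)"
    by (rule detm_mult)
  also have "detm n (\<lambda>k j. poly.coeff (p j) k) = (\<Prod>j<n. poly.coeff (p j) j)"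
    by (rule detm_upper_triangular) (use assms in \<open>auto intro: coeff_eq_0 le_less_trans\<close>)
  finally show ?thesis by (simp add: mult.commute)
qed

text \<open>The Newton basis at the nodes \<open>x 0, x 1, \<dots>\<close> turns the Vandermonde matrix into a
  triangular one.\<close>

lemma vandermonde_det:
  fixes x :: "nat \<Rightarrow> 'a :: idom"
  shows "detm n (\<lambda>i j. x i ^ j) = (\<Prod>j<n. \<Prod>i<j. x j - x i)"
proof -
  define p where "p j = (\<Prod>k<j. [:- x k, 1:])" for j
  have deg: "degree (p j) = j" for j
    unfolding p_def by (subst degree_prod_eq_sum_degree) auto
  have lead: "poly.coeff (p j) j = 1" for j
    using lead_coeff_prod[of "\<lambda>k. [:- x k, 1:]" "{..<j}"] deg[of j] by (simp add: p_def)
  have "detm n (\<lambda>i j. x i ^ j) = detm n (\<lambda>i j. poly (p j) (x i))"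
    by (subst detm_poly) (auto simp: deg lead)
  also have "\<dots> = (\<Prod>j<n. poly (p j) (x j))"
    by (rule detm_lower_triangular) (auto simp: p_def poly_prod)
  finally show ?thesis by (simp add: p_def poly_prod)
qed

text \<open>\<open>x gchoose j\<close> is a polynomial in x of degree j with leading coefficient 1 /
  j!, and j! is the product of the differences j - i over i < j.\<close>

lemma binomial_det:
  fixes x :: "nat \<Rightarrow> real"
  shows "detm n (\<lambda>i j. x i gchoose j) = (\<Prod>j<n. \<Prod>i<j. (x j - x i) / (real j - real i))"
proof -
  define p :: "nat \<Rightarrow> real poly" where "p j = Polynomial.smult (1 / fact j) (\<Prod>k<j. [:- of_nat k, 1:])" for j
  have deg: "degree (\<Prod>k<j. [:- real k, 1:]) = j" for j
    by (subst degree_prod_eq_sum_degree) auto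
  have lead: "poly.coeff (p j) j = 1 / fact j" for j
    using lead_coeff_prod[of "\<lambda>k. [:- real k, 1:]" "{..<j}"] deg[of j] by (simp add: p_def)
  have degp: "degree (p j) \<le> j" for j
    by (simp add: p_def deg)
  have fact: "(\<Prod>i<j. real j - real i) = fact j" for j
  proof -
    have "(\<Prod>i<j. real j - real i) = (\<Prod>i<j. real (Suc i))"
      by (rule prod.reindex_bij_witness[where i = "\<lambda>i. j - Suc i" and j = "\<lambda>i. j - Suc i"])
        (auto simp: of_nat_diff)
    then show ?thesis
      by (simp only: fact_prod_Suc lessThan_atLeast0 of_nat_prod)
  qed
  have "detm n (\<lambda>i j. x i gchoose j) = detm n (\<lambda>i j. poly (p j) (x i))"
    by (rule detm_cong) (simp add: p_def poly_prod gbinomial_prod_rev lessThan_atLeast0)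
  also have "\<dots> = (\<Prod>j<n. 1 / fact j) * (\<Prod>j<n. \<Prod>i<j. x j - x i)"
    by (subst detm_poly) (simp_all add: lead vandermonde_det degp)
  also have "\<dots> = (\<Prod>j<n. \<Prod>i<j. (x j - x i) / (real j - real i))"
    by (simp add: prod_dividef prod.distrib[symmetric] fact)
  finally show ?thesis .
qed

text \<open>The nodes i - \<lambda>_i increase with i, which gives the differences the signs of the
  definition. The binomial form is chosen because binomials can be summed over intervals by Pascal's
  rule.\<close>

lemma Dim_det: "Dim l = detm (length l) (\<lambda>i j. of_int (int i - l ! i) gchoose j)"
proof -
  have "Dim l = (\<Prod>(j, i)\<in>Sigma {..<length l} (\<lambda>j. {..<j}).
      (of_int (int j - l ! j) - of_int (int i - l ! i)) / (real j - real i))"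
    unfolding Dim_def
    by (rule prod.reindex_bij_witness[where i = prod.swap and j = prod.swap]) (auto simp: algebra_simps)
  then show ?thesis by (simp add: binomial_det prod.Sigma)
qed

lemma Dim_pos:
  assumes "l \<in> signatures"
  shows "Dim l > 0"
  unfolding Dim_def
proof (intro prod_pos, clarsimp)
  fix i j assume "i < j" "j < length l"
  then have "l ! j \<le> l ! i"
    using assms by (auto simp: signatures_def signatures_of_iff)
  then show "0 < (real_of_int (l ! i) - real_of_int (l ! j) - real i + real j) / (real j - real i)"
    using \<open>i < j\<close> by (intro divide_pos_pos) auto
qed

lemma Dim_Nil [simp]: "Dim [] = 1"
  by (simp add: Dim_det)

lemma sum_gbinomial_int:
  assumes "a \<le> b"
  shows "(\<Sum>k\<in>{a..<b}. of_int k gchoose j) = (of_int b gchoose Suc j) - (of_int a gchoose Suc j :: real)"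
  using assms
proof (induction b rule: int_ge_induct)
  case (step b)
  have "{a..<b + 1} = insert b {a..<b}" using step.hyps by auto
  moreover have "(of_int (b + 1) :: real) gchoose Suc j = (of_int b gchoose j) + (of_int b gchoose Suc j)"
    using gbinomial_Suc_Suc[of "of_int b :: real" j] by (simp add: add.commute)
  ultimately show ?case using step.IH by simp
qed simp

text \<open>Summing a row over its interval raises the binomial order by one and leaves a difference
  of two boundary terms. The resulting N by N determinant is what remains of the N + 1 by N + 1
  binomial determinant after subtracting from each row its predecessor.\<close>

lemma Dim_branching:
  assumes "n \<in> signatures_of (Suc N)"
  shows "(\<Sum>l | interlaces l n. Dim l) = Dim n"
proof -
  define y where "y i = int i - n ! i" for i
  have len: "length n = Suc N" using assms by (simp add: signatures_of_iff)
  have mono: "n ! Suc i \<le> n ! i" if "i < N" for i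
    using assms that by (auto simp: signatures_of_iff)
  have box: "{l. interlaces l n} = boxes N (\<lambda>i. {n ! Suc i..n ! i})"
    by (rule interlaces_below[OF len])
  have "(\<Sum>l | interlaces l n. Dim l) =
      (\<Sum>l\<in>boxes N (\<lambda>i. {n ! Suc i..n ! i}). detm N (\<lambda>i j. of_int (int i - l ! i) gchoose j))"
    unfolding box by (rule sum.cong) (auto simp: boxes_def Dim_det)
  also have "\<dots> = detm N (\<lambda>i j. \<Sum>k\<in>{n ! Suc i..n ! i}. of_int (int i - k) gchoose j)"
    by (rule detm_multilinear[symmetric]) simp
  also have "\<dots> = detm N (\<lambda>i j. (of_int (y (Suc i)) gchoose Suc j) - (of_int (y i) gchoose Suc j))"
  proof (rule detm_cong)
    fix i j assume "i < N" "j < N"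
    have "(\<Sum>k\<in>{n ! Suc i..n ! i}. of_int (int i - k) gchoose j) =
        (\<Sum>k\<in>{y i..<y (Suc i)}. real_of_int k gchoose j)"
      by (rule sum.reindex_bij_witness[where i = "\<lambda>k. int i - k" and j = "\<lambda>k. int i - k"])
        (auto simp: y_def)
    also have "\<dots> = (of_int (y (Suc i)) gchoose Suc j) - (of_int (y i) gchoose Suc j)"
      by (rule sum_gbinomial_int) (use mono[OF \<open>i < N\<close>] in \<open>simp add: y_def\<close>)
    finally show "(\<Sum>k\<in>{n ! Suc i..n ! i}. of_int (int i - k) gchoose j) =
        (of_int (y (Suc i)) gchoose Suc j) - (of_int (y i) gchoose Suc j :: real)" .
  qed
  \<comment> \<open>Column 0 consists of ones, so the subtraction clears it below the top entry, and
    expanding along it leaves the differences with the order shifted by one.\<close>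
  also have "\<dots> = detm (Suc N) (\<lambda>i j. (of_int (y i) gchoose j) +
      (if i = 0 then 0 else - 1 * (of_int (y (i - 1)) gchoose j)))"
    by (subst detm_first_column) auto
  also have "\<dots> = detm (Suc N) (\<lambda>i j. of_int (y i) gchoose j)"
    by (rule detm_add_previous_row)
  also have "\<dots> = Dim n" by (simp add: Dim_det len y_def)
  finally show ?thesis .
qed

text \<open>Each factor is 1 + (\<lambda>_i - \<lambda>_j) / (j - i), at most one plus the sum of
  the absolute values, and N * N is a crude count of the pairs. What matters is polynomial growth
  for fixed N.\<close>

lemma Dim_bound:
  assumes "l \<in> signatures_of N"
  shows "Dim l \<le> (1 + (\<Sum>i<N. of_int \<bar>l ! i\<bar>)) ^ (N * N)"
proof -
  define S :: real where "S = (\<Sum>i<N. of_int \<bar>l ! i\<bar>)"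
  have S: "0 \<le> S" unfolding S_def by (rule sum_nonneg) simp
  have len: "length l = N" using assms by (simp add: signatures_of_iff)
  let ?P = "{(i, j). i < j \<and> j < length l}"
  have sub: "?P \<subseteq> {..<N} \<times> {..<N}" using len by auto
  have "Dim l \<le> (\<Prod>(i, j)\<in>?P. 1 + S)"
    unfolding Dim_def
  proof (rule prod_mono, clarify)
    fix i j assume ij: "i < j" "j < length l"
    then have le: "l ! j \<le> l ! i" using assms by (auto simp: signatures_of_iff)
    have "of_int \<bar>l ! i\<bar> + of_int \<bar>l ! j\<bar> = (\<Sum>k\<in>{i, j}. real_of_int \<bar>l ! k\<bar>)" using ij by simp
    also have "\<dots> \<le> S" unfolding S_def by (rule sum_mono2) (use ij len in auto)
    finally have "real_of_int (l ! i) - of_int (l ! j) \<le> S" by linarith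
    moreover have "S \<le> S * (real j - real i)"
      using S ij by (intro mult_right_le_one_le mult_le_cancel_left1[THEN iffD2]) auto
    ultimately have "real_of_int (l ! i) - of_int (l ! j) - real i + real j \<le> (1 + S) * (real j - real i)"
      by (simp add: algebra_simps)
    then show "0 \<le> real_of_int (l ! i - l ! j - int i + int j) / real_of_int (int j - int i) \<and>
        real_of_int (l ! i - l ! j - int i + int j) / real_of_int (int j - int i) \<le> 1 + S"
      using ij le by (auto simp: field_simps)
  qed
  also have "\<dots> = (1 + S) ^ card ?P" by (simp add: case_prod_unfold)
  also have "\<dots> \<le> (1 + S) ^ (N * N)"
    using card_mono[OF _ sub] S by (intro power_increasing) auto
  finally show ?thesis by (simp add: S_def)
qed

section \<open>The Pieri rule\<close>

lemma sum_int_interval_telescope: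
  fixes c :: "int \<Rightarrow> 'a :: ab_group_add"
  assumes "a \<le> b + 1"
  shows "(\<Sum>n\<in>{a..b}. c n) - (\<Sum>n\<in>{a..b}. c (n + 1)) = c a - c (b + 1)"
proof (cases "a = b + 1")
  case False
  have "(\<Sum>n\<in>{a..b}. c (n + 1)) = (\<Sum>n\<in>{a + 1..b + 1}. c n)"
    by (rule sum.reindex_bij_witness[where i = "\<lambda>n. n - 1" and j = "\<lambda>n. n + 1"]) auto
  moreover have "{a..b} = insert a {a + 1..b}" "{a + 1..b + 1} = insert (b + 1) {a + 1..b}"
    using False assms by auto
  ultimately show ?thesis by simp
qed simp

text \<open>For finitely supported c the sum over the interlacing v is a box sum, hence one
  determinant whose rows are sums of c over intervals. Row and column subtractions turn it into the
  determinant of l, bordered by a last row that is zero except for the total sum of c.\<close>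

lemma pieri_window:
  fixes c :: "int \<Rightarrow> 'a :: comm_ring_1"
  assumes l: "l \<in> signatures_of N" and H: "\<And>x. x \<in> set l \<Longrightarrow> \<bar>x\<bar> \<le> H" "0 \<le> H"
    and c: "\<And>n. H < \<bar>n\<bar> \<Longrightarrow> c n = 0"
  shows "(\<Sum>v | interlaces l v \<and> set v \<subseteq> {- H..H}. jacobi_trudi c v) =
    (\<Sum>n\<in>{- H..H}. c n) * jacobi_trudi c l"
proof -
  have len: "length l = N" using l by (rule signatures_of_length)
  have bd: "- H \<le> l ! i" "l ! i \<le> H" if "i < N" for i
    using H(1)[of "l ! i"] that len by (auto simp: abs_le_iff)
  \<comment> \<open>\<open>d\<close> and \<open>u\<close> are the lower and upper bounds of the
    entries of v; the two bounds that interlacing leaves open are supplied by the window.\<close>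
  define d where "d i = (if i < N then l ! i else - H)" for i
  define u where "u i = (if i = 0 then H else l ! (i - 1))" for i
  \<comment> \<open>Tail sums of c started at \<open>d i - i\<close>: since
    \<open>u i = d (i - 1)\<close> for positive i, the shifted intervals of neighbouring rows are
    adjacent, so each interval sum is a difference of two consecutive tails.\<close>
  define A where "A i j = (\<Sum>n\<in>{d i - int i..H}. c (n + int j))" for i j :: nat
  have box: "{v. interlaces l v \<and> set v \<subseteq> {- H..H}} = boxes (Suc N) (\<lambda>i. {d i..u i})"
  proof (intro equalityI subsetI)
    fix v assume "v \<in> {v. interlaces l v \<and> set v \<subseteq> {- H..H}}"
    then have v: "length v = Suc N" "\<And>i. i < N \<Longrightarrow> v ! Suc i \<le> l ! i \<and> l ! i \<le> v ! i"
        "set v \<subseteq> {- H..H}"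
      by (auto simp: interlaces_def len)
    show "v \<in> boxes (Suc N) (\<lambda>i. {d i..u i})"
    proof (rule boxesI)
      fix i assume i: "i < Suc N"
      then have "v ! i \<in> {- H..H}" by (intro subsetD[OF v(3)] nth_mem) (simp add: v(1))
      then show "v ! i \<in> {d i..u i}"
        using v(2)[of i] v(2)[of "i - 1"] i by (auto simp: d_def u_def)
    qed (rule v(1))
  next
    fix v assume "v \<in> boxes (Suc N) (\<lambda>i. {d i..u i})"
    then have v: "length v = Suc N" "\<And>i. i \<le> N \<Longrightarrow> v ! i \<in> {d i..u i}"
      by (auto simp: boxes_def)
    have "interlaces l v"
      unfolding interlaces_def
    proof (intro conjI allI impI)
      fix i assume i: "i < length l"
      show "v ! Suc i \<le> l ! i" using v(2)[of "Suc i"] i len by (auto simp: u_def)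
      show "l ! i \<le> v ! i" using v(2)[of i] i len by (auto simp: d_def)
    qed (simp add: v len)
    moreover have "set v \<subseteq> {- H..H}"
    proof
      fix x assume "x \<in> set v"
      then obtain i where i: "i \<le> N" "x = v ! i" by (auto simp: in_set_conv_nth v(1) less_Suc_eq_le)
      have "- H \<le> d i" using bd by (auto simp: d_def)
      moreover have "u i \<le> H" using bd i H by (auto simp: u_def)
      ultimately show "x \<in> {- H..H}" using v(2)[OF i(1)] i(2) by auto
    qed
    ultimately show "v \<in> {v. interlaces l v \<and> set v \<subseteq> {- H..H}}" by simp
  qed
  have mono: "d (Suc i) \<le> d i" if "i < N" for i
    using l bd that by (auto simp: d_def signatures_of_iff)
  have top: "d i - int i \<le> H + 1" for i
    using bd[of i] H by (auto simp: d_def)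
  have "(\<Sum>v | interlaces l v \<and> set v \<subseteq> {- H..H}. jacobi_trudi c v) =
      (\<Sum>v\<in>boxes (Suc N) (\<lambda>i. {d i..u i}). detm (Suc N) (\<lambda>i j. c (v ! i - int i + int j)))"
    unfolding box by (rule sum.cong) (auto simp: boxes_def jacobi_trudi_detm)
  also have "\<dots> = detm (Suc N) (\<lambda>i j. \<Sum>k\<in>{d i..u i}. c (k - int i + int j))"
    by (rule detm_multilinear[symmetric]) simp
  also have "\<dots> = detm (Suc N) (\<lambda>i j. A i j + (if i = 0 then 0 else - 1 * A (i - 1) j))"
  proof (rule detm_cong)
    fix i j assume i: "i < Suc N"
    have "(\<Sum>k\<in>{d i..u i}. c (k - int i + int j)) = (\<Sum>n\<in>{d i - int i..u i - int i}. c (n + int j))"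
      by (rule sum.reindex_bij_witness[where i = "\<lambda>n. n + int i" and j = "\<lambda>k. k - int i"]) auto
    also have "\<dots> = A i j + (if i = 0 then 0 else - 1 * A (i - 1) j)"
    proof (cases i)
      case (Suc i')
      then have "i' < N" using i by simp
      then have "{d i - int i..H} = {d i - int i..u i - int i} \<union> {d i' - int i'..H}"
          "{d i - int i..u i - int i} \<inter> {d i' - int i'..H} = {}"
        using mono[of i'] top[of i'] Suc bd[of i'] by (auto simp: u_def d_def)
      then have "A i j = (\<Sum>n\<in>{d i - int i..u i - int i}. c (n + int j)) + A i' j"
        unfolding A_def by (simp add: sum.union_disjoint)
      then show ?thesis using Suc by simp
    qed (simp add: A_def u_def)
    finally show "(\<Sum>k\<in>{d i..u i}. c (k - int i + int j)) =
        A i j + (if i = 0 then 0 else - 1 * A (i - 1) j)" .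
  qed
  also have "\<dots> = detm (Suc N) A"
    by (rule detm_add_previous_row)
  also have "\<dots> = detm (Suc N) (\<lambda>i j. A i j + (if Suc j < Suc N then - 1 * A i (Suc j) else 0))"
    using detm_add_next_column[of "Suc N" A "\<lambda>_. - 1"] by simp
  \<comment> \<open>A difference of neighbouring columns is a tail minus the same tail shifted by
    one; the boundary term at the top lies beyond the window and vanishes.\<close>
  also have "\<dots> = detm (Suc N) (\<lambda>i j. if j < N then c (d i - int i + int j) else A i N)"
  proof (rule detm_cong)
    fix i j assume ij: "j < Suc N"
    show "A i j + (if Suc j < Suc N then - 1 * A i (Suc j) else 0) =
        (if j < N then c (d i - int i + int j) else A i N)"
    proof (cases "j < N")
      case True
      have "A i j - A i (Suc j) = c (d i - int i + int j) - c (H + 1 + int j)"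
        using sum_int_interval_telescope[OF top, of "\<lambda>n. c (n + int j)" i]
        by (simp add: A_def algebra_simps)
      moreover have "c (H + 1 + int j) = 0" using c[of "H + 1 + int j"] H by simp
      ultimately show ?thesis using True by simp
    next
      case False
      then show ?thesis using ij by (simp add: less_Suc_eq)
    qed
  qed
  \<comment> \<open>In the last row \<open>d N = - H\<close>, so the arguments - H - N + j with j <
    N lie below the window and only the corner entry survives.\<close>
  also have "\<dots> = A N N * detm N (\<lambda>i j. if j < N then c (d i - int i + int j) else A i N)"
    by (subst detm_last_row) (use c H in \<open>auto simp: d_def\<close>)
  also have "detm N (\<lambda>i j. if j < N then c (d i - int i + int j) else A i N) = jacobi_trudi c l"
    unfolding jacobi_trudi_detm len by (rule detm_cong) (auto simp: d_def)
  also have "A N N = (\<Sum>n\<in>{- H..H + int N}. c n)"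
    unfolding A_def d_def
    by (rule sum.reindex_bij_witness[where i = "\<lambda>n. n - int N" and j = "\<lambda>k. k + int N"]) auto
  also have "\<dots> = (\<Sum>n\<in>{- H..H}. c n)"
    by (rule sum.mono_neutral_right) (use c H in auto)
  finally show ?thesis .
qed

section \<open>Monomial coefficients of the \<open>\<sigma>\<^sub>\<lambda>\<close>\<close>

lemma coeff_add [simp]: "coeff (a + b) M = coeff a M + coeff b M"
  by (simp add: plus_bseries.rep_eq)

lemma coeff_zero [simp]: "coeff 0 M = 0"
  by (simp add: zero_bseries.rep_eq)

lemma coeff_one: "coeff 1 M = (if M = {#} then 1 else 0)"
  by (simp add: one_bseries.rep_eq)

lemma coeff_minus [simp]: "coeff (- a) M = - coeff a M" "coeff (a - b) M = coeff a M - coeff b M"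
  by (simp_all only: uminus_bseries.rep_eq minus_bseries_def plus_bseries.rep_eq diff_conv_add_uminus)

lemma coeff_bscale [simp]: "coeff (bscale z a) M = z * coeff a M"
  by (simp add: bscale.rep_eq)

lemma coeff_sum: "coeff (\<Sum>i\<in>I. f i) M = (\<Sum>i\<in>I. coeff (f i) M)"
  by (induction I rule: infinite_finite_induct) auto

lemma coeff_times: "coeff (a * b) M = (\<Sum>(A, B) | A + B = M. coeff a A * coeff b B)"
  by (simp add: times_bseries.rep_eq)

lemma coeff_sign_mult: "coeff (of_int (sign p) * a) M = of_int (sign p) * coeff a M"
  by (cases p rule: sign_cases) simp_all

text \<open>A decomposition whose first part is a singleton removes one letter from M, and equal
  letters give the same decomposition; hence the sum over distinct letters.\<close>

lemma coeff_phi_mult: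
  "coeff (phi * a) M = (\<Sum>n\<in>set_mset M. coeff a (M - {#n#}))"
proof -
  have "coeff (phi * a) M = (\<Sum>(A, B)\<in>(\<lambda>n. ({#n#}, M - {#n#})) ` set_mset M. coeff phi A * coeff a B)"
    unfolding coeff_times
  proof (rule sum.mono_neutral_right)
    show "\<forall>p\<in>{(A, B). A + B = M} - (\<lambda>n. ({#n#}, M - {#n#})) ` set_mset M.
        (case p of (A, B) \<Rightarrow> coeff phi A * coeff a B) = 0"
    proof clarify
      fix A B :: "int multiset" assume AB: "(A, B) \<notin> (\<lambda>n. ({#n#}, A + B - {#n#})) ` set_mset (A + B)"
      have "size A \<noteq> 1"
      proof
        assume "size A = 1"
        then obtain n where "A = {#n#}" using size_1_singleton_mset by blast
        then show False using AB by (auto simp: image_iff)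
      qed
      then show "coeff phi A * coeff a B = 0" by (simp add: phi.rep_eq)
    qed
  qed (auto simp: finite_decompositions)
  also have "\<dots> = (\<Sum>n\<in>set_mset M. coeff a (M - {#n#}))"
    by (subst sum.reindex) (auto simp: inj_on_def phi.rep_eq)
  finally show ?thesis .
qed

lemma coeff_var_mult:
  "coeff (var n * a) M = (if n \<in># M then coeff a (M - {#n#}) else 0)"
proof (cases "n \<in># M")
  case True
  have "coeff (var n * a) M = (\<Sum>(A, B)\<in>{({#n#}, M - {#n#})}. coeff (var n) A * coeff a B)"
    unfolding coeff_times
    by (rule sum.mono_neutral_right)
      (use True in \<open>auto simp: finite_decompositions var.rep_eq split: if_splits\<close>)
  then show ?thesis using True by (simp add: var.rep_eq)
next
  case False
  have "coeff (var n * a) M = 0"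
    unfolding coeff_times by (rule sum.neutral) (use False in \<open>auto simp: var.rep_eq\<close>)
  then show ?thesis using False by simp
qed

lemma coeff_prod_var:
  "coeff (\<Prod>i = 0..<n. var (f i)) M = (if M = mset (map f [0..<n]) then 1 else 0)"
proof (induction n arbitrary: M)
  case (Suc n)
  have "(\<Prod>i = 0..<Suc n. var (f i)) = var (f n) * (\<Prod>i = 0..<n. var (f i))"
    by (simp add: mult.commute)
  moreover have "f n \<in># M \<and> M - {#f n#} = mset (map f [0..<n]) \<longleftrightarrow> M = mset (map f [0..<Suc n])"
    by (auto simp del: mset_map simp: mset_map[symmetric] dest!: insert_DiffM)
  ultimately show ?case by (simp only: coeff_var_mult Suc.IH) auto
qed (simp add: coeff_one)

text \<open>The monomial of the term that belongs to \<open>p\<close> in the Leibniz expansion of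
  \<open>sigma l\<close>.\<close>

definition index_mset :: "int list \<Rightarrow> (nat \<Rightarrow> nat) \<Rightarrow> int multiset" where
  "index_mset l p = mset (map (\<lambda>i. l ! i - int i + int (p i)) [0..<length l])"

text \<open>Killing the variables outside W does not affect the coefficients at monomials in W. The
  full range of indices describes \<open>sigma\<close> itself; a finite W gives access to identities
  for finitely supported sequences.\<close>

lemma coeff_jacobi_trudi_window:
  assumes "set_mset M \<subseteq> W"
  shows "coeff (jacobi_trudi (\<lambda>n. if n \<in> W then var n else 0) l) M =
    (\<Sum>p | p permutes {0..<length l} \<and> index_mset l p = M. of_int (sign p))"
proof -
  let ?c = "\<lambda>n. if n \<in> W then var n else 0"
  have "coeff (jacobi_trudi ?c l) M = (\<Sum>p | p permutes {0..<length l}.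
      of_int (sign p) * coeff (\<Prod>i = 0..<length l. ?c (l ! i - int i + int (p i))) M)"
    by (simp add: jacobi_trudi_detm detm_leibniz coeff_sum coeff_sign_mult)
  also have "\<dots> = (\<Sum>p | p permutes {0..<length l}. if index_mset l p = M then of_int (sign p) else 0)"
  proof (rule sum.cong[OF refl])
    fix p
    let ?f = "\<lambda>i. l ! i - int i + int (p i)"
    have "coeff (\<Prod>i = 0..<length l. ?c (?f i)) M = (if index_mset l p = M then 1 else 0)"
    proof (cases "\<forall>i<length l. ?f i \<in> W")
      case True
      then have "(\<Prod>i = 0..<length l. ?c (?f i)) = (\<Prod>i = 0..<length l. var (?f i))"
        by (intro prod.cong) auto
      then show ?thesis by (auto simp: coeff_prod_var index_mset_def)
    next
      case False
      then obtain i where i: "i < length l" "?f i \<notin> W" by blast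
      then have "(\<Prod>i = 0..<length l. ?c (?f i)) = 0" by (intro prod_zero) auto
      moreover have "?f i \<in># index_mset l p" using i by (auto simp: index_mset_def)
      ultimately show ?thesis using i assms by auto
    qed
    then show "of_int (sign p) * coeff (\<Prod>i = 0..<length l. ?c (?f i)) M =
        (if index_mset l p = M then of_int (sign p) else 0)" by simp
  qed
  also have "\<dots> = (\<Sum>p | p permutes {0..<length l} \<and> index_mset l p = M. of_int (sign p))"
    by (subst sum.inter_filter[symmetric]) (auto simp: finite_permutations)
  finally show ?thesis .
qed

lemma coeff_sigma:
  "coeff (sigma l) M = (\<Sum>p | p permutes {0..<length l} \<and> index_mset l p = M. of_int (sign p))"
  using coeff_jacobi_trudi_window[of M UNIV l] by (simp add: sigma_def)

lemma coeff_sigma_nonzeroD: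
  assumes "coeff (sigma l) M \<noteq> 0"
  obtains p where "p permutes {0..<length l}" "index_mset l p = M"
  using assms unfolding coeff_sigma by (metis (mono_tags, lifting) mem_Collect_eq sum.neutral)

lemma size_index_mset [simp]: "size (index_mset l p) = length l"
  by (simp add: index_mset_def)

text \<open>The shifts p(i) - i add up to zero. This conserved weight later determines which letter
  of a monomial a step of a pattern removes.\<close>

lemma sum_index_mset:
  assumes "p permutes {0..<length l}"
  shows "sum_mset (index_mset l p) = sum_list l"
proof -
  have "sum_mset (index_mset l p) = (\<Sum>i = 0..<length l. l ! i - int i + int (p i))"
    by (simp only: index_mset_def sum_mset_sum_list) (simp add: sum_list_sum_nth)
  also have "\<dots> = (\<Sum>i = 0..<length l. l ! i) - (\<Sum>i = 0..<length l. int i) + (\<Sum>i = 0..<length l. int (p i))"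
    by (simp add: sum.distrib sum_subtractf)
  also have "(\<Sum>i = 0..<length l. int (p i)) = (\<Sum>i = 0..<length l. int i)"
    using sum.permute[OF assms, of int] by (simp add: o_def)
  finally show ?thesis by (simp add: sum_list_sum_nth)
qed

lemma index_mset_entry:
  assumes "p permutes {0..<length l}" "x \<in> set l"
  shows "\<exists>y\<in>#index_mset l p. \<bar>x - y\<bar> \<le> int (length l)"
proof -
  obtain i where i: "i < length l" "x = l ! i" using assms(2) by (auto simp: in_set_conv_nth)
  have "p i < length l" using permutes_in_image[OF assms(1), of i] i by simp
  then have "\<bar>x - (l ! i - int i + int (p i))\<bar> \<le> int (length l)" using i by auto
  moreover have "l ! i - int i + int (p i) \<in># index_mset l p" using i by (auto simp: index_mset_def)
  ultimately show ?thesis by blast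
qed

lemma coeff_sigma_nonzero:
  assumes "coeff (sigma l) M \<noteq> 0"
  shows "length l = size M" "sum_list l = sum_mset M"
    "\<And>x. x \<in> set l \<Longrightarrow> \<exists>y\<in>#M. \<bar>x - y\<bar> \<le> int (size M)"
proof -
  obtain p where p: "p permutes {0..<length l}" "index_mset l p = M"
    using assms by (rule coeff_sigma_nonzeroD)
  show "length l = size M" using size_index_mset[of l p] p by simp
  then show "\<exists>y\<in>#M. \<bar>x - y\<bar> \<le> int (size M)" if "x \<in> set l" for x
    using index_mset_entry[OF p(1) that] p(2) by simp
  show "sum_list l = sum_mset M" using sum_index_mset[OF p(1)] p(2) by simp
qed

definition support :: "int multiset \<Rightarrow> int list set" where
  "support M = {l \<in> signatures. coeff (sigma l) M \<noteq> 0}"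

text \<open>Every entry of a contributing signature lies within distance \<open>size M\<close> of
  some letter of M.\<close>

lemma finite_support: "finite (support M)"
proof (rule finite_subset)
  let ?W = "\<Union>y\<in>set_mset M. {y - int (size M)..y + int (size M)}"
  show "support M \<subseteq> {l. set l \<subseteq> ?W \<and> length l = size M}"
  proof
    fix l assume "l \<in> support M"
    then have nz: "coeff (sigma l) M \<noteq> 0" by (simp add: support_def)
    have "set l \<subseteq> ?W"
    proof
      fix x assume "x \<in> set l"
      then obtain y where "y \<in># M" "\<bar>x - y\<bar> \<le> int (size M)" using coeff_sigma_nonzero(3)[OF nz] by blast
      then show "x \<in> ?W" by (intro UN_I[of y]) auto
    qed
    then show "l \<in> {l. set l \<subseteq> ?W \<and> length l = size M}"
      using coeff_sigma_nonzero(1)[OF nz] by simp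
  qed
  show "finite {l. set l \<subseteq> ?W \<and> length l = size M}" by (rule finite_lists_length_eq) auto
qed

text \<open>A permutation other than the identity has an inversion, and undoing it lowers the sum
  because n decreases strictly. A minimizer over the finitely many permutations is therefore the
  identity, and one improvement step away from p makes the inequality strict.\<close>

lemma rearrangement_strict:
  fixes n :: "nat \<Rightarrow> int"
  assumes n: "\<And>i j. i < j \<Longrightarrow> j < N \<Longrightarrow> n j < n i" and p: "p permutes {0..<N}" "p \<noteq> id"
  shows "(\<Sum>i = 0..<N. n i * int i) < (\<Sum>i = 0..<N. n i * int (p i))"
proof -
  define F where "F q = (\<Sum>i = 0..<N. n i * int (q i))" for q :: "nat \<Rightarrow> nat"
  let ?S = "{q. q permutes {0..<N}}"
  have improve: "\<exists>q'\<in>?S. F q' < F q" if q: "q \<in> ?S" "q \<noteq> id" for q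
  proof -
    have "\<exists>i j. i < j \<and> j < N \<and> q j < q i"
    proof (rule ccontr)
      assume H: "\<nexists>i j. i < j \<and> j < N \<and> q j < q i"
      have inj: "inj q" using q permutes_inj by auto
      have less: "q i < q j" if "i < j" "j < N" for i j
      proof -
        have "\<not> q j < q i" using H that by blast
        moreover have "q i \<noteq> q j" using inj that by (auto dest: injD)
        ultimately show ?thesis by linarith
      qed
      have "i \<le> q i" if "i < N" for i
        using that
      proof (induction i)
        case (Suc i)
        then show ?case using less[of i "Suc i"] by simp
      qed simp
      then have "q = id" using q by (intro permutes_natset_ge[of q "{0..<N}"]) auto
      then show False using q by simp
    qed
    then obtain i j where ij: "i < j" "j < N" "q j < q i" by blast
    define q' where "q' = q \<circ> Transposition.transpose i j"
    have "q' permutes {0..<N}"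
      unfolding q'_def using q ij by (intro permutes_compose permutes_swap_id) auto
    moreover have "F q' < F q"
    proof -
      let ?R = "{0..<N} - {i, j}"
      have split: "F r = n i * int (r i) + (n j * int (r j) + (\<Sum>k\<in>?R. n k * int (r k)))" for r
      proof -
        have "{0..<N} = insert i (insert j ?R)" using ij by auto
        then have "F r = (\<Sum>k\<in>insert i (insert j ?R). n k * int (r k))" unfolding F_def by simp
        also have "\<dots> = n i * int (r i) + (n j * int (r j) + (\<Sum>k\<in>?R. n k * int (r k)))"
          using ij by (subst sum.insert) (auto simp: sum.insert)
        finally show ?thesis .
      qed
      have "(\<Sum>k\<in>?R. n k * int (q' k)) = (\<Sum>k\<in>?R. n k * int (q k))"
        by (rule sum.cong) (auto simp: q'_def Transposition.transpose_def)
      then have "F q' - F q = (n i - n j) * (int (q j) - int (q i))"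
        by (simp add: split q'_def algebra_simps)
      also have "\<dots> < 0" using ij n[OF ij(1,2)] by (intro mult_pos_neg) auto
      finally show ?thesis by simp
    qed
    ultimately show ?thesis by blast
  qed
  have S: "finite ?S" "?S \<noteq> {}" by (auto simp: finite_permutations intro: exI[of _ id] permutes_id)
  define q where "q = arg_min_on F ?S"
  have q: "q \<in> ?S" unfolding q_def by (rule arg_min_if_finite(1)[OF S])
  have min: "F q \<le> F r" if "r \<in> ?S" for r
    unfolding q_def by (rule arg_min_least[OF S that])
  have "q = id"
  proof (rule ccontr)
    assume "q \<noteq> id"
    then obtain r where "r \<in> ?S" "F r < F q" using improve[OF q] by blast
    then show False using min[of r] by simp
  qed
  moreover obtain r where "r \<in> ?S" "F r < F p" using improve[of p] p by auto
  ultimately have "F id < F p" using min[of r] by simp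
  then show ?thesis by (simp add: F_def)
qed

text \<open>By the rearrangement inequality the sum of squares orders the monomials in such a way that the
  passage from the \<open>\<sigma>\<^sub>\<lambda>\<close> to the monomials is unitriangular.\<close>

definition square_sum :: "int multiset \<Rightarrow> int" where
  "square_sum M = (\<Sum>x\<in>#M. x\<^sup>2)"

lemma square_sum_nonneg: "0 \<le> square_sum M"
  unfolding square_sum_def by (induction M) auto

text \<open>With n_i = \<lambda>_i - i the letters are n_i + p(i); in the sum of their squares only
  the cross term depends on p, and the identity is its only minimizer.\<close>

lemma square_sum_index_mset:
  assumes l: "l \<in> signatures" and p: "p permutes {0..<length l}" "p \<noteq> id"
  shows "square_sum (mset l) < square_sum (index_mset l p)"
proof -
  define n where "n i = l ! i - int i" for i
  let ?I = "{0..<length l}"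
  have sq: "square_sum (mset (map f [0..<m])) = (\<Sum>i = 0..<m. (f i)\<^sup>2)" for f m
    by (simp only: square_sum_def mset_map[symmetric] sum_mset_sum_list) (simp add: sum_list_sum_nth)
  have "l = map (\<lambda>i. n i + int i) [0..<length l]" by (simp add: n_def map_nth)
  then have "square_sum (mset l) = (\<Sum>i\<in>?I. (n i + int i)\<^sup>2)" using sq by metis
  also have "\<dots> = (\<Sum>i\<in>?I. (n i)\<^sup>2) + (\<Sum>i\<in>?I. (int i)\<^sup>2) + 2 * (\<Sum>i\<in>?I. n i * int i)"
    by (simp add: power2_sum sum.distrib sum_distrib_left mult.assoc)
  also have "\<dots> < (\<Sum>i\<in>?I. (n i)\<^sup>2) + (\<Sum>i\<in>?I. (int i)\<^sup>2) + 2 * (\<Sum>i\<in>?I. n i * int (p i))"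
  proof -
    have "n j < n i" if "i < j" "j < length l" for i j
    proof -
      have "l ! j \<le> l ! i" using l that by (auto simp: signatures_iff signatures_of_iff)
      then show ?thesis using that by (simp add: n_def)
    qed
    then show ?thesis using rearrangement_strict[OF _ p, of n] by simp
  qed
  also have "(\<Sum>i\<in>?I. (int i)\<^sup>2) = (\<Sum>i\<in>?I. (int (p i))\<^sup>2)"
    using sum.permute[OF p(1), of "\<lambda>i. (int i)\<^sup>2"] by (simp add: o_def)
  also have "(\<Sum>i\<in>?I. (n i)\<^sup>2) + (\<Sum>i\<in>?I. (int (p i))\<^sup>2) + 2 * (\<Sum>i\<in>?I. n i * int (p i)) =
      (\<Sum>i\<in>?I. (n i + int (p i))\<^sup>2)"
    by (simp add: power2_sum sum.distrib sum_distrib_left mult.assoc)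
  also have "\<dots> = square_sum (index_mset l p)"
    by (simp add: index_mset_def sq n_def del: mset_map)
  finally show ?thesis .
qed

lemma index_mset_id [simp]: "index_mset l id = mset l"
  by (simp add: index_mset_def map_nth)

lemma coeff_sigma_self:
  assumes "l \<in> signatures"
  shows "coeff (sigma l) (mset l) = 1"
proof -
  have "{p. p permutes {0..<length l} \<and> index_mset l p = mset l} = {id}"
    using square_sum_index_mset[OF assms] by (force simp: permutes_id)
  then show ?thesis by (simp add: coeff_sigma sign_id)
qed

lemma square_sum_support:
  assumes "l \<in> support M"
  shows "square_sum (mset l) < square_sum M \<or> mset l = M"
proof -
  obtain p where "p permutes {0..<length l}" "index_mset l p = M" "l \<in> signatures"
    using assms coeff_sigma_nonzeroD[of l M] by (auto simp: support_def)
  then show ?thesis using square_sum_index_mset[of l p] by (cases "p = id") auto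
qed

lemma signatures_mset_inj:
  assumes "l \<in> signatures" "n \<in> signatures" "mset l = mset n"
  shows "l = n"
proof -
  have "sorted (rev l)" "sorted (rev n)"
    using assms(1,2) by (auto simp: signatures_def signatures_of_def sorted_wrt_rev)
  then have "rev l = rev n"
    using properties_for_sort[of "rev l" "rev n"] assms(3) by (simp add: sorted_sort_id)
  then show ?thesis by simp
qed

text \<open>Only finitely many of the variables are relevant for the coefficient at a given monomial, so the
  identity for finitely supported sequences applies.\<close>

lemma coeff_phi_sigma:
  assumes l: "l \<in> signatures"
  shows "coeff (phi * sigma l) M = (\<Sum>v | interlaces l v \<and> v \<in> support M. coeff (sigma v) M)"
proof -
  \<comment> \<open>The window holds the letters of l and M and the entries of all signatures
    contributing at M, so the truncated Pieri sum misses none of them.\<close>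
  define H where "H = Max (insert 0 (abs ` (set l \<union> set_mset M \<union> \<Union>(set ` support M))))"
  have fin: "finite (insert 0 (abs ` (set l \<union> set_mset M \<union> \<Union>(set ` support M))))"
    using finite_support by auto
  have H: "\<bar>x\<bar> \<le> H" if "x \<in> set l \<union> set_mset M \<union> \<Union>(set ` support M)" for x
    unfolding H_def by (rule Max_ge[OF fin]) (use that in auto)
  have H0: "0 \<le> H" unfolding H_def by (rule Max_ge[OF fin]) auto
  define c where "c n = (if n \<in> {- H..H} then var n else 0)" for n
  have jt: "coeff (jacobi_trudi c v) A = coeff (sigma v) A" if "A \<subseteq># M" for v A
  proof -
    have "set_mset A \<subseteq> {- H..H}"
    proof
      fix x assume "x \<in> set_mset A"
      then have "x \<in> set_mset M" using that by (meson mset_subset_eqD)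
      then have "\<bar>x\<bar> \<le> H" by (intro H) simp
      then show "x \<in> {- H..H}" by auto
    qed
    from coeff_jacobi_trudi_window[OF this, of v] show ?thesis
      by (simp add: c_def[abs_def] coeff_sigma)
  qed
  have csum: "coeff (\<Sum>n\<in>{- H..H}. c n) A = coeff phi A" if "A \<subseteq># M" for A
  proof (cases "size A = 1")
    case True
    then obtain n where n: "A = {#n#}" using size_1_singleton_mset by blast
    then have "n \<in># M" using that by simp
    then have "\<bar>n\<bar> \<le> H" by (intro H) simp
    then have nH: "n \<in> {- H..H}" by auto
    have "coeff (\<Sum>n\<in>{- H..H}. c n) A = (\<Sum>k\<in>{- H..H}. if k = n then 1 else 0)"
      unfolding coeff_sum by (rule sum.cong) (auto simp: c_def var.rep_eq n)
    also have "\<dots> = 1" using nH by (simp only: sum.delta finite_atLeastAtMost_int) simp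
    finally show ?thesis using True by (simp add: phi.rep_eq)
  next
    case False
    then have "A \<noteq> {#k#}" for k by auto
    then have "coeff (\<Sum>n\<in>{- H..H}. c n) A = 0"
      unfolding coeff_sum by (intro sum.neutral) (simp add: c_def var.rep_eq)
    then show ?thesis using False by (simp add: phi.rep_eq)
  qed
  have "coeff (phi * sigma l) M = coeff ((\<Sum>n\<in>{- H..H}. c n) * jacobi_trudi c l) M"
    unfolding coeff_times
    by (rule sum.cong) (auto simp: jt csum)
  also have "(\<Sum>n\<in>{- H..H}. c n) * jacobi_trudi c l =
      (\<Sum>v | interlaces l v \<and> set v \<subseteq> {- H..H}. jacobi_trudi c v)"
    by (rule pieri_window[symmetric, of l "length l"]) (use l H H0 in \<open>auto simp: signatures_iff c_def\<close>)
  also have "coeff \<dots> M = (\<Sum>v | interlaces l v \<and> set v \<subseteq> {- H..H}. coeff (sigma v) M)"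
    by (simp add: coeff_sum jt)
  also have "\<dots> = (\<Sum>v | interlaces l v \<and> v \<in> support M. coeff (sigma v) M)"
  proof (rule sum.mono_neutral_right)
    show "finite {v. interlaces l v \<and> set v \<subseteq> {- H..H}}"
      by (rule finite_subset[OF _ finite_lists_length_eq[of "{- H..H}" "Suc (length l)"]])
        (auto simp: interlaces_def)
    show "{v. interlaces l v \<and> v \<in> support M} \<subseteq> {v. interlaces l v \<and> set v \<subseteq> {- H..H}}"
    proof clarify
      fix v x assume v: "v \<in> support M" "x \<in> set v"
      then have "\<bar>x\<bar> \<le> H" by (intro H) auto
      then show "x \<in> {- H..H}" by auto
    qed
    show "\<forall>v\<in>{v. interlaces l v \<and> set v \<subseteq> {- H..H}} - {v. interlaces l v \<and> v \<in> support M}.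
        coeff (sigma v) M = 0"
      using interlaces_signature by (auto simp: support_def)
  qed
  finally show ?thesis .
qed

section \<open>Expansion in the \<open>\<sigma>\<^sub>\<lambda>\<close>\<close>

text \<open>The sum of \<open>f\<close> over the weights of all Gelfand-Tsetlin patterns with top row \<open>v\<close>.\<close>

primrec gt_sum :: "nat \<Rightarrow> int list \<Rightarrow> (int list \<Rightarrow> 'a :: comm_monoid_add) \<Rightarrow> 'a" where
  "gt_sum 0 v f = f []"
| "gt_sum (Suc N) v f =
    (\<Sum>l | interlaces l v. gt_sum N l (\<lambda>m. f ((sum_list v - sum_list l) # m)))"

lemma support_length: "v \<in> support M \<Longrightarrow> length v = size M"
  by (simp add: support_def coeff_sigma_nonzero(1))

lemma support_sum: "v \<in> support M \<Longrightarrow> sum_list v = sum_mset M"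
  by (simp add: support_def coeff_sigma_nonzero(2))

lemma sum_support_superset:
  assumes "finite S" "support M \<subseteq> S" "S \<subseteq> signatures"
  shows "(\<Sum>v\<in>support M. g v * coeff (sigma v) M) = (\<Sum>v\<in>S. g v * coeff (sigma v) M)"
  by (rule sum.mono_neutral_left) (use assms in \<open>auto simp: support_def\<close>)

text \<open>The iterated Pieri rule for noncommuting letters, f being a function of words.
  Collecting the top rows v over a fixed second row l gives the coefficient of
  \<open>phi * sigma l\<close> at M, in which one letter of M is split off; the rows below are
  covered by the induction hypothesis for the remaining letters.\<close>

lemma gt_sum_expansion:
  fixes f :: "int list \<Rightarrow> complex"
  assumes "size M = N"
  shows "(\<Sum>v\<in>support M. gt_sum N v f * coeff (sigma v) M) = (\<Sum>m\<in>permutations_of_multiset M. f m)"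
  using assms
proof (induction N arbitrary: M f)
  case 0
  have sig: "sigma [] = 1" by (simp add: sigma_def jacobi_trudi_def)
  have "support M \<subseteq> {[]}" using support_length[of _ M] 0 by auto
  moreover have "[] \<in> support M" using 0 by (simp add: support_def sig coeff_one signatures_iff signatures_of_iff)
  ultimately have "support M = {[]}" by blast
  then show ?case using 0 by (simp add: sig coeff_one )
next
  case (Suc N)
  define s where "s = sum_mset M"
  \<comment> \<open>One finite index set for the second rows that serves both before and after the
    interchange of sums.\<close>
  define L where "L = (\<Union>v\<in>support M. {l. interlaces l v}) \<union> (\<Union>n\<in>set_mset M. support (M - {#n#}))"
  have finL: "finite L" unfolding L_def by (auto intro: finite_support finite_interlaces)
  have sigL: "L \<subseteq> signatures"
    unfolding L_def using interlaces_signature by (auto simp: support_def)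
  define G where "G n l = gt_sum N l (\<lambda>m. f (n # m))" for n l
  have "(\<Sum>v\<in>support M. gt_sum (Suc N) v f * coeff (sigma v) M) =
      (\<Sum>v\<in>support M. \<Sum>l\<in>L. if interlaces l v then G (s - sum_list l) l * coeff (sigma v) M else 0)"
  proof (rule sum.cong[OF refl])
    fix v assume v: "v \<in> support M"
    have "gt_sum (Suc N) v f * coeff (sigma v) M =
        (\<Sum>l | interlaces l v. G (s - sum_list l) l * coeff (sigma v) M)"
      using support_sum[OF v] by (simp add: G_def s_def sum_distrib_right)
    also have "{l. interlaces l v} = {l \<in> L. interlaces l v}"
      using v by (auto simp: L_def)
    also have "(\<Sum>l\<in>{l \<in> L. interlaces l v}. G (s - sum_list l) l * coeff (sigma v) M) =
        (\<Sum>l\<in>L. if interlaces l v then G (s - sum_list l) l * coeff (sigma v) M else 0)"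
      by (rule sum.inter_filter[OF finL])
    finally show "gt_sum (Suc N) v f * coeff (sigma v) M =
        (\<Sum>l\<in>L. if interlaces l v then G (s - sum_list l) l * coeff (sigma v) M else 0)" .
  qed
  also have "\<dots> = (\<Sum>l\<in>L. G (s - sum_list l) l * coeff (phi * sigma l) M)"
  proof (subst sum.swap, rule sum.cong[OF refl])
    fix l assume "l \<in> L"
    then have "l \<in> signatures" using sigL by blast
    have "(\<Sum>v\<in>support M. if interlaces l v then G (s - sum_list l) l * coeff (sigma v) M else 0) =
        (\<Sum>v\<in>{v \<in> support M. interlaces l v}. G (s - sum_list l) l * coeff (sigma v) M)"
      by (rule sum.inter_filter[symmetric, OF finite_support])
    also have "{v \<in> support M. interlaces l v} = {v. interlaces l v \<and> v \<in> support M}" by auto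
    finally show "(\<Sum>v\<in>support M. if interlaces l v then G (s - sum_list l) l * coeff (sigma v) M else 0) =
        G (s - sum_list l) l * coeff (phi * sigma l) M"
      by (simp add: coeff_phi_sigma[OF \<open>l \<in> signatures\<close>] sum_distrib_left)
  qed
  also have "\<dots> = (\<Sum>n\<in>set_mset M. \<Sum>l\<in>L. G n l * coeff (sigma l) (M - {#n#}))"
    unfolding coeff_phi_mult sum_distrib_left
  proof (subst sum.swap, intro sum.cong refl)
    fix n l assume n: "n \<in> set_mset M"
    \<comment> \<open>By conservation of weight the first letter of the word is the letter that was
      split off.\<close>
    have "n = s - sum_list l" if "coeff (sigma l) (M - {#n#}) \<noteq> 0"
      using coeff_sigma_nonzero(2)[OF that] n by (simp add: s_def sum_mset_diff)
    then show "G (s - sum_list l) l * coeff (sigma l) (M - {#n#}) = G n l * coeff (sigma l) (M - {#n#})"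
      by (cases "coeff (sigma l) (M - {#n#}) = 0") auto
  qed
  also have "\<dots> = (\<Sum>n\<in>set_mset M. \<Sum>l\<in>support (M - {#n#}). G n l * coeff (sigma l) (M - {#n#}))"
    by (intro sum.cong refl sum_support_superset[symmetric] finL sigL) (auto simp: L_def)
  also have "\<dots> = (\<Sum>n\<in>set_mset M. \<Sum>m\<in>permutations_of_multiset (M - {#n#}). f (n # m))"
  proof (rule sum.cong[OF refl])
    fix n assume "n \<in> set_mset M"
    then have "size (M - {#n#}) = N" using Suc.prems by (simp add: size_Diff_singleton)
    from Suc.IH[OF this, of "\<lambda>m. f (n # m)"]
    show "(\<Sum>l\<in>support (M - {#n#}). G n l * coeff (sigma l) (M - {#n#})) =
        (\<Sum>m\<in>permutations_of_multiset (M - {#n#}). f (n # m))"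
      by (simp add: G_def)
  qed
  also have "\<dots> = (\<Sum>n\<in>set_mset M. \<Sum>m\<in>(#) n ` permutations_of_multiset (M - {#n#}). f m)"
    by (simp add: sum.reindex)
  also have "\<dots> = (\<Sum>m\<in>(\<Union>n\<in>set_mset M. (#) n ` permutations_of_multiset (M - {#n#})). f m)"
    by (rule sum.UNION_disjoint[symmetric]) auto
  also have "(\<Union>n\<in>set_mset M. (#) n ` permutations_of_multiset (M - {#n#})) = permutations_of_multiset M"
    using Suc.prems by (subst permutations_of_multiset_nonempty[of M]) auto
  finally show ?case .
qed

section \<open>Existence and uniqueness of the \<sigma> expansion\<close>

definition expands :: "bseries \<Rightarrow> (int list \<Rightarrow> complex) \<Rightarrow> bool" where
  "expands \<psi> a \<longleftrightarrow> (\<forall>l. l \<notin> signatures \<longrightarrow> a l = 0) \<and>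
     (\<forall>M. coeff \<psi> M = (\<Sum>v\<in>support M. a v * coeff (sigma v) M))"

text \<open>\<open>support M\<close> contains the indices of all nonzero terms and does not depend
  on the family a, which makes the sums for different families directly comparable.\<close>

lemma expands_iff_formal_sum:
  "expands \<psi> a \<longleftrightarrow> (\<forall>l. l \<notin> signatures \<longrightarrow> a l = 0) \<and>
     has_formal_sum (\<lambda>l. bscale (a l) (sigma l)) signatures \<psi>"
proof -
  have sub: "{l \<in> signatures. coeff (bscale (a l) (sigma l)) M \<noteq> 0} \<subseteq> support M" for M
    by (auto simp: support_def)
  have "(\<Sum>l | l \<in> signatures \<and> coeff (bscale (a l) (sigma l)) M \<noteq> 0. coeff (bscale (a l) (sigma l)) M) =
      (\<Sum>v\<in>support M. a v * coeff (sigma v) M)" for M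
    by (rule sum.mono_neutral_cong_left[OF finite_support]) (auto simp: support_def)
  then show ?thesis
    unfolding expands_def has_formal_sum_def
    using finite_subset[OF sub finite_support] by simp
qed

text \<open>At the monomial of l the element \<open>sigma l\<close> has coefficient one, and the
  other signatures contributing there have a smaller sum of squares; so the values are determined by
  induction on that sum.\<close>

lemma expands_unique:
  assumes "expands \<psi> a" "expands \<psi> b"
  shows "a = b"
proof
  fix l
  show "a l = b l"
  proof (induction "nat (square_sum (mset l))" arbitrary: l rule: less_induct)
    case less
    show ?case
    proof (cases "l \<in> signatures")
      case True
      have l: "l \<in> support (mset l)"
        using True by (simp add: support_def coeff_sigma_self)
      have eq: "a v = b v" if "v \<in> support (mset l) - {l}" for v
      proof -
        have "square_sum (mset v) < square_sum (mset l)"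
          using square_sum_support[of v "mset l"] signatures_mset_inj[of v l] that True
          by (auto simp: support_def)
        then show ?thesis
          using less[of v] square_sum_nonneg[of "mset v"] by simp
      qed
      have split: "coeff \<psi> (mset l) = c l + (\<Sum>v\<in>support (mset l) - {l}. c v * coeff (sigma v) (mset l))"
        if "expands \<psi> c" for c
      proof -
        have "coeff \<psi> (mset l) = (\<Sum>v\<in>support (mset l). c v * coeff (sigma v) (mset l))"
          using that by (simp add: expands_def)
        also have "\<dots> = c l * coeff (sigma l) (mset l) +
            (\<Sum>v\<in>support (mset l) - {l}. c v * coeff (sigma v) (mset l))"
          by (rule sum.remove[OF finite_support l])
        finally show ?thesis by (simp add: coeff_sigma_self[OF True])
      qed
      have "(\<Sum>v\<in>support (mset l) - {l}. a v * coeff (sigma v) (mset l)) =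
          (\<Sum>v\<in>support (mset l) - {l}. b v * coeff (sigma v) (mset l))"
        by (rule sum.cong) (auto simp: eq)
      then show ?thesis using split[OF assms(1)] split[OF assms(2)] by simp
    qed (use assms in \<open>simp add: expands_def\<close>)
  qed
qed

lemma sigma_coeff_eqI: "expands \<psi> a \<Longrightarrow> sigma_coeff \<psi> = a"
  unfolding sigma_coeff_def expands_iff_formal_sum[symmetric]
  by (rule the_equality) (auto intro: expands_unique)

text \<open>One ordering of every monomial has to be singled out, because a Gelfand-Tsetlin pattern and its
  permuted weights contribute separately.\<close>

definition sorted_coeff :: "bseries \<Rightarrow> int list \<Rightarrow> complex" where
  "sorted_coeff \<psi> m = (if sorted m then coeff \<psi> (mset m) else 0)"

text \<open>Of all orderings of M only the sorted one contributes to the word sum, so the pattern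
  sums reproduce \<open>coeff \<psi> M\<close>. Besides existence this yields the explicit formula
  on which the growth estimates rest.\<close>

lemma expands_gt_sum:
  "expands \<psi> (\<lambda>v. if v \<in> signatures then gt_sum (length v) v (sorted_coeff \<psi>) else 0)"
  unfolding expands_def
proof (intro conjI allI)
  fix M
  have "(\<Sum>v\<in>support M. (if v \<in> signatures then gt_sum (length v) v (sorted_coeff \<psi>) else 0) *
      coeff (sigma v) M) = (\<Sum>v\<in>support M. gt_sum (size M) v (sorted_coeff \<psi>) * coeff (sigma v) M)"
    by (rule sum.cong) (auto simp: support_length support_def coeff_sigma_nonzero(1))
  also have "\<dots> = (\<Sum>m\<in>permutations_of_multiset M. sorted_coeff \<psi> m)"
    by (rule gt_sum_expansion) simp
  also have "\<dots> = (\<Sum>m\<in>{sorted_list_of_multiset M}. sorted_coeff \<psi> m)"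
  proof (rule sum.mono_neutral_right)
    show "\<forall>m\<in>permutations_of_multiset M - {sorted_list_of_multiset M}. sorted_coeff \<psi> m = 0"
    proof
      fix m assume m: "m \<in> permutations_of_multiset M - {sorted_list_of_multiset M}"
      then have "M = mset m" using permutations_of_multisetD by fastforce
      then have "sorted_list_of_multiset M = sort m" by simp
      then have "\<not> sorted m" using m by (auto simp: sorted_sort_id)
      then show "sorted_coeff \<psi> m = 0" by (simp add: sorted_coeff_def)
    qed
  qed (auto intro: permutations_of_multisetI)
  also have "\<dots> = coeff \<psi> M" by (simp add: sorted_coeff_def)
  finally show "coeff \<psi> M = (\<Sum>v\<in>support M.
      (if v \<in> signatures then gt_sum (length v) v (sorted_coeff \<psi>) else 0) * coeff (sigma v) M)" ..
qed simp

lemma sigma_coeff_gt_sum: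
  "v \<in> signatures \<Longrightarrow> sigma_coeff \<psi> v = gt_sum (length v) v (sorted_coeff \<psi>)"
  using sigma_coeff_eqI[OF expands_gt_sum, of \<psi>] by simp

lemma expands_sigma_coeff: "expands \<psi> (sigma_coeff \<psi>)"
  using sigma_coeff_eqI[OF expands_gt_sum, of \<psi>] expands_gt_sum[of \<psi>] by simp

lemma sigma_coeff_outside: "l \<notin> signatures \<Longrightarrow> sigma_coeff \<psi> l = 0"
  using expands_sigma_coeff[of \<psi>] unfolding expands_def by blast

lemma coeff_sigma_expansion: "coeff \<psi> M = (\<Sum>v\<in>support M. sigma_coeff \<psi> v * coeff (sigma v) M)"
  using expands_sigma_coeff[of \<psi>] unfolding expands_def by blast

section \<open>Linear operations and multiplication by \<phi> in the \<sigma> basis\<close>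

lemma sigma_coeff_add [simp]: "sigma_coeff (\<psi> + \<theta>) l = sigma_coeff \<psi> l + sigma_coeff \<theta> l"
proof -
  have "expands (\<psi> + \<theta>) (\<lambda>l. sigma_coeff \<psi> l + sigma_coeff \<theta> l)"
    by (simp add: expands_def sigma_coeff_outside coeff_sigma_expansion[of \<psi>]
        coeff_sigma_expansion[of \<theta>] ring_distribs sum.distrib)
  from sigma_coeff_eqI[OF this] show ?thesis by simp
qed

lemma sigma_coeff_bscale [simp]: "sigma_coeff (bscale z \<psi>) l = z * sigma_coeff \<psi> l"
proof -
  have "expands (bscale z \<psi>) (\<lambda>l. z * sigma_coeff \<psi> l)"
    by (simp add: expands_def sigma_coeff_outside coeff_sigma_expansion[of \<psi>] sum_distrib_left mult.assoc)
  from sigma_coeff_eqI[OF this] show ?thesis by simp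
qed

lemma sigma_coeff_zero [simp]: "sigma_coeff 0 l = 0"
proof -
  have "expands 0 (\<lambda>l. 0)" by (simp add: expands_def)
  from sigma_coeff_eqI[OF this] show ?thesis by simp
qed

lemma sigma_coeff_minus [simp]: "sigma_coeff (- \<psi>) l = - sigma_coeff \<psi> l"
  using sigma_coeff_add[of \<psi> "- \<psi>" l] by (simp add: eq_neg_iff_add_eq_0 add.commute)

lemma sigma_Nil: "sigma [] = 1"
  by (simp add: sigma_def jacobi_trudi_def)

lemma Nil_signature [simp]: "[] \<in> signatures"
  by (simp add: signatures_iff signatures_of_iff)

lemma sigma_coeff_one: "sigma_coeff 1 l = (if l = [] then 1 else 0)"
proof -
  have "expands 1 (\<lambda>l. if l = [] then 1 else 0)"
    unfolding expands_def
  proof (intro conjI allI)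
    fix M
    have "(\<Sum>v\<in>support M. (if v = [] then 1 else 0) * coeff (sigma v) M) =
        (\<Sum>v\<in>support M. if v = [] then coeff (sigma []) M else 0)"
      by (rule sum.cong) auto
    also have "\<dots> = coeff 1 M" by (simp add: finite_support sigma_Nil) (auto simp: support_def sigma_Nil)
    finally show "coeff 1 M = (\<Sum>v\<in>support M. (if v = [] then 1 else 0) * coeff (sigma v) M)" ..
  qed auto
  from sigma_coeff_eqI[OF this] show ?thesis by simp
qed

text \<open>The Pieri rule read dually: exchanging the finite sums collects at each v the
  coefficients of the l that interlace it.\<close>

lemma sigma_coeff_phi_mult: "sigma_coeff (phi * \<psi>) v = (\<Sum>l | interlaces l v. sigma_coeff \<psi> l)"
proof -
  define b where "b v = (\<Sum>l | interlaces l v. sigma_coeff \<psi> l)" for v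
  have "expands (phi * \<psi>) b"
    unfolding expands_def
  proof (intro conjI allI impI)
    fix v assume "v \<notin> signatures"
    then have "{l. interlaces l v} = {}" using interlaces_signature by blast
    then show "b v = 0" by (simp add: b_def)
  next
    fix M
    define L where "L = (\<Union>v\<in>support M. {l. interlaces l v}) \<union> (\<Union>n\<in>set_mset M. support (M - {#n#}))"
    have finL: "finite L" unfolding L_def by (auto intro: finite_support finite_interlaces)
    have sigL: "L \<subseteq> signatures"
      unfolding L_def using interlaces_signature by (auto simp: support_def)
    have "coeff (phi * \<psi>) M = (\<Sum>n\<in>set_mset M. \<Sum>l\<in>L. sigma_coeff \<psi> l * coeff (sigma l) (M - {#n#}))"
      unfolding coeff_phi_mult coeff_sigma_expansion[of \<psi>]
      by (intro sum.cong refl sum_support_superset finL sigL) (auto simp: L_def)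
    also have "\<dots> = (\<Sum>l\<in>L. sigma_coeff \<psi> l * coeff (phi * sigma l) M)"
      unfolding coeff_phi_mult sum_distrib_left by (rule sum.swap)
    also have "\<dots> = (\<Sum>l\<in>L. \<Sum>v\<in>support M. if interlaces l v then sigma_coeff \<psi> l * coeff (sigma v) M else 0)"
    proof (rule sum.cong[OF refl])
      fix l assume "l \<in> L"
      then have "l \<in> signatures" using sigL by blast
      have "{v. interlaces l v \<and> v \<in> support M} = {v \<in> support M. interlaces l v}" by auto
      then show "sigma_coeff \<psi> l * coeff (phi * sigma l) M =
          (\<Sum>v\<in>support M. if interlaces l v then sigma_coeff \<psi> l * coeff (sigma v) M else 0)"
        by (simp add: coeff_phi_sigma[OF \<open>l \<in> signatures\<close>] sum_distrib_left
            sum.inter_filter[OF finite_support] if_distrib[of "\<lambda>x. sigma_coeff \<psi> l * x"] cong: if_cong)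
    qed
    also have "\<dots> = (\<Sum>v\<in>support M. b v * coeff (sigma v) M)"
    proof (subst sum.swap, rule sum.cong[OF refl])
      fix v assume v: "v \<in> support M"
      have "{l. interlaces l v} = {l \<in> L. interlaces l v}" using v by (auto simp: L_def)
      then show "(\<Sum>l\<in>L. if interlaces l v then sigma_coeff \<psi> l * coeff (sigma v) M else 0) =
          b v * coeff (sigma v) M"
        by (simp add: b_def sum_distrib_right sum.inter_filter[OF finL]
            if_distrib[of "\<lambda>x. x * coeff (sigma v) M"] cong: if_cong)
    qed
    finally show "coeff (phi * \<psi>) M = (\<Sum>v\<in>support M. b v * coeff (sigma v) M)" .
  qed
  from sigma_coeff_eqI[OF this] show ?thesis by (simp add: b_def)
qed

lemma sigma_coeff_phi_power:
  "sigma_coeff (phi ^ N) l = (if l \<in> signatures_of N then of_real (Dim l) else 0)"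
proof (induction N arbitrary: l)
  case 0
  then show ?case by (auto simp: sigma_coeff_one signatures_of_iff)
next
  case (Suc N)
  have "sigma_coeff (phi ^ Suc N) l =
      (\<Sum>k | interlaces k l. if k \<in> signatures_of N then of_real (Dim k) else 0)"
    by (simp add: sigma_coeff_phi_mult Suc.IH)
  also have "\<dots> = (if l \<in> signatures_of (Suc N) then of_real (Dim l) else 0)"
  proof (cases "l \<in> signatures_of (Suc N)")
    case True
    have "k \<in> signatures_of N" if "interlaces k l" for k
      using interlaces_signature(1)[OF that] True that
      by (auto simp: signatures_iff interlaces_def signatures_of_iff)
    then have "(\<Sum>k | interlaces k l. if k \<in> signatures_of N then complex_of_real (Dim k) else 0) =
        of_real (\<Sum>k | interlaces k l. Dim k)"
      by (simp)
    then show ?thesis using Dim_branching[OF True] True by simp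
  next
    case False
    have "k \<notin> signatures_of N" if "interlaces k l" for k
      using interlaces_signature(2)[OF that] False that
      by (auto simp: signatures_iff interlaces_def signatures_of_iff)
    then show ?thesis using False by simp
  qed
  finally show ?case .
qed

no_notation Infinite_Set_Sum.abs_summable_on (infix "abs'_summable'_on" 50)

section \<open>Series of subexponential growth\<close>

text \<open>The coefficients of an element of finite norm grow polynomially, whereas the Laurent coefficients
  of \<open>\<Phi>(u; \<omega>)\<close> decay exponentially. So such a series can be evaluated monomial by monomial, which makes
  the multiplicativity of the evaluation obvious.\<close>

definition absum :: "int multiset \<Rightarrow> nat" where
  "absum M = (\<Sum>n\<in>#M. nat \<bar>n\<bar>)"

definition mon :: "('b \<Rightarrow> 'a) \<Rightarrow> 'b multiset \<Rightarrow> 'a :: comm_monoid_mult" where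
  "mon c M = (\<Prod>n\<in>#M. c n)"

text \<open>Subexponential growth, expressed by summability against every geometric weight, the form
  in which series are dominated later. In bounded degree, bounds by multiples of
  \<open>(1 / r) ^ absum M\<close> for all r < 1 amount to the same, at the cost of replacing r by
  its square root.\<close>

definition slow :: "bseries \<Rightarrow> bool" where
  "slow \<psi> \<longleftrightarrow> (\<forall>r. 0 < r \<longrightarrow> r < 1 \<longrightarrow> (\<lambda>M. cmod (coeff \<psi> M) * r ^ absum M) summable_on UNIV)"

definition slow_family :: "(int list \<Rightarrow> complex) \<Rightarrow> bool" where
  "slow_family a \<longleftrightarrow> (\<exists>d. \<forall>l. d < length l \<longrightarrow> a l = 0) \<and>
     (\<forall>r. 0 < r \<longrightarrow> r < 1 \<longrightarrow> (\<lambda>l. cmod (a l) * r ^ absum (mset l)) summable_on signatures)"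

definition decaying :: "(int \<Rightarrow> complex) \<Rightarrow> bool" where
  "decaying c \<longleftrightarrow> (\<exists>K r. 0 < r \<and> r < 1 \<and> (\<forall>n. cmod (c n) \<le> K * r ^ nat \<bar>n\<bar>))"

lemma absum_simps [simp]:
  "absum {#} = 0" "absum (add_mset n M) = nat \<bar>n\<bar> + absum M" "absum (A + B) = absum A + absum B"
  by (simp_all add: absum_def)

lemma mon_simps [simp]:
  "mon c {#} = 1" "mon c (add_mset n M) = c n * mon c M" "mon c (A + B) = mon c A * mon c B"
  by (simp_all add: mon_def)

lemma absum_nth: "int (absum (mset l)) = (\<Sum>i<length l. \<bar>l ! i\<bar>)"
proof -
  have "int (absum (mset l)) = (\<Sum>x\<leftarrow>l. \<bar>x\<bar>)" by (induction l) auto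
  then show ?thesis by (simp add: sum_list_sum_nth lessThan_atLeast0)
qed

lemma real_absum_nth: "real (absum (mset l)) = (\<Sum>i<length l. of_int \<bar>l ! i\<bar>)"
  using arg_cong[OF absum_nth[of l], of real_of_int] by simp

text \<open>The function |x| + x is increasing and |x| - x is decreasing. Comparing l with the
  entries of v that bound it from above and from below gives one inequality for each, and together
  they settle both signs of the difference of the row sums.\<close>

lemma interlaces_absum:
  assumes "interlaces l v"
  shows "nat \<bar>sum_list v - sum_list l\<bar> + absum (mset l) \<le> absum (mset v)"
proof -
  let ?N = "length l"
  have v: "length v = Suc ?N" "\<And>i. i < ?N \<Longrightarrow> v ! Suc i \<le> l ! i \<and> l ! i \<le> v ! i"
    using assms by (auto simp: interlaces_def)
  have "(\<Sum>i<?N. \<bar>l ! i\<bar> + l ! i) \<le> (\<Sum>i<?N. \<bar>v ! i\<bar> + v ! i)"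
    by (rule sum_mono) (use v(2) in fastforce)
  also have "\<dots> \<le> (\<Sum>i<Suc ?N. \<bar>v ! i\<bar> + v ! i)" by simp
  finally have 1: "int (absum (mset l)) + sum_list l \<le> int (absum (mset v)) + sum_list v"
    using v(1) by (simp add: absum_nth sum_list_sum_nth sum.distrib lessThan_atLeast0)
  have "(\<Sum>i<?N. \<bar>l ! i\<bar> - l ! i) \<le> (\<Sum>i<?N. \<bar>v ! Suc i\<bar> - v ! Suc i)"
    by (rule sum_mono) (use v(2) in fastforce)
  also have "\<dots> \<le> (\<Sum>i<Suc ?N. \<bar>v ! i\<bar> - v ! i)" by (subst sum.lessThan_Suc_shift) simp
  finally have 2: "int (absum (mset l)) - sum_list l \<le> int (absum (mset v)) - sum_list v"
    using v(1) by (simp add: absum_nth sum_list_sum_nth sum_subtractf lessThan_atLeast0)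
  from 1 2 show ?thesis by linarith
qed

lemma interlaces_signatures_of:
  assumes "interlaces l v" "v \<in> signatures_of (Suc N)"
  shows "l \<in> signatures_of N"
  using assms interlaces_signature(1)[OF assms(1)]
  by (auto simp: signatures_iff interlaces_def signatures_of_iff)

text \<open>\<open>Dim v\<close> counts the patterns with top row v, and row by row the absolute sum
  of the word they spell stays below that of v.\<close>

lemma gt_sum_bound:
  fixes F :: "int list \<Rightarrow> complex"
  assumes "v \<in> signatures_of N"
    and "\<And>m. length m = N \<Longrightarrow> absum (mset m) \<le> absum (mset v) \<Longrightarrow> cmod (F m) \<le> C"
  shows "cmod (gt_sum N v F) \<le> Dim v * C"
  using assms
proof (induction N arbitrary: v F)
  case 0
  then show ?case by (simp add: signatures_of_iff)
next
  case (Suc N)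
  have "cmod (gt_sum (Suc N) v F) \<le> (\<Sum>l | interlaces l v. Dim l * C)"
    unfolding gt_sum.simps
  proof (rule sum_norm_le)
    fix l assume "l \<in> {l. interlaces l v}"
    then have l: "interlaces l v" by simp
    show "cmod (gt_sum N l (\<lambda>m. F ((sum_list v - sum_list l) # m))) \<le> Dim l * C"
    proof (rule Suc.IH)
      show "l \<in> signatures_of N" using l Suc.prems(1) by (rule interlaces_signatures_of)
      show "cmod (F ((sum_list v - sum_list l) # m)) \<le> C"
        if "length m = N" "absum (mset m) \<le> absum (mset l)" for m
        using that interlaces_absum[OF l] by (intro Suc.prems(2)) auto
    qed
  qed
  also have "\<dots> = Dim v * C"
    by (simp add: sum_distrib_right[symmetric] Dim_branching[OF Suc.prems(1)])
  finally show ?case .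
qed

lemma coeff_bounded_degree: obtains d where "\<And>M. d < size M \<Longrightarrow> coeff \<psi> M = 0"
  using coeff[of \<psi>] by auto

lemma sigma_coeff_degree:
  assumes "\<And>M. size M = length v \<Longrightarrow> coeff \<psi> M = 0"
  shows "sigma_coeff \<psi> v = 0"
proof (cases "v \<in> signatures")
  case True
  then have "cmod (gt_sum (length v) v (sorted_coeff \<psi>)) \<le> Dim v * 0"
    by (intro gt_sum_bound) (auto simp: sorted_coeff_def assms signatures_iff)
  then show ?thesis by (simp add: sigma_coeff_gt_sum[OF True])
qed (rule sigma_coeff_outside)

lemma sigma_coeff_bounded_degree: obtains d where "\<And>l. d < length l \<Longrightarrow> sigma_coeff \<psi> l = 0"
  using coeff_bounded_degree[of \<psi>] sigma_coeff_degree[of _ \<psi>] by metis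

text \<open>Bernoulli's inequality for 1 / t = 1 + e bounds 1 + n by a multiple of (1 / t)^n, and
  raising this to the power k + 1 turns t into r. The order k + 1 in place of k keeps the root
  meaningful for k = 0.\<close>

lemma poly_le_exp:
  fixes r :: real
  assumes "0 < r" "r < 1"
  obtains C where "0 \<le> C" "\<And>n. (1 + real n) ^ k \<le> C * (1 / r) ^ n"
proof -
  define t where "t = root (Suc k) r"
  have t: "0 < t" "t < 1" "t ^ Suc k = r"
    using assms by (auto simp: t_def real_root_gt_zero simp del: power_Suc)
  define e where "e = 1 / t - 1"
  have e: "e > 0" using t by (simp add: e_def)
  define B where "B = max 1 (1 / e)"
  have B: "B \<ge> 1" "B * e \<ge> 1" using e by (auto simp: B_def field_simps max_def)
  have lin: "1 + real n \<le> B * (1 / t) ^ n" for n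
  proof -
    have "1 + real n \<le> B * 1 + (B * e) * real n"
      using B by (intro add_mono mult_right_mono[of 1 "B * e" "real n", simplified]) auto
    also have "\<dots> = B * (1 + real n * e)" by (simp add: algebra_simps)
    also have "\<dots> \<le> B * (1 + e) ^ n"
      using e B by (intro mult_left_mono Bernoulli_inequality) auto
    finally show ?thesis by (simp add: e_def)
  qed
  show ?thesis
  proof (rule that[of "B ^ Suc k"])
    fix n
    have "(1 + real n) ^ k \<le> (1 + real n) ^ Suc k" by (rule power_increasing) auto
    also have "\<dots> \<le> (B * (1 / t) ^ n) ^ Suc k" by (rule power_mono[OF lin]) simp
    also have "\<dots> = B ^ Suc k * (1 / t ^ Suc k) ^ n"
      by (simp only: power_mult_distrib power_mult[symmetric] power_one_over mult.commute)
    finally show "(1 + real n) ^ k \<le> B ^ Suc k * (1 / r) ^ n" by (simp only: t)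
  qed (use B in auto)
qed

lemma Dim_subexponential:
  assumes "0 < r" "r < 1"
  obtains C where "0 \<le> C" "\<And>v. v \<in> signatures_of N \<Longrightarrow> Dim v \<le> C * (1 / r) ^ absum (mset v)"
proof -
  obtain C where C: "0 \<le> C" "\<And>n. (1 + real n) ^ (N * N) \<le> C * (1 / r) ^ n"
    using poly_le_exp[OF assms] by blast
  show ?thesis
  proof (rule that[OF C(1)])
    fix v assume v: "v \<in> signatures_of N"
    have "Dim v \<le> (1 + real (absum (mset v))) ^ (N * N)"
      using Dim_bound[OF v] by (simp add: real_absum_nth signatures_of_length[OF v])
    then show "Dim v \<le> C * (1 / r) ^ absum (mset v)" using C(2) by (rule order.trans)
  qed
qed

lemma summable_on_int_geometric:
  fixes r :: real
  assumes "0 \<le> r" "r < 1"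
  shows "(\<lambda>n::int. r ^ nat \<bar>n\<bar>) summable_on UNIV"
proof -
  have geo: "(\<lambda>n::nat. r ^ n) summable_on UNIV"
    by (rule norm_summable_imp_summable_on) (use assms in \<open>simp add: summable_geometric power_abs\<close>)
  have "(\<lambda>n::int. r ^ nat \<bar>n\<bar>) summable_on range int"
    by (subst summable_on_reindex) (auto simp: o_def geo)
  moreover have "(\<lambda>n::int. r ^ nat \<bar>n\<bar>) summable_on range (\<lambda>n. - int n)"
    by (subst summable_on_reindex) (auto simp: o_def geo inj_on_def)
  ultimately have "(\<lambda>n::int. r ^ nat \<bar>n\<bar>) summable_on (range int \<union> range (\<lambda>n. - int n))"
    by (rule summable_on_union)
  moreover have "range int \<union> range (\<lambda>n. - int n) = UNIV"
  proof -
    have "n \<in> range int \<union> range (\<lambda>n. - int n)" for n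
      by (cases n rule: int_cases2) auto
    then show ?thesis by blast
  qed
  ultimately show ?thesis by simp
qed

lemma summable_on_lists_geometric:
  fixes r :: real
  assumes "0 \<le> r" "r < 1"
  shows "(\<lambda>l. r ^ absum (mset l)) summable_on {l. length l = N}"
proof (induction N)
  case (Suc N)
  let ?S = "infsum (\<lambda>l. r ^ absum (mset l)) {l. length l = N}"
  have "(\<lambda>p. r ^ nat \<bar>fst p\<bar> * r ^ absum (mset (snd p))) summable_on (UNIV \<times> {l. length l = N})"
  proof (rule summable_on_SigmaI)
    show "((\<lambda>l. r ^ nat \<bar>fst (n, l)\<bar> * r ^ absum (mset (snd (n, l)))) has_sum r ^ nat \<bar>n\<bar> * ?S)
        {l. length l = N}" for n
      using Suc by (simp add: has_sum_cmult_right)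
    show "(\<lambda>n::int. r ^ nat \<bar>n\<bar> * ?S) summable_on UNIV"
      by (intro summable_on_cmult_left summable_on_int_geometric assms)
  qed (use assms in auto)
  also have "?this \<longleftrightarrow> ?case"
    by (rule summable_on_reindex_bij_witness[where i = "\<lambda>l. (hd l, tl l)" and j = "\<lambda>p. fst p # snd p"])
      (auto simp: power_add length_Suc_conv)
  finally show ?case .
qed simp

text \<open>Of the weight r = s * s one factor s absorbs the growth of a, and the other makes the
  sum over integer vectors of fixed length converge.\<close>

lemma slow_familyI:
  assumes deg: "\<And>l. d < length l \<Longrightarrow> a l = 0"
    and bound: "\<And>N r. 0 < r \<Longrightarrow> r < 1 \<Longrightarrow> \<exists>C. \<forall>v\<in>signatures_of N. cmod (a v) \<le> C * (1 / r) ^ absum (mset v)"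
  shows "slow_family a"
  unfolding slow_family_def
proof (intro conjI allI impI)
  fix r :: real assume r: "0 < r" "r < 1"
  define s where "s = sqrt r"
  have s: "0 < s" "s < 1" "s * s = r" using r by (auto simp: s_def)
  let ?f = "\<lambda>l. cmod (a l) * r ^ absum (mset l)"
  have level: "?f summable_on signatures_of N" for N
  proof -
    obtain C where C: "\<And>v. v \<in> signatures_of N \<Longrightarrow> cmod (a v) \<le> C * (1 / s) ^ absum (mset v)"
      using bound[OF s(1,2)] by blast
    have "(\<lambda>l. C * s ^ absum (mset l)) summable_on {l. length l = N}"
      using s by (intro summable_on_cmult_right summable_on_lists_geometric) auto
    then have "(\<lambda>l. C * s ^ absum (mset l)) summable_on signatures_of N"
      by (rule summable_on_subset) (auto simp: signatures_of_iff)
    then show ?thesis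
    proof (rule summable_on_comparison_test)
      fix v assume "v \<in> signatures_of N"
      then have "?f v \<le> C * (1 / s) ^ absum (mset v) * (s * s) ^ absum (mset v)"
        unfolding s(3) using r by (intro mult_right_mono C) auto
      also have "\<dots> = C * s ^ absum (mset v)"
        using s(1) by (simp add: power_mult_distrib power_one_over)
      finally show "?f v \<le> C * s ^ absum (mset v)" .
    qed (use r in auto)
  qed
  have "?f summable_on (\<Union>N\<le>d. signatures_of N)"
  proof (induction d)
    case (Suc d)
    have "(\<Union>N\<le>Suc d. signatures_of N) = (\<Union>N\<le>d. signatures_of N) \<union> signatures_of (Suc d)"
      by (simp add: atMost_Suc Un_commute)
    then show ?case using summable_on_union[OF Suc level] by simp
  qed (simp add: level)
  moreover have "?f summable_on signatures \<longleftrightarrow> ?f summable_on (\<Union>N\<le>d. signatures_of N)"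
  proof (rule summable_on_cong_neutral)
    fix l assume "l \<in> signatures - (\<Union>N\<le>d. signatures_of N)"
    then have "d < length l" by (auto simp: signatures_iff not_less[symmetric])
    then show "?f l = 0" by (simp add: deg)
  next
    fix l assume "l \<in> (\<Union>N\<le>d. signatures_of N) - signatures"
    then show "?f l = 0" by (auto simp only: signatures_def)
  qed simp
  ultimately show "?f summable_on signatures" by simp
qed (use deg in blast)

lemma slow_coeff_bound:
  assumes "slow \<psi>" "0 < r" "r < 1"
  obtains B where "0 \<le> B" "\<And>M. cmod (coeff \<psi> M) \<le> B * (1 / r) ^ absum M"
proof -
  let ?f = "\<lambda>M. cmod (coeff \<psi> M) * r ^ absum M"
  have sum: "?f summable_on UNIV" using assms by (auto simp: slow_def)
  show ?thesis
  proof (rule that[of "infsum ?f UNIV"])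
    show "0 \<le> infsum ?f UNIV" by (rule infsum_nonneg) (use assms in auto)
    fix M
    have "sum ?f {M} \<le> infsum ?f UNIV"
      by (rule finite_sum_le_infsum[OF sum]) (use assms in auto)
    then show "cmod (coeff \<psi> M) \<le> infsum ?f UNIV * (1 / r) ^ absum M"
      using assms by (simp add: power_one_over field_simps)
  qed
qed

text \<open>In the pattern formula both the number of terms \<open>Dim v\<close> and the size of the
  terms grow subexponentially; with s the square root of r, each may cost
  \<open>(1 / s) ^ absum (mset v)\<close>.\<close>

lemma slow_family_sigma_coeff:
  assumes "slow \<psi>"
  shows "slow_family (sigma_coeff \<psi>)"
proof -
  obtain d where d: "\<And>l. d < length l \<Longrightarrow> sigma_coeff \<psi> l = 0"
    using sigma_coeff_bounded_degree[of \<psi>] by blast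
  show ?thesis
  proof (rule slow_familyI[OF d])
    fix N and r :: real assume r: "0 < r" "r < 1"
    define s where "s = sqrt r"
    have s: "0 < s" "s < 1" "s * s = r" using r by (auto simp: s_def)
    obtain B where B: "0 \<le> B" "\<And>M. cmod (coeff \<psi> M) \<le> B * (1 / s) ^ absum M"
      using slow_coeff_bound[OF assms s(1,2)] by blast
    obtain C where C: "0 \<le> C" "\<And>v. v \<in> signatures_of N \<Longrightarrow> Dim v \<le> C * (1 / s) ^ absum (mset v)"
      using Dim_subexponential[OF s(1,2)] by blast
    show "\<exists>C. \<forall>v\<in>signatures_of N. cmod (sigma_coeff \<psi> v) \<le> C * (1 / r) ^ absum (mset v)"
    proof (intro exI ballI)
      fix v assume v: "v \<in> signatures_of N"
      then have vs: "v \<in> signatures" "length v = N" by (auto simp: signatures_def signatures_of_iff)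
      have "cmod (sigma_coeff \<psi> v) \<le> Dim v * (B * (1 / s) ^ absum (mset v))"
        unfolding sigma_coeff_gt_sum[OF vs(1)] vs(2)
      proof (rule gt_sum_bound[OF v])
        fix m :: "int list" assume m: "absum (mset m) \<le> absum (mset v)"
        have "cmod (sorted_coeff \<psi> m) \<le> B * (1 / s) ^ absum (mset m)"
          using B s by (simp add: sorted_coeff_def)
        also have "\<dots> \<le> B * (1 / s) ^ absum (mset v)"
          using B s m by (intro mult_left_mono power_increasing) auto
        finally show "cmod (sorted_coeff \<psi> m) \<le> B * (1 / s) ^ absum (mset v)" .
      qed
      also have "\<dots> \<le> (C * (1 / s) ^ absum (mset v)) * (B * (1 / s) ^ absum (mset v))"
        using B s C(2)[OF v] by (intro mult_right_mono) auto
      also have "\<dots> = (C * B) * (1 / r) ^ absum (mset v)"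
        unfolding s(3)[symmetric] by (simp add: power_mult_distrib power_one_over field_simps)
      finally show "cmod (sigma_coeff \<psi> v) \<le> (C * B) * (1 / r) ^ absum (mset v)" .
    qed
  qed
qed

section \<open>Evaluation of series\<close>

definition ev :: "(int \<Rightarrow> complex) \<Rightarrow> bseries \<Rightarrow> complex" where
  "ev c \<psi> = (\<Sum>\<^sub>\<infinity>M. coeff \<psi> M * mon c M)"

lemma mon_bound:
  assumes "\<And>n. cmod (c n) \<le> K * r ^ nat \<bar>n\<bar>" "0 \<le> K" "0 \<le> r"
  shows "cmod (mon c M) \<le> K ^ size M * r ^ absum M"
proof (induction M)
  case (add n M)
  have "cmod (mon c (add_mset n M)) \<le> (K * r ^ nat \<bar>n\<bar>) * (K ^ size M * r ^ absum M)"
    unfolding mon_simps norm_mult using assms add by (intro mult_mono) auto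
  then show ?case by (simp add: power_add mult_ac)
qed simp

text \<open>A term of the determinant moves each of the N entries by at most N. Against a geometric
  weight in bounded degree this costs a constant factor.\<close>

lemma absum_index_mset:
  assumes p: "p permutes {0..<length l}"
  shows "absum (mset l) \<le> absum (index_mset l p) + length l * length l"
proof -
  let ?N = "length l"
  have "int (absum (mset l)) = (\<Sum>i<?N. \<bar>l ! i\<bar>)" by (rule absum_nth)
  also have "\<dots> \<le> (\<Sum>i<?N. \<bar>l ! i - int i + int (p i)\<bar> + int ?N)"
  proof (rule sum_mono)
    fix i assume i: "i \<in> {..<?N}"
    then have "p i < ?N" using permutes_in_image[OF p, of i] by simp
    then show "\<bar>l ! i\<bar> \<le> \<bar>l ! i - int i + int (p i)\<bar> + int ?N" using i by auto
  qed
  also have "\<dots> = int (absum (index_mset l p) + ?N * ?N)"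
    using absum_nth[of "map (\<lambda>i. l ! i - int i + int (p i)) [0..<?N]"]
    by (simp add: index_mset_def sum.distrib)
  finally show ?thesis by linarith
qed

definition index_msets :: "int list \<Rightarrow> int multiset set" where
  "index_msets l = index_mset l ` {p. p permutes {0..<length l}}"

lemma finite_index_msets: "finite (index_msets l)"
  by (simp add: index_msets_def finite_permutations)

lemma coeff_sigma_outside: "M \<notin> index_msets l \<Longrightarrow> coeff (sigma l) M = 0"
  using coeff_sigma_nonzeroD[of l M] by (auto simp: index_msets_def)

lemma card_index_msets: "card (index_msets l) \<le> fact (length l)"
  unfolding index_msets_def
  by (rule order.trans[OF card_image_le]) (auto simp: finite_permutations card_permutations)

lemma norm_coeff_sigma: "cmod (coeff (sigma l) M) \<le> fact (length l)"
proof -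
  have "cmod (coeff (sigma l) M) \<le> (\<Sum>p | p permutes {0..<length l} \<and> index_mset l p = M. 1)"
    unfolding coeff_sigma by (rule sum_norm_le) (simp add: sign_def)
  also have "\<dots> \<le> (\<Sum>p | p permutes {0..<length l}. 1)"
    by (rule sum_mono2) (auto simp: finite_permutations)
  also have "\<dots> = fact (length l)" by (simp add: card_permutations)
  finally show ?thesis .
qed

lemma jacobi_trudi_mon:
  "jacobi_trudi c l = (\<Sum>M\<in>index_msets l. coeff (sigma l) M * mon c M)"
proof -
  have "jacobi_trudi c l = (\<Sum>p | p permutes {0..<length l}. of_int (sign p) * mon c (index_mset l p))"
    unfolding jacobi_trudi_detm detm_leibniz
  proof (rule sum.cong[OF refl])
    fix p
    have "mon c (mset (map f [0..<n])) = (\<Prod>i = 0..<n. c (f i))" for f n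
      by (induction n) (simp_all add: mult.commute)
    then show "of_int (sign p) * (\<Prod>i = 0..<length l. c (l ! i - int i + int (p i))) =
        of_int (sign p) * mon c (index_mset l p)"
      by (simp add: index_mset_def del: mset_map)
  qed
  also have "\<dots> = (\<Sum>M\<in>index_msets l. \<Sum>p\<in>{p \<in> {p. p permutes {0..<length l}}. index_mset l p = M}.
      of_int (sign p) * mon c (index_mset l p))"
    unfolding index_msets_def by (rule sum.image_gen) (simp add: finite_permutations)
  also have "\<dots> = (\<Sum>M\<in>index_msets l. coeff (sigma l) M * mon c M)"
    by (rule sum.cong) (auto simp: coeff_sigma sum_distrib_right)
  finally show ?thesis .
qed

text \<open>The domination behind both orders of summation: for length at most d a determinant has
  at most d! monomials, with coefficients of modulus at most d!, and each evaluates to at most a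
  constant times r to the absolute sum of the signature.\<close>

lemma abs_summable_sigma_mon:
  assumes "slow_family a" "decaying c"
  shows "(\<lambda>(l, M). a l * coeff (sigma l) M * mon c M) abs_summable_on signatures \<times> UNIV"
proof -
  obtain d where d: "\<And>l. d < length l \<Longrightarrow> a l = 0" using assms(1) by (auto simp: slow_family_def)
  obtain K0 r where K0: "0 < r" "r < 1" "\<And>n. cmod (c n) \<le> K0 * r ^ nat \<bar>n\<bar>"
    using assms(2) by (auto simp: decaying_def)
  \<comment> \<open>At least 1, so that \<open>K ^ size M\<close> may be replaced by
    \<open>K ^ d\<close>.\<close>
  define K where "K = max 1 K0"
  have "cmod (c n) \<le> K * r ^ nat \<bar>n\<bar>" for n
    by (rule order.trans[OF K0(3)]) (use K0 in \<open>auto simp: K_def intro!: mult_right_mono\<close>)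
  then have mon: "cmod (mon c M) \<le> K ^ size M * r ^ absum M" for M
    by (rule mon_bound) (use K0 in \<open>auto simp: K_def\<close>)
  have K: "1 \<le> K" by (simp add: K_def)
  define D where "D = fact d * (fact d * (K ^ d * (1 / r) ^ (d * d)))"
  define g where "g l = (\<Sum>M\<in>index_msets l. cmod (a l * coeff (sigma l) M * mon c M))" for l
  have "(\<lambda>p. norm (case p of (l, M) \<Rightarrow> a l * coeff (sigma l) M * mon c M)) summable_on (signatures \<times> UNIV)"
  proof (rule summable_on_SigmaI)
    fix l assume "l \<in> signatures"
    have "((\<lambda>M. cmod (a l * coeff (sigma l) M * mon c M)) has_sum g l) UNIV"
      unfolding g_def
      by (rule has_sum_finite_neutralI) (auto simp: finite_index_msets coeff_sigma_outside)
    then show "((\<lambda>M. norm (case (l, M) of (l, M) \<Rightarrow> a l * coeff (sigma l) M * mon c M)) has_sum g l) UNIV"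
      by simp
  next
    have sum: "(\<lambda>l. D * (cmod (a l) * r ^ absum (mset l))) summable_on signatures"
      using assms(1) K0(1,2) by (intro summable_on_cmult_right) (auto simp: slow_family_def)
    show "g summable_on signatures"
    proof (rule summable_on_comparison_test[OF sum])
      fix l assume "l \<in> signatures"
      show "g l \<le> D * (cmod (a l) * r ^ absum (mset l))"
      proof (cases "d < length l")
        case False
        then have len: "length l \<le> d" by simp
        have bd: "cmod (a l * coeff (sigma l) M * mon c M) \<le>
            cmod (a l) * (fact d * (K ^ d * ((1 / r) ^ (d * d) * r ^ absum (mset l))))"
          if M: "M \<in> index_msets l" for M
        proof -
          obtain p where p: "p permutes {0..<length l}" "M = index_mset l p"
            using M by (auto simp: index_msets_def)
          have "absum (mset l) \<le> absum M + d * d"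
            using absum_index_mset[OF p(1)] mult_le_mono[OF len len] by (simp add: p(2))
          then have "r ^ (absum M + d * d) \<le> r ^ absum (mset l)"
            using K0(1,2) by (intro power_decreasing) auto
          then have "r ^ absum M \<le> (1 / r) ^ (d * d) * r ^ absum (mset l)"
            using K0(1) by (simp add: power_add power_one_over field_simps)
          moreover have "K ^ size M \<le> K ^ d"
            using K len by (intro power_increasing) (auto simp: p(2))
          ultimately have "cmod (mon c M) \<le> K ^ d * ((1 / r) ^ (d * d) * r ^ absum (mset l))"
            using K K0(1) by (intro order.trans[OF mon] mult_mono) auto
          moreover have "cmod (coeff (sigma l) M) \<le> fact d"
            using norm_coeff_sigma[of l M] fact_mono[OF len, where 'a = real] by linarith
          ultimately show ?thesis
            unfolding norm_mult mult.assoc by (intro mult_left_mono mult_mono) auto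
        qed
        have "g l \<le> real (card (index_msets l)) *
            (cmod (a l) * (fact d * (K ^ d * ((1 / r) ^ (d * d) * r ^ absum (mset l)))))"
          unfolding g_def using sum_bounded_above[of "index_msets l", OF bd] by simp
        also have "\<dots> \<le> fact d *
            (cmod (a l) * (fact d * (K ^ d * ((1 / r) ^ (d * d) * r ^ absum (mset l)))))"
        proof (rule mult_right_mono)
          show "real (card (index_msets l)) \<le> fact d"
            using card_index_msets[of l] fact_mono[OF len, where 'a = nat]
            by (metis le_trans of_nat_fact of_nat_le_iff)
        qed (use K K0 in auto)
        finally show ?thesis by (simp add: D_def mult_ac)
      qed (simp add: g_def d)
    qed (auto simp: g_def intro: sum_nonneg)
  qed auto
  then show ?thesis .
qed

lemma coeff_sigma_not_support: "l \<in> signatures \<Longrightarrow> l \<notin> support M \<Longrightarrow> coeff (sigma l) M = 0"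
  by (simp add: support_def)

lemma supportD: "l \<in> support M \<Longrightarrow> l \<in> signatures"
  by (simp add: support_def)

lemma abs_summable_on_Times_iterate:
  fixes f :: "'a \<Rightarrow> 'b \<Rightarrow> 'c :: real_normed_vector"
  assumes "(\<lambda>(x, y). f x y) abs_summable_on A \<times> B"
  shows "\<And>x. x \<in> A \<Longrightarrow> f x abs_summable_on B"
    and "(\<lambda>x. \<Sum>\<^sub>\<infinity>y\<in>B. norm (f x y)) abs_summable_on A"
  using assms unfolding Infinite_Sum.abs_summable_on_Sigma_iff prod.case by blast+

text \<open>The double series over signatures and monomials is summed in both orders. For a fixed
  signature the sum over monomials is a multiple of the determinant in c; for a fixed monomial the
  sum over signatures is the term of \<psi>. Both inner sums have finitely many nonzero
  terms.\<close>

lemma ev_expansion: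
  assumes a: "slow_family a" "expands \<psi> a" and c: "decaying c"
  shows "(\<lambda>M. coeff \<psi> M * mon c M) abs_summable_on UNIV"
    and "(\<lambda>l. a l * jacobi_trudi c l) abs_summable_on signatures"
    and "(\<Sum>\<^sub>\<infinity>l\<in>signatures. a l * jacobi_trudi c l) = ev c \<psi>"
proof -
  let ?f = "\<lambda>l M. a l * coeff (sigma l) M * mon c M"
  have sum: "(\<lambda>(l, M). ?f l M) abs_summable_on signatures \<times> UNIV"
    by (rule abs_summable_sigma_mon[OF a(1) c])
  have jt: "(?f l has_sum a l * jacobi_trudi c l) UNIV" for l
  proof (rule has_sum_finite_neutralI)
    show "a l * jacobi_trudi c l = (\<Sum>M\<in>index_msets l. ?f l M)"
      by (simp add: jacobi_trudi_mon sum_distrib_left mult.assoc)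
  qed (auto simp: finite_index_msets coeff_sigma_outside)
  have co: "((\<lambda>l. ?f l M) has_sum coeff \<psi> M * mon c M) signatures" for M
  proof (rule has_sum_finite_neutralI)
    have "coeff \<psi> M = (\<Sum>v\<in>support M. a v * coeff (sigma v) M)"
      using a(2) unfolding expands_def by blast
    then show "coeff \<psi> M * mon c M = (\<Sum>l\<in>support M. ?f l M)"
      by (simp add: sum_distrib_right)
  qed (auto simp: finite_support coeff_sigma_not_support dest: supportD)
  note s1 = abs_summable_on_Times_iterate[OF sum]
  show "(\<lambda>l. a l * jacobi_trudi c l) abs_summable_on signatures"
  proof (rule Infinite_Sum.abs_summable_on_comparison_test[OF s1(2)])
    fix l assume "l \<in> signatures"
    have "norm (a l * jacobi_trudi c l) = norm (infsum (?f l) UNIV)"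
      using infsumI[OF jt[of l]] by simp
    also have "\<dots> \<le> (\<Sum>\<^sub>\<infinity>M. norm (?f l M))"
      by (rule norm_infsum_bound[OF s1(1)]) fact
    finally show "norm (a l * jacobi_trudi c l) \<le> norm (\<Sum>\<^sub>\<infinity>M. norm (?f l M))" by simp
  qed
  have "(\<lambda>p. norm (case p of (M, l) \<Rightarrow> ?f l M)) summable_on UNIV \<times> signatures \<longleftrightarrow>
      (\<lambda>p. norm (case p of (l, M) \<Rightarrow> ?f l M)) summable_on signatures \<times> UNIV"
    by (rule summable_on_reindex_bij_witness[where i = prod.swap and j = prod.swap]) auto
  then have "(\<lambda>(M, l). ?f l M) abs_summable_on UNIV \<times> signatures" using sum by blast
  note s2 = abs_summable_on_Times_iterate(1)[OF this UNIV_I] abs_summable_on_Times_iterate(2)[OF this]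
  show "(\<lambda>M. coeff \<psi> M * mon c M) abs_summable_on UNIV"
  proof (rule Infinite_Sum.abs_summable_on_comparison_test[OF s2(2)])
    fix M
    have "norm (coeff \<psi> M * mon c M) = norm (infsum (\<lambda>l. ?f l M) signatures)"
      using infsumI[OF co[of M]] by simp
    also have "\<dots> \<le> (\<Sum>\<^sub>\<infinity>l\<in>signatures. norm (?f l M))"
      by (rule norm_infsum_bound[OF s2(1)])
    finally show "norm (coeff \<psi> M * mon c M) \<le> norm (\<Sum>\<^sub>\<infinity>l\<in>signatures. norm (?f l M))" by simp
  qed
  have "(\<Sum>\<^sub>\<infinity>l\<in>signatures. a l * jacobi_trudi c l) = (\<Sum>\<^sub>\<infinity>l\<in>signatures. \<Sum>\<^sub>\<infinity>M. ?f l M)"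
    by (rule infsum_cong) (rule infsumI[OF jt, symmetric])
  also have "\<dots> = (\<Sum>\<^sub>\<infinity>M. \<Sum>\<^sub>\<infinity>l\<in>signatures. ?f l M)"
    by (rule infsum_swap_banach[OF abs_summable_summable[OF sum]])
  also have "\<dots> = ev c \<psi>"
    unfolding ev_def by (rule infsum_cong) (rule infsumI[OF co])
  finally show "(\<Sum>\<^sub>\<infinity>l\<in>signatures. a l * jacobi_trudi c l) = ev c \<psi>" .
qed

lemma decaying_geometric:
  "0 < r \<Longrightarrow> r < 1 \<Longrightarrow> decaying (\<lambda>n. of_real (r ^ nat \<bar>n\<bar>))"
  unfolding decaying_def by (intro exI[of _ 1] exI[of _ r]) (auto simp: norm_power)

lemma mon_geometric: "mon (\<lambda>n. of_real (r ^ nat \<bar>n\<bar>)) M = of_real (r ^ absum M)"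
  by (induction M) (simp_all add: power_add)

text \<open>Being slow means being absolutely evaluable at every decaying sequence; the sequences
  r^|n| recover the definition. In this form closure under products follows from the absolute Cauchy
  product.\<close>

lemma slow_iff: "slow \<psi> \<longleftrightarrow> (\<forall>c. decaying c \<longrightarrow> (\<lambda>M. coeff \<psi> M * mon c M) abs_summable_on UNIV)"
proof
  assume "slow \<psi>"
  then show "\<forall>c. decaying c \<longrightarrow> (\<lambda>M. coeff \<psi> M * mon c M) abs_summable_on UNIV"
    using ev_expansion(1)[OF slow_family_sigma_coeff expands_sigma_coeff] by blast
next
  assume R: "\<forall>c. decaying c \<longrightarrow> (\<lambda>M. coeff \<psi> M * mon c M) abs_summable_on UNIV"
  show "slow \<psi>"
    unfolding slow_def
  proof (intro allI impI)
    fix r :: real assume r: "0 < r" "r < 1"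
    have "(\<lambda>M. coeff \<psi> M * mon (\<lambda>n. of_real (r ^ nat \<bar>n\<bar>)) M) abs_summable_on UNIV"
      using R decaying_geometric[OF r] by blast
    then show "(\<lambda>M. cmod (coeff \<psi> M) * r ^ absum M) summable_on UNIV"
      using r unfolding mon_geometric by (simp add: norm_mult norm_power)
  qed
qed

lemma slowI:
  assumes "slow_family a" "expands \<psi> a"
  shows "slow \<psi>"
  unfolding slow_iff using ev_expansion(1)[OF assms] by blast

section \<open>Multiplicativity of the evaluation\<close>

lemma abs_summable_complexI: "(f has_sum S) A \<Longrightarrow> f abs_summable_on A" for f :: "'a \<Rightarrow> complex"
  using summable_on_iff_abs_summable_on_complex has_sum_imp_summable by blast

lemma has_sum_Times:
  fixes f :: "'a \<Rightarrow> complex" and g :: "'b \<Rightarrow> complex"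
  assumes f: "(f has_sum s) A" and g: "(g has_sum t) B"
  shows "((\<lambda>p. f (fst p) * g (snd p)) has_sum s * t) (A \<times> B)"
proof (rule has_sum_SigmaI)
  show "((\<lambda>y. f (fst (x, y)) * g (snd (x, y))) has_sum f x * t) B" for x
    using has_sum_cmult_right[OF g] by simp
  show "((\<lambda>x. f x * t) has_sum s * t) A"
    by (rule has_sum_cmult_left[OF f])
  have "(\<lambda>p. norm (f (fst p) * g (snd p))) summable_on A \<times> B"
  proof (rule summable_on_SigmaI)
    show "((\<lambda>y. norm (f (fst (x, y)) * g (snd (x, y)))) has_sum norm (f x) * infsum (\<lambda>y. norm (g y)) B) B" for x
      using has_sum_cmult_right[OF has_sum_infsum[OF abs_summable_complexI[OF g]], of "norm (f x)"]
      by (simp add: norm_mult)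
    show "(\<lambda>x. norm (f x) * infsum (\<lambda>y. norm (g y)) B) summable_on A"
      by (rule summable_on_cmult_left[OF abs_summable_complexI[OF f]])
  qed simp
  then show "(\<lambda>p. f (fst p) * g (snd p)) summable_on A \<times> B"
    by (rule abs_summable_summable)
qed

text \<open>Pairs (A, B) are grouped by their sum; each group is finite, and absolute convergence
  over all pairs permits the regrouping.\<close>

lemma cauchy_product_msets:
  fixes f g :: "int multiset \<Rightarrow> complex"
  assumes f: "f abs_summable_on UNIV" and g: "g abs_summable_on UNIV"
  defines "h \<equiv> \<lambda>M. \<Sum>(A, B) | A + B = M. f A * g B"
  shows "h abs_summable_on UNIV" "infsum h UNIV = infsum f UNIV * infsum g UNIV"
proof -
  let ?D = "\<lambda>M. {(A, B). A + B = (M :: int multiset)}"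
  let ?fg = "\<lambda>p. f (fst p) * g (snd p)"
  have hs: "(?fg has_sum infsum f UNIV * infsum g UNIV) UNIV"
    using has_sum_Times[OF has_sum_infsum[OF abs_summable_summable[OF f]]
        has_sum_infsum[OF abs_summable_summable[OF g]]] by simp
  have prod: "?fg abs_summable_on UNIV" by (rule abs_summable_complexI[OF hs])
  have sig: "(\<lambda>q. ?fg (snd q)) abs_summable_on Sigma UNIV ?D"
    using prod
    by (subst summable_on_reindex_bij_witness[where i = "\<lambda>p. (fst p + snd p, p)" and j = snd]) auto
  have D: "infsum (\<lambda>p. ?fg p) (?D M) = h M" for M
    unfolding h_def using finite_decompositions[of M] by (simp add: split_beta)
  have "(\<lambda>M. \<Sum>\<^sub>\<infinity>p\<in>?D M. norm (?fg p)) abs_summable_on UNIV"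
    using sig by (simp add: Infinite_Sum.abs_summable_on_Sigma_iff)
  then show "h abs_summable_on UNIV"
  proof (rule Infinite_Sum.abs_summable_on_comparison_test)
    fix M
    have "norm (h M) = norm (\<Sum>p\<in>?D M. ?fg p)" by (simp add: h_def split_beta)
    also have "\<dots> \<le> (\<Sum>p\<in>?D M. norm (?fg p))" by (rule norm_sum)
    also have "\<dots> = (\<Sum>\<^sub>\<infinity>p\<in>?D M. norm (?fg p))"
      using finite_decompositions[of M] by simp
    finally show "norm (h M) \<le> norm (\<Sum>\<^sub>\<infinity>p\<in>?D M. norm (?fg p))" by simp
  qed
  have "infsum h UNIV = (\<Sum>\<^sub>\<infinity>M. \<Sum>\<^sub>\<infinity>p\<in>?D M. ?fg (snd (M, p)))"
    by (simp add: D)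
  also have "\<dots> = infsum (\<lambda>q. ?fg (snd q)) (Sigma UNIV ?D)"
    by (rule infsum_Sigma_banach[OF abs_summable_summable[OF sig]])
  also have "\<dots> = infsum ?fg UNIV"
    by (rule infsum_reindex_bij_witness[where i = "\<lambda>p. (fst p + snd p, p)" and j = snd]) auto
  also have "\<dots> = infsum f UNIV * infsum g UNIV" by (rule infsumI[OF hs])
  finally show "infsum h UNIV = infsum f UNIV * infsum g UNIV" .
qed

lemma coeff_times_mon:
  "coeff (\<psi> * \<theta>) M * mon c M = (\<Sum>(A, B) | A + B = M. (coeff \<psi> A * mon c A) * (coeff \<theta> B * mon c B))"
  unfolding coeff_times sum_distrib_right by (rule sum.cong) (auto simp: mult_ac)

lemma slow_mult: "slow \<psi> \<Longrightarrow> slow \<theta> \<Longrightarrow> slow (\<psi> * \<theta>)"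
  unfolding slow_iff coeff_times_mon
  by (intro allI impI cauchy_product_msets(1)) (drule spec, drule mp, assumption, assumption)+

lemma ev_mult: "slow \<psi> \<Longrightarrow> slow \<theta> \<Longrightarrow> decaying c \<Longrightarrow> ev c (\<psi> * \<theta>) = ev c \<psi> * ev c \<theta>"
  unfolding ev_def coeff_times_mon by (rule cauchy_product_msets(2)) (simp_all only: slow_iff)

lemma ev_one [simp]: "ev c 1 = 1"
proof -
  have "((\<lambda>M. coeff 1 M * mon c M) has_sum 1) UNIV"
    by (rule has_sum_finite_neutralI[of "{{#}}"]) (auto simp: coeff_one)
  then show ?thesis unfolding ev_def by (rule infsumI)
qed

lemma ev_phi: "ev c phi = infsum c UNIV"
proof -
  have "ev c phi = (\<Sum>\<^sub>\<infinity>M\<in>range (\<lambda>n. {#n#}). coeff phi M * mon c M)"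
    unfolding ev_def
  proof (rule infsum_cong_neutral)
    fix M :: "int multiset" assume "M \<in> UNIV - range (\<lambda>n. {#n#})"
    then have "size M \<noteq> 1" using size_1_singleton_mset by blast
    then show "coeff phi M * mon c M = 0" by (simp add: phi.rep_eq)
  qed auto
  also have "\<dots> = infsum c UNIV"
    by (subst infsum_reindex) (auto simp: o_def phi.rep_eq inj_on_def)
  finally show ?thesis .
qed

section \<open>Laurent expansions near the unit circle\<close>

lemma laurent_expansion_circle:
  "laurent_expansion f c \<Longrightarrow> cmod u = 1 \<Longrightarrow> ((\<lambda>n. c n * u powi n) has_sum f u) UNIV"
  by (auto simp: laurent_expansion_def)

lemma laurent_expansionE:
  assumes "laurent_expansion f c"
  obtains e where "0 < e" "e \<le> 1"
    "\<And>u. 1 - e < cmod u \<Longrightarrow> cmod u < 1 + e \<Longrightarrow> ((\<lambda>n. c n * u powi n) has_sum f u) UNIV"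
proof -
  obtain e where "0 < e" and e: "\<And>u. 1 - e < cmod u \<Longrightarrow> cmod u < 1 + e \<Longrightarrow> ((\<lambda>n. c n * u powi n) has_sum f u) UNIV"
    using assms by (auto simp: laurent_expansion_def)
  show ?thesis
    by (rule that[of "min e 1"]) (use \<open>0 < e\<close> e in auto)
qed

lemma laurent_abs_summable:
  assumes "laurent_expansion f c"
  shows "c abs_summable_on UNIV"
  using abs_summable_complexI[OF laurent_expansion_circle[OF assms, of 1]] by simp

lemma summable_on_bounded_terms:
  fixes f :: "'a \<Rightarrow> real"
  assumes "f summable_on A" "\<And>x. x \<in> A \<Longrightarrow> 0 \<le> f x"
  obtains B where "0 \<le> B" "\<And>x. x \<in> A \<Longrightarrow> f x \<le> B"
proof (rule that[of "infsum f A"])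
  show "0 \<le> infsum f A" by (rule infsum_nonneg) (rule assms)
  fix x assume "x \<in> A"
  then have "sum f {x} \<le> infsum f A"
    by (intro finite_sum_le_infsum assms) auto
  then show "f x \<le> infsum f A" by simp
qed

text \<open>The terms are bounded at one radius above 1 and at one radius below 1; the first yields
  geometric decay for positive n, the second for negative n.\<close>

lemma laurent_decaying:
  assumes "laurent_expansion f c"
  shows "decaying c"
proof -
  obtain e where e: "0 < e" "e \<le> 1"
    "\<And>u. 1 - e < cmod u \<Longrightarrow> cmod u < 1 + e \<Longrightarrow> ((\<lambda>n. c n * u powi n) has_sum f u) UNIV"
    using laurent_expansionE[OF assms] by blast
  have ex: "\<exists>B\<ge>0. \<forall>n. cmod (c n) * x powi n \<le> B" if x: "1 - e < x" "x < 1 + e" "0 < x" for x :: real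
  proof -
    have "((\<lambda>n. c n * of_real x powi n) has_sum f (of_real x)) UNIV"
      using x by (intro e(3)) auto
    then have "(\<lambda>n. cmod (c n * of_real x powi n)) summable_on UNIV"
      by (rule abs_summable_complexI)
    then have "(\<lambda>n. cmod (c n) * x powi n) summable_on UNIV"
      using x by (simp add: norm_mult norm_power_int)
    then obtain B where "0 \<le> B" "\<And>n. n \<in> UNIV \<Longrightarrow> cmod (c n) * x powi n \<le> B"
      by (rule summable_on_bounded_terms) (use x in auto)
    then show ?thesis by auto
  qed
  define x y where "x = 1 + e / 2" and "y = 1 - e / 2"
  obtain B1 where B1: "0 \<le> B1" "\<And>n. cmod (c n) * x powi n \<le> B1"
    using ex[of x] e by (auto simp: x_def)
  obtain B2 where B2: "0 \<le> B2" "\<And>n. cmod (c n) * y powi n \<le> B2"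
    using ex[of y] e by (auto simp: y_def)
  have xy: "1 < x" "0 < y" "y < 1" using e by (auto simp: x_def y_def)
  define r where "r = max (1 / x) y"
  have r: "0 < r" "r < 1" using xy by (auto simp: r_def)
  define B where "B = max B1 B2"
  have "cmod (c n) \<le> B * r ^ nat \<bar>n\<bar>" for n
  proof (cases "0 \<le> n")
    case True
    then obtain k where k: "n = int k" using nonneg_int_cases by blast
    have "cmod (c n) \<le> B1 * (1 / x) ^ k"
      using B1(2)[of n] xy by (simp add: k power_one_over field_simps)
    also have "\<dots> \<le> B * r ^ k"
      using B1 xy by (intro mult_mono power_mono) (auto simp: B_def r_def)
    finally show ?thesis by (simp add: k)
  next
    case False
    then have k: "n = - int (nat (- n))" by simp
    define k where "k = nat (- n)"
    have k: "n = - int k" using k unfolding k_def .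
    have "cmod (c n) \<le> B2 * y ^ k"
      using B2(2)[of n] xy by (simp add: k power_int_minus field_simps)
    also have "\<dots> \<le> B * r ^ k"
      using B2 xy by (intro mult_mono power_mono) (auto simp: B_def r_def)
    finally show ?thesis by (simp add: k)
  qed
  then show ?thesis using r by (auto simp: decaying_def)
qed

definition convolution :: "(int \<Rightarrow> complex) \<Rightarrow> (int \<Rightarrow> complex) \<Rightarrow> int \<Rightarrow> complex" where
  "convolution c d n = (\<Sum>\<^sub>\<infinity>k. c (n - k) * d k)"

lemma laurent_expansion_mult:
  assumes "laurent_expansion f c" "laurent_expansion g d"
  shows "laurent_expansion (\<lambda>u. f u * g u) (convolution c d)"
proof -
  obtain e1 where e1: "0 < e1" "e1 \<le> 1"
    "\<And>u. 1 - e1 < cmod u \<Longrightarrow> cmod u < 1 + e1 \<Longrightarrow> ((\<lambda>n. c n * u powi n) has_sum f u) UNIV"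
    using laurent_expansionE[OF assms(1)] by blast
  obtain e2 where e2: "0 < e2" "e2 \<le> 1"
    "\<And>u. 1 - e2 < cmod u \<Longrightarrow> cmod u < 1 + e2 \<Longrightarrow> ((\<lambda>n. d n * u powi n) has_sum g u) UNIV"
    using laurent_expansionE[OF assms(2)] by blast
  show ?thesis
    unfolding laurent_expansion_def
  proof (intro exI[of _ "min e1 e2"] conjI allI impI)
    fix u assume u: "1 - min e1 e2 < cmod u \<and> cmod u < 1 + min e1 e2"
    then have u0: "u \<noteq> 0" using e1 e2 by auto
    have "((\<lambda>p. (c (fst p) * u powi fst p) * (d (snd p) * u powi snd p)) has_sum f u * g u) (UNIV \<times> UNIV)"
      by (rule has_sum_Times) (use u e1 e2 in auto)
    also have "?this \<longleftrightarrow> ((\<lambda>q. c (fst q - snd q) * d (snd q) * u powi fst q) has_sum f u * g u) (UNIV \<times> UNIV)"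
      by (rule has_sum_reindex_bij_witness[where i = "\<lambda>q. (fst q - snd q, snd q)"
            and j = "\<lambda>p. (fst p + snd p, snd p)"])
        (simp_all add: u0 power_int_add mult_ac)
    finally have S: "((\<lambda>q. c (fst q - snd q) * d (snd q) * u powi fst q) has_sum f u * g u) (UNIV \<times> UNIV)" .
    have inner: "((\<lambda>k. c (n - k) * d k * u powi n) has_sum convolution c d n * u powi n) UNIV" for n
    proof -
      have "(\<lambda>k. c (n - k) * d k) abs_summable_on UNIV"
      proof -
        obtain B where B: "0 \<le> B" "\<And>m. m \<in> UNIV \<Longrightarrow> cmod (c m) \<le> B"
          using summable_on_bounded_terms[OF laurent_abs_summable[OF assms(1)]] by auto
        have "(\<lambda>k. B * cmod (d k)) summable_on UNIV"
          by (rule summable_on_cmult_right[OF laurent_abs_summable[OF assms(2)]])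
        then show ?thesis
          by (rule Infinite_Sum.abs_summable_on_comparison_test') (simp add: norm_mult mult_right_mono B)
      qed
      then have "((\<lambda>k. c (n - k) * d k) has_sum convolution c d n) UNIV"
        unfolding convolution_def by (rule has_sum_infsum[OF abs_summable_summable])
      then show ?thesis by (rule has_sum_cmult_left)
    qed
    show "((\<lambda>n. convolution c d n * u powi n) has_sum f u * g u) UNIV"
      by (rule has_sum_Sigma'[OF S]) (simp add: inner)
  qed (use e1 e2 in auto)
qed

lemma laurent_expansion_cong:
  assumes "laurent_expansion f c" "0 < e" "\<And>u. 1 - e < cmod u \<Longrightarrow> cmod u < 1 + e \<Longrightarrow> f u = g u"
  shows "laurent_expansion g c"
proof -
  obtain e' where "0 < e'" and e':
    "\<And>u. 1 - e' < cmod u \<Longrightarrow> cmod u < 1 + e' \<Longrightarrow> ((\<lambda>n. c n * u powi n) has_sum f u) UNIV"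
    using laurent_expansionE[OF assms(1)] by blast
  show ?thesis
    unfolding laurent_expansion_def
  proof (intro exI[of _ "min e e'"] conjI allI impI)
    fix u assume u: "1 - min e e' < cmod u \<and> cmod u < 1 + min e e'"
    then have "((\<lambda>n. c n * u powi n) has_sum f u) UNIV" by (intro e') auto
    moreover have "f u = g u" using u by (intro assms(3)) auto
    ultimately show "((\<lambda>n. c n * u powi n) has_sum g u) UNIV" by simp
  qed (use assms(2) \<open>0 < e'\<close> in simp)
qed

lemma laurent_expansion_reflect:
  assumes "laurent_expansion f c"
  shows "laurent_expansion (\<lambda>u. f (inverse u)) (\<lambda>n. c (- n))"
proof -
  obtain e where e: "0 < e" "e \<le> 1"
    "\<And>u. 1 - e < cmod u \<Longrightarrow> cmod u < 1 + e \<Longrightarrow> ((\<lambda>n. c n * u powi n) has_sum f u) UNIV"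
    using laurent_expansionE[OF assms] by blast
  show ?thesis
    unfolding laurent_expansion_def
  \<comment> \<open>With this width the inner radius is 1 / (1 + e), so inversion maps the annulus
    into the given one.\<close>
  proof (intro exI[of _ "e / (1 + e)"] conjI allI impI)
    fix u assume u: "1 - e / (1 + e) < cmod u \<and> cmod u < 1 + e / (1 + e)"
    have "1 - e / (1 + e) = 1 / (1 + e)" using e by (simp add: field_simps)
    then have lo: "1 / (1 + e) < cmod u" using u by simp
    moreover have "0 < 1 / (1 + e)" using e by simp
    ultimately have pos: "0 < cmod u" by linarith
    have up: "inverse (cmod u) < 1 + e" using lo pos e by (simp add: field_simps)
    have "(1 - e) * cmod u \<le> (1 - e) * (1 + e / (1 + e))"
      using u e by (intro mult_left_mono) auto
    also have "\<dots> < 1" using e by (simp add: field_simps)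
    finally have "1 - e < inverse (cmod u)" using pos by (simp add: field_simps)
    then have "((\<lambda>n. c n * inverse u powi n) has_sum f (inverse u)) UNIV"
      using up by (intro e(3)) (auto simp: norm_inverse)
    also have "?this \<longleftrightarrow> ((\<lambda>n. c (- n) * u powi n) has_sum f (inverse u)) UNIV"
      by (rule has_sum_reindex_bij_witness[where i = uminus and j = uminus])
        (auto simp: power_int_minus power_int_inverse)
    finally show "((\<lambda>n. c (- n) * u powi n) has_sum f (inverse u)) UNIV" .
  qed (use e in auto)
qed

section \<open>Laurent coefficients as integrals over the circle\<close>

lemma has_integral_cis:
  fixes m :: int
  shows "((\<lambda>t. cis (of_int m * t)) has_integral (if m = 0 then of_real (2 * pi) else 0)) {0..2 * pi}"
proof (cases "m = 0")
  case True
  then show ?thesis using has_integral_const_real[of "1 :: complex" 0 "2 * pi"] by (simp add: scaleR_conv_of_real)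
next
  case False
  define F where "F t = cis (of_int m * t) / (\<i> * of_int m)" for t
  have "((\<lambda>t. cis (of_int m * t)) has_integral F (2 * pi) - F 0) {0..2 * pi}"
  proof (rule fundamental_theorem_of_calculus)
    fix t :: real
    have "((\<lambda>t. exp (\<i> * of_int m * of_real t) / (\<i> * of_int m)) has_vector_derivative
        exp (\<i> * of_int m * of_real t)) (at t within {0..2 * pi})"
      using False by (auto intro!: derivative_eq_intros has_vector_derivative_real_field)
    then show "(F has_vector_derivative cis (of_int m * t)) (at t within {0..2 * pi})"
      by (simp add: F_def[abs_def] cis_conv_exp mult_ac)
  qed simp
  moreover have "F (2 * pi) = F 0"
  proof -
    have "cis (of_int m * (2 * pi)) = cis (2 * pi) powi m" by (simp only: cis_power_int)
    then show ?thesis by (simp add: F_def)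
  qed
  ultimately show ?thesis using False by simp
qed

text \<open>Absolute summability on the circle makes the finite partial sums converge uniformly, so
  integrals pass to the limit; by orthogonality the integral of a partial sum no longer changes once
  the index n belongs to it.\<close>

lemma laurent_coeff_integral:
  assumes "laurent_expansion f c"
  shows "((\<lambda>t. f (cis t) * cis (- of_int n * t)) has_integral of_real (2 * pi) * c n) {0..2 * pi}"
proof -
  let ?g = "\<lambda>k t. c k * cis (of_int (k - n) * t)"
  have sum: "(\<lambda>k. cmod (c k)) summable_on UNIV" by (rule laurent_abs_summable[OF assms])
  have "uniform_limit {0..2 * pi} (\<lambda>F t. \<Sum>k\<in>F. ?g k t) (\<lambda>t. \<Sum>\<^sub>\<infinity>k. ?g k t) (finite_subsets_at_top UNIV)"
    by (rule Weierstrass_m_test_general[OF _ sum]) (simp add: norm_mult)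
  moreover have "(\<Sum>\<^sub>\<infinity>k. ?g k t) = f (cis t) * cis (- of_int n * t)" for t
  proof -
    have "((\<lambda>k. c k * cis t powi k * cis (- of_int n * t)) has_sum f (cis t) * cis (- of_int n * t)) UNIV"
      by (rule has_sum_cmult_left) (rule laurent_expansion_circle[OF assms], simp)
    moreover have "c k * cis t powi k * cis (- of_int n * t) = ?g k t" for k
      unfolding cis_power_int mult.assoc cis_mult by (simp add: algebra_simps)
    ultimately have "((\<lambda>k. ?g k t) has_sum f (cis t) * cis (- of_int n * t)) UNIV"
      by (simp only:)
    then show ?thesis by (rule infsumI)
  qed
  ultimately have lim: "uniform_limit {0..2 * pi} (\<lambda>F t. \<Sum>k\<in>F. ?g k t)
      (\<lambda>t. f (cis t) * cis (- of_int n * t)) (finite_subsets_at_top UNIV)" by simp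
  obtain I J where I: "\<And>F. ((\<lambda>t. \<Sum>k\<in>F. ?g k t) has_integral I F) {0..2 * pi}"
    and J: "((\<lambda>t. f (cis t) * cis (- of_int n * t)) has_integral J) {0..2 * pi}"
    and IJ: "(I \<longlongrightarrow> J) (finite_subsets_at_top UNIV)"
    by (rule uniform_limit_integral[OF lim]) (auto intro!: continuous_intros)
  have "I F = of_real (2 * pi) * c n" if "finite F" "n \<in> F" for F
  proof -
    have "((\<lambda>t. \<Sum>k\<in>F. ?g k t) has_integral
        (\<Sum>k\<in>F. c k * (if k - n = 0 then of_real (2 * pi) else 0))) {0..2 * pi}"
      using that by (intro has_integral_sum has_integral_mult_right has_integral_cis)
    then have "I F = (\<Sum>k\<in>F. c k * (if k - n = 0 then of_real (2 * pi) else 0))"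
      using I has_integral_unique by blast
    also have "\<dots> = (\<Sum>k\<in>F. if k = n then of_real (2 * pi) * c n else 0)"
      by (rule sum.cong) auto
    also have "\<dots> = of_real (2 * pi) * c n" using that by simp
    finally show ?thesis .
  qed
  then have "eventually (\<lambda>F. I F = of_real (2 * pi) * c n) (finite_subsets_at_top UNIV)"
    unfolding eventually_finite_subsets_at_top by (intro exI[of _ "{n}"]) auto
  then have "(I \<longlongrightarrow> of_real (2 * pi) * c n) (finite_subsets_at_top UNIV)"
    by (rule tendsto_eventually)
  then have "J = of_real (2 * pi) * c n"
    using IJ by (intro tendsto_unique[of "finite_subsets_at_top UNIV"]) auto
  then show ?thesis using J by simp
qed

lemma laurent_unique:
  assumes "laurent_expansion f c" "laurent_expansion f d"
  shows "c = d"
proof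
  fix n
  have "of_real (2 * pi) * c n = of_real (2 * pi) * d n"
    by (rule has_integral_unique[OF laurent_coeff_integral[OF assms(1)] laurent_coeff_integral[OF assms(2)]])
  then show "c n = d n" by simp
qed

lemma laurent_coeff_tendsto:
  assumes f: "\<And>k. laurent_expansion (f k) (c k)" and g: "laurent_expansion g d"
    and le: "\<And>k u. cmod u = 1 \<Longrightarrow> cmod (f k u) \<le> 1"
    and lim: "\<And>u. cmod u = 1 \<Longrightarrow> (\<lambda>k. f k u) \<longlonglongrightarrow> g u"
  shows "(\<lambda>k. c k n) \<longlonglongrightarrow> d n"
proof -
  let ?I = "\<lambda>h. integral {0..2 * pi} (\<lambda>t. h (cis t) * cis (- of_int n * t))"
  have "(\<lambda>k. ?I (f k)) \<longlonglongrightarrow> ?I g"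
  proof (rule dominated_convergence(2))
    show "(\<lambda>t. f k (cis t) * cis (- of_int n * t)) integrable_on {0..2 * pi}" for k
      using laurent_coeff_integral[OF f] by (rule has_integral_integrable)
    show "(\<lambda>t::real. 1 :: real) integrable_on {0..2 * pi}" by (rule integrable_const_ivl)
    show "norm (f k (cis t) * cis (- of_int n * t)) \<le> 1" for k t
      using le[of "cis t" k] by (simp add: norm_mult)
    show "(\<lambda>k. f k (cis t) * cis (- of_int n * t)) \<longlonglongrightarrow> g (cis t) * cis (- of_int n * t)" for t
      by (intro tendsto_intros lim) simp
  qed
  then have "(\<lambda>k. of_real (2 * pi) * c k n) \<longlonglongrightarrow> of_real (2 * pi) * d n"
    using integral_unique[OF laurent_coeff_integral[OF f]] integral_unique[OF laurent_coeff_integral[OF g]]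
    by simp
  then have "(\<lambda>k. of_real (2 * pi) * c k n / of_real (2 * pi)) \<longlonglongrightarrow> of_real (2 * pi) * d n / of_real (2 * pi)"
    by (rule tendsto_divide) auto
  then show ?thesis by simp
qed

lemma laurent_expansion_holomorphic:
  assumes holo: "f holomorphic_on ball 0 \<rho>" and \<rho>: "1 < \<rho>"
  obtains c where "laurent_expansion f c"
proof -
  define a where "a n = (deriv ^^ n) f 0 / fact n" for n
  have sums: "(\<lambda>n. a n * w ^ n) sums f w" if "cmod w < \<rho>" for w
    using holomorphic_power_series[OF holo, of w] that by (simp add: a_def)
  define c where "c n = (if 0 \<le> n then a (nat n) else 0)" for n :: int
  have "laurent_expansion f c"
    unfolding laurent_expansion_def
  proof (intro exI[of _ "\<rho> - 1"] conjI allI impI)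
    fix u assume "1 - (\<rho> - 1) < cmod u \<and> cmod u < 1 + (\<rho> - 1)"
    then have u: "cmod u < \<rho>" by simp
    \<comment> \<open>Absolute convergence at u follows from mere convergence at a point of larger
      modulus.\<close>
    then obtain x where x: "cmod u < x" "x < \<rho>" using dense by blast
    have "0 \<le> x" using x(1) norm_ge_zero[of u] by linarith
    then have nx: "cmod (of_real x) = x" by simp
    have "summable (\<lambda>n. a n * of_real x ^ n)" using sums[of "of_real x"] nx x by (simp add: sums_iff)
    then have "summable (\<lambda>n. norm (a n * u ^ n))"
      by (rule powser_insidea) (use nx x in simp)
    then have "((\<lambda>n. a n * u ^ n) has_sum f u) UNIV"
      using sums[OF u] by (rule norm_summable_imp_has_sum)
    then have "((\<lambda>n. c n * u powi n) has_sum f u) (range int)"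
      by (subst has_sum_reindex) (auto simp: o_def c_def)
    also have "?this \<longleftrightarrow> ((\<lambda>n. c n * u powi n) has_sum f u) UNIV"
    proof (rule has_sum_cong_neutral)
      fix n :: int assume "n \<in> UNIV - range int"
      then have "\<not> 0 \<le> n" by (metis DiffE UNIV_I nonneg_int_cases rangeI)
      then show "c n * u powi n = 0" by (simp add: c_def)
    qed auto
    finally show "((\<lambda>n. c n * u powi n) has_sum f u) UNIV" .
  qed (use \<rho> in simp)
  then show ?thesis by (rule that)
qed

section \<open>The functions \<open>\<Phi>(u; \<omega>)\<close>\<close>

lemma prodinf_LIMSEQ:
  fixes f :: "nat \<Rightarrow> complex"
  assumes "summable (\<lambda>i. norm (f i - 1))"
  shows "convergent_prod f" "(\<lambda>n. \<Prod>i<n. f i) \<longlonglongrightarrow> prodinf f"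
proof -
  show "convergent_prod f"
    using assms by (intro abs_convergent_prod_imp_convergent_prod) (simp add: abs_convergent_prod_conv_summable)
  then show "(\<lambda>n. \<Prod>i<n. f i) \<longlonglongrightarrow> prodinf f"
    by (intro has_prod_imp_tendsto' convergent_prod_has_prod)
qed

text \<open>A longer partial product is the product of the first m factors, bounded by the
  exponential of the total sum, times a block that differs from 1 by at most the exponential of the
  tail sum minus 1.\<close>

lemma prodinf_tail_bound:
  fixes f :: "nat \<Rightarrow> complex"
  assumes M: "\<And>i. norm (f i - 1) \<le> M i" "summable M"
  shows "norm (prodinf f - (\<Prod>i<m. f i)) \<le> exp (suminf M) * (exp (\<Sum>i. M (i + m)) - 1)"
proof -
  have M0: "0 \<le> M i" for i using order.trans[OF norm_ge_zero M(1)] .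
  have conv: "summable (\<lambda>i. norm (f i - 1))"
    by (rule summable_comparison_test'[OF M(2), of 0]) (simp add: M(1))
  have sumM: "sum M A \<le> suminf M" if "finite A" for A
    by (rule sum_le_suminf) (use M M0 that in auto)
  have bd: "norm ((\<Prod>i<n. f i) - (\<Prod>i<m. f i)) \<le> exp (suminf M) * (exp (\<Sum>i. M (i + m)) - 1)"
    if "m \<le> n" for n
  proof -
    have "{..<n} = {..<m} \<union> {m..<n}" "{..<m} \<inter> {m..<n} = {}" using that by auto
    then have "(\<Prod>i<n. f i) - (\<Prod>i<m. f i) = (\<Prod>i<m. f i) * ((\<Prod>i=m..<n. f i) - 1)"
      by (simp add: prod.union_disjoint algebra_simps)
    moreover have "norm (\<Prod>i<m. f i) \<le> exp (suminf M)"
    proof -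
      have "norm (\<Prod>i<m. f i) = (\<Prod>i<m. norm (f i))" by (simp add: prod_norm)
      also have "\<dots> \<le> (\<Prod>i<m. 1 + M i)"
      proof (rule prod_mono, clarify)
        fix i
        have "norm (f i) \<le> norm (1 :: complex) + norm (f i - 1)"
          using norm_triangle_ineq[of 1 "f i - 1"] by simp
        then show "0 \<le> norm (f i) \<and> norm (f i) \<le> 1 + M i" using M(1)[of i] by simp
      qed
      also have "\<dots> \<le> exp (\<Sum>i<m. M i)" by (rule prod_le_exp_sum) (rule M0)
      also have "\<dots> \<le> exp (suminf M)" using sumM[of "{..<m}"] by simp
      finally show ?thesis .
    qed
    moreover have "norm ((\<Prod>i=m..<n. f i) - 1) \<le> exp (\<Sum>i. M (i + m)) - 1"
    proof -
      have "norm ((\<Prod>i=m..<n. f i) - 1) = norm ((\<Prod>i=m..<n. 1 + (f i - 1)) - 1)" by simp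
      also have "\<dots> \<le> (\<Prod>i=m..<n. 1 + norm (f i - 1)) - 1" by (rule norm_prod_minus1_le_prod_minus1)
      also have "(\<Prod>i=m..<n. 1 + norm (f i - 1)) \<le> (\<Prod>i=m..<n. 1 + M i)"
        by (rule prod_mono) (simp add: M(1))
      also have "\<dots> \<le> exp (\<Sum>i=m..<n. M i)" by (rule prod_le_exp_sum) (rule M0)
      also have "(\<Sum>i=m..<n. M i) = (\<Sum>i<n - m. M (i + m))"
        by (rule sum.reindex_bij_witness[where i = "\<lambda>i. i + m" and j = "\<lambda>i. i - m"]) auto
      also have "(\<Sum>i<n - m. M (i + m)) \<le> (\<Sum>i. M (i + m))"
        by (rule sum_le_suminf) (use M(2) M0 in \<open>auto simp: summable_iff_shift\<close>)
      finally show ?thesis by simp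
    qed
    ultimately show ?thesis by (simp add: norm_mult mult_mono)
  qed
  show ?thesis
  proof (rule LIMSEQ_le_const2)
    show "(\<lambda>n. norm ((\<Prod>i<n. f i) - (\<Prod>i<m. f i))) \<longlonglongrightarrow> norm (prodinf f - (\<Prod>i<m. f i))"
      by (intro tendsto_intros prodinf_LIMSEQ(2)[OF conv])
  qed (use bd in blast)
qed

text \<open>Tannery's theorem for products: the common majorant makes the tails uniformly small, and
  the finitely many remaining factors converge.\<close>

lemma tendsto_prodinf:
  fixes f :: "nat \<Rightarrow> nat \<Rightarrow> complex"
  assumes M: "\<And>k i. norm (f k i - 1) \<le> M i" "\<And>i. norm (g i - 1) \<le> M i" "summable M"
    and lim: "\<And>i. (\<lambda>k. f k i) \<longlonglongrightarrow> g i"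
  shows "(\<lambda>k. prodinf (f k)) \<longlonglongrightarrow> prodinf g"
proof (rule tendstoI)
  fix e :: real assume e: "0 < e"
  define t where "t m = exp (suminf M) * (exp (\<Sum>i. M (i + m)) - 1)" for m
  have "t \<longlonglongrightarrow> exp (suminf M) * (exp 0 - 1)"
    unfolding t_def by (intro tendsto_intros suminf_exist_split2 M(3))
  then have "t \<longlonglongrightarrow> 0" by simp
  then have "eventually (\<lambda>m. t m < e / 3) sequentially" using e by (intro order_tendstoD(2)) auto
  then obtain m where m: "t m < e / 3" by (auto simp: eventually_sequentially)
  have "(\<lambda>k. \<Prod>i<m. f k i) \<longlonglongrightarrow> (\<Prod>i<m. g i)" by (intro tendsto_prod lim)
  then have "eventually (\<lambda>k. dist (\<Prod>i<m. f k i) (\<Prod>i<m. g i) < e / 3) sequentially"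
    using e by (intro tendstoD) auto
  then show "eventually (\<lambda>k. dist (prodinf (f k)) (prodinf g) < e) sequentially"
  proof eventually_elim
    case (elim k)
    have "dist (prodinf (f k)) (\<Prod>i<m. f k i) \<le> t m"
      unfolding dist_norm t_def by (rule prodinf_tail_bound[OF M(1,3)])
    moreover have "dist (prodinf g) (\<Prod>i<m. g i) \<le> t m"
      unfolding dist_norm t_def by (rule prodinf_tail_bound[OF M(2,3)])
    moreover have "dist (prodinf (f k)) (prodinf g) \<le> dist (prodinf (f k)) (\<Prod>i<m. f k i) +
        dist (\<Prod>i<m. f k i) (\<Prod>i<m. g i) + dist (prodinf g) (\<Prod>i<m. g i)"
      using dist_triangle[of "prodinf (f k)" "prodinf g" "\<Prod>i<m. f k i"]
        dist_triangle2[of "\<Prod>i<m. f k i" "prodinf g" "\<Prod>i<m. g i"] by (simp add: dist_commute)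
    ultimately show ?case using elim m by linarith
  qed
qed

section \<open>The two halves of \<Phi>\<close>

definition admissible :: "(nat \<Rightarrow> real) \<Rightarrow> (nat \<Rightarrow> real) \<Rightarrow> real \<Rightarrow> bool" where
  "admissible a b d \<longleftrightarrow> decseq a \<and> decseq b \<and> (\<forall>i. 0 \<le> a i) \<and> (\<forall>i. 0 \<le> b i) \<and>
     summable (\<lambda>i. a i + b i) \<and> (\<Sum>i. a i + b i) \<le> d \<and> b 0 \<le> 1"

definition gfac :: "real \<Rightarrow> real \<Rightarrow> complex \<Rightarrow> complex" where
  "gfac a b z = (1 + of_real b * (z - 1)) / (1 - of_real a * (z - 1))"

text \<open>The part of \<Phi> that belongs to one sign; the other sign enters as a function of the
  same kind in 1 / u. For a single half the joint condition on the \<beta> parameters leaves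
  \<open>b 0 \<le> 1\<close>.\<close>

definition hfun :: "(nat \<Rightarrow> real) \<Rightarrow> (nat \<Rightarrow> real) \<Rightarrow> real \<Rightarrow> complex \<Rightarrow> complex" where
  "hfun a b d z = exp (of_real (d - (\<Sum>i. a i + b i)) * (z - 1)) * (\<Prod>i. gfac (a i) (b i) z)"

text \<open>The denominator is (1 + a) - a z. The radius is chosen so that a |z| \<le> a + 1 / 2 for
  all a up to A, which keeps all factors of a half regular in one common disc.\<close>

lemma gfac_denominator:
  assumes "0 \<le> a" "a \<le> A" "cmod z \<le> 1 + 1 / (2 * (1 + A))"
  shows "1 / 2 \<le> cmod (1 - of_real a * (z - 1))"
proof -
  have "a * cmod z \<le> a * (1 + 1 / (2 * (1 + A)))" using assms by (intro mult_left_mono) auto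
  also have "\<dots> = a + a / (2 * (1 + A))" by (simp add: distrib_left)
  also have "a / (2 * (1 + A)) \<le> 1 / 2" using assms by (simp add: field_simps)
  finally have "1 / 2 \<le> (1 + a) - a * cmod z" by simp
  also have "\<dots> = cmod (of_real (1 + a)) - cmod (of_real a * z)"
    using assms by (simp only: norm_of_real norm_mult, simp?)
  also have "\<dots> \<le> cmod (of_real (1 + a) - of_real a * z)" by (rule norm_triangle_ineq2)
  also have "of_real (1 + a) - of_real a * z = 1 - of_real a * (z - 1)" by (simp add: algebra_simps)
  finally show ?thesis .
qed

text \<open>The difference is (a + b) (z - 1) over the denominator; |z - 1| \<le> 3 in the disc and
  the lower bound 1 / 2 for the denominator give the factor 6.\<close>

lemma gfac_minus_one:
  assumes "0 \<le> a" "a \<le> A" "0 \<le> b" "cmod z \<le> 1 + 1 / (2 * (1 + A))"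
  shows "cmod (gfac a b z - 1) \<le> 6 * (a + b)"
proof -
  note den = gfac_denominator[OF assms(1,2,4)]
  have "1 - of_real a * (z - 1) \<noteq> 0" using den by auto
  then have "gfac a b z - 1 = of_real (a + b) * (z - 1) / (1 - of_real a * (z - 1))"
    by (simp add: gfac_def field_simps)
  then have eq: "cmod (gfac a b z - 1) = (a + b) * cmod (z - 1) / cmod (1 - of_real a * (z - 1))"
    using assms by (simp only: norm_divide norm_mult norm_of_real, simp?)
  have "1 / (2 * (1 + A)) \<le> 1" using assms by (simp add: field_simps)
  then have "cmod (z - 1) \<le> 3" using norm_triangle_ineq4[of z 1] assms(4) by simp
  then have "(a + b) * cmod (z - 1) / cmod (1 - of_real a * (z - 1)) \<le> (a + b) * 3 / (1 / 2)"
    using den assms by (intro frac_le mult_left_mono mult_nonneg_nonneg) auto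
  then show ?thesis using eq by simp
qed

lemma gfac_summable:
  assumes "admissible a b d" "cmod z \<le> 1 + 1 / (2 * (1 + a 0))"
  shows "summable (\<lambda>i. norm (gfac (a i) (b i) z - 1))"
proof (rule summable_comparison_test')
  show "summable (\<lambda>i. 6 * (a i + b i))" using assms(1) by (intro summable_mult) (simp add: admissible_def)
  show "norm (norm (gfac (a i) (b i) z - 1)) \<le> 6 * (a i + b i)" for i
    using assms gfac_minus_one[of "a i" "a 0" "b i" z] by (simp add: admissible_def decseq_def)
qed

text \<open>On the circle the numerator is a convex combination of 1 and z, and the denominator (1 +
  a) - a z has modulus at least (1 + a) - a = 1.\<close>

lemma norm_gfac_circle:
  assumes "0 \<le> a" "0 \<le> b" "b \<le> 1" "cmod z = 1"
  shows "cmod (gfac a b z) \<le> 1"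
proof -
  have "1 + of_real b * (z - 1) = of_real (1 - b) + of_real b * z" by (simp add: algebra_simps)
  also have "cmod \<dots> \<le> cmod (of_real (1 - b)) + cmod (of_real b * z)" by (rule norm_triangle_ineq)
  also have "\<dots> = 1" using assms by (simp only: norm_of_real norm_mult, simp?)
  finally have num: "cmod (1 + of_real b * (z - 1)) \<le> 1" .
  have "1 = cmod (of_real (1 + a)) - cmod (of_real a * z)"
    using assms by (simp only: norm_of_real norm_mult, simp?)
  also have "\<dots> \<le> cmod (of_real (1 + a) - of_real a * z)" by (rule norm_triangle_ineq2)
  also have "of_real (1 + a) - of_real a * z = 1 - of_real a * (z - 1)" by (simp add: algebra_simps)
  finally have den: "1 \<le> cmod (1 - of_real a * (z - 1))" .
  have "cmod (gfac a b z) \<le> 1 / 1"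
    unfolding gfac_def norm_divide using num den by (intro frac_le) auto
  then show ?thesis by simp
qed

lemma norm_exp_circle:
  assumes "0 \<le> g" "cmod z = 1"
  shows "cmod (exp (of_real g * (z - 1))) \<le> 1"
proof -
  have "Re z \<le> 1" using complex_Re_le_cmod[of z] assms by simp
  then have "g * (Re z - 1) \<le> 0" using assms by (intro mult_nonneg_nonpos) auto
  then show ?thesis by (simp add: norm_exp_eq_Re)
qed

lemma circle_in_annulus: "cmod z = 1 \<Longrightarrow> 0 \<le> A \<Longrightarrow> cmod z \<le> 1 + 1 / (2 * (1 + A))" for A :: real
  by simp

lemma admissible_le_one: "admissible a b d \<Longrightarrow> b i \<le> 1"
  unfolding admissible_def decseq_def by (meson le0 order.trans)

lemma hfun_partial_products:
  assumes "admissible a b d" "cmod z = 1"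
  shows "(\<lambda>n. exp (of_real (d - (\<Sum>i. a i + b i)) * (z - 1)) * (\<Prod>i<n. gfac (a i) (b i) z)) \<longlonglongrightarrow> hfun a b d z"
  unfolding hfun_def
  by (intro tendsto_intros prodinf_LIMSEQ gfac_summable[OF assms(1)] circle_in_annulus[OF assms(2)])
    (use assms in \<open>simp add: admissible_def\<close>)

lemma norm_hfun_partial:
  assumes "admissible a b d" "cmod z = 1"
  shows "norm (exp (of_real (d - (\<Sum>i. a i + b i)) * (z - 1)) * (\<Prod>i<n. gfac (a i) (b i) z)) \<le> 1"
proof -
  have "norm (\<Prod>i<n. gfac (a i) (b i) z) \<le> 1"
    unfolding prod_norm[symmetric]
    by (intro prod_le_1) (use assms admissible_le_one[OF assms(1)] in \<open>auto simp: admissible_def intro!: norm_gfac_circle\<close>)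
  moreover have "norm (exp (of_real (d - (\<Sum>i. a i + b i)) * (z - 1))) \<le> 1"
    using assms by (intro norm_exp_circle) (auto simp: admissible_def)
  ultimately show ?thesis unfolding norm_mult by (intro mult_le_one) auto
qed

lemma norm_hfun_circle:
  assumes "admissible a b d" "cmod z = 1"
  shows "cmod (hfun a b d z) \<le> 1"
  using norm_hfun_partial[OF assms]
  by (intro LIMSEQ_le_const2[OF tendsto_norm[OF hfun_partial_products[OF assms]]]) blast

lemma hfun_holomorphic:
  assumes h: "admissible a b d"
  shows "hfun a b d holomorphic_on ball 0 (1 + 1 / (2 * (1 + a 0)))"
proof -
  let ?S = "ball 0 (1 + 1 / (2 * (1 + a 0))) :: complex set"
  have h': "\<And>i. 0 \<le> a i" "\<And>i. a i \<le> a 0" "\<And>i. 0 \<le> b i" "summable (\<lambda>i. a i + b i)"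
    using h by (auto simp: admissible_def decseq_def)
  have inS: "cmod z \<le> 1 + 1 / (2 * (1 + a 0))" if "z \<in> ?S" for z using that by simp
  have holo: "(\<lambda>z. gfac (a i) (b i) z) holomorphic_on ?S" for i
  proof -
    have "1 - of_real (a i) * (z - 1) \<noteq> 0" if "z \<in> ?S" for z
      using gfac_denominator[OF h'(1,2) inS[OF that], of i] by auto
    then show ?thesis unfolding gfac_def by (intro holomorphic_intros) auto
  qed
  have "(\<lambda>z. \<Prod>i. gfac (a i) (b i) z) holomorphic_on ?S"
  proof (rule holomorphic_uniform_sequence)
    show "(\<lambda>z. \<Prod>i<n. gfac (a i) (b i) z) holomorphic_on ?S" for n
      by (intro holomorphic_intros holo)
    fix x assume "x \<in> ?S"
    then obtain e where e: "0 < e" "cball x e \<subseteq> ?S" using open_ball open_contains_cball by blast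
    have "uniformly_convergent_on (cball x e) (\<lambda>N z. \<Prod>n<N. gfac (a n) (b n) z)"
    proof (rule uniformly_convergent_on_prod')
      show "continuous_on (cball x e) (gfac (a n) (b n))" for n
        using holo e(2) by (meson continuous_on_subset holomorphic_on_imp_continuous_on)
      show "uniformly_convergent_on (cball x e) (\<lambda>N z. \<Sum>n<N. norm (gfac (a n) (b n) z - 1))"
      proof (rule Weierstrass_m_test')
        show "norm (norm (gfac (a n) (b n) z - 1)) \<le> 6 * (a n + b n)" if "z \<in> cball x e" for n z
          using that e(2) by (simp only: real_norm_def abs_norm_cancel) (intro gfac_minus_one[of _ "a 0"] h' inS, blast)
        show "summable (\<lambda>n. 6 * (a n + b n))" by (intro summable_mult h')
      qed
    qed simp
    then obtain l where l: "uniform_limit (cball x e) (\<lambda>N z. \<Prod>n<N. gfac (a n) (b n) z) l sequentially"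
      by (auto simp: uniformly_convergent_on_def)
    have "l z = (\<Prod>i. gfac (a i) (b i) z)" if "z \<in> cball x e" for z
    proof (rule LIMSEQ_unique)
      show "(\<lambda>N. \<Prod>n<N. gfac (a n) (b n) z) \<longlonglongrightarrow> l z" by (rule tendsto_uniform_limitI[OF l that])
      show "(\<lambda>N. \<Prod>n<N. gfac (a n) (b n) z) \<longlonglongrightarrow> (\<Prod>i. gfac (a i) (b i) z)"
        by (intro prodinf_LIMSEQ gfac_summable[OF h] inS) (use that e(2) in blast)
    qed
    then have "uniform_limit (cball x e) (\<lambda>N z. \<Prod>n<N. gfac (a n) (b n) z)
        (\<lambda>z. \<Prod>i. gfac (a i) (b i) z) sequentially"
      using l by (subst uniform_limit_cong'[where g = "\<lambda>N z. \<Prod>n<N. gfac (a n) (b n) z" and i = l]) auto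
    then show "\<exists>d>0. cball x d \<subseteq> ?S \<and> uniform_limit (cball x d) (\<lambda>N z. \<Prod>n<N. gfac (a n) (b n) z)
        (\<lambda>z. \<Prod>i. gfac (a i) (b i) z) sequentially"
      using e by blast
  qed simp
  then show ?thesis unfolding hfun_def[abs_def] by (intro holomorphic_intros)
qed

lemma Omega_admissible:
  assumes "(ap, bp, am, bm, dp, dm) \<in> Omega"
  shows "admissible ap bp dp" "admissible am bm dm"
proof -
  have *: "decseq ap" "decseq bp" "decseq am" "decseq bm" "\<And>i. 0 \<le> ap i" "\<And>i. 0 \<le> bp i"
      "\<And>i. 0 \<le> am i" "\<And>i. 0 \<le> bm i" "summable (\<lambda>i. ap i + bp i)" "(\<Sum>i. ap i + bp i) \<le> dp"
      "summable (\<lambda>i. am i + bm i)" "(\<Sum>i. am i + bm i) \<le> dm" "bp 0 + bm 0 \<le> 1"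
    using assms by (auto simp: Omega_def)
  have b: "bp 0 \<le> 1" "bm 0 \<le> 1" using *(13) *(6)[of 0] *(8)[of 0] by linarith+
  show "admissible ap bp dp" using * b unfolding admissible_def by (intro conjI allI) auto
  show "admissible am bm dm" using * b unfolding admissible_def by (intro conjI allI) auto
qed

lemma Phi_hfun:
  assumes "admissible ap bp dp" "admissible am bm dm"
    and u: "cmod u \<le> 1 + 1 / (2 * (1 + ap 0))" "cmod (inverse u) \<le> 1 + 1 / (2 * (1 + am 0))"
  shows "Phi u (ap, bp, am, bm, dp, dm) = hfun ap bp dp u * hfun am bm dm (inverse u)"
proof -
  have "(\<Prod>i. gfac (ap i) (bp i) u) * (\<Prod>i. gfac (am i) (bm i) (inverse u)) =
      (\<Prod>i. gfac (ap i) (bp i) u * gfac (am i) (bm i) (inverse u))"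
    by (intro prodinf_mult prodinf_LIMSEQ(1) gfac_summable[OF assms(1)] gfac_summable[OF assms(2)] u)
  then show ?thesis
    by (simp add: Phi_def hfun_def gfac_def Let_def exp_add mult_ac)
qed

lemma Phi_laurent:
  assumes "\<omega> \<in> Omega"
  shows "laurent_expansion (\<lambda>u. Phi u \<omega>) (phi_hat \<omega>)"
proof -
  obtain ap bp am bm dp dm where \<omega>: "\<omega> = (ap, bp, am, bm, dp, dm)" by (metis prod_cases6)
  note h = Omega_admissible[OF assms[unfolded \<omega>]]
  have a0: "0 \<le> ap 0" "0 \<le> am 0" using h by (auto simp: admissible_def)
  define rp rm where "rp = 1 / (2 * (1 + ap 0))" and "rm = 1 / (2 * (1 + am 0))"
  have r: "0 < rp" "0 < rm" "rm < 1" using a0 by (auto simp: rp_def rm_def field_simps)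
  obtain c where c: "laurent_expansion (hfun ap bp dp) c"
    using laurent_expansion_holomorphic[OF hfun_holomorphic[OF h(1)]] r(1) by (auto simp: rp_def)
  obtain d where d: "laurent_expansion (hfun am bm dm) d"
    using laurent_expansion_holomorphic[OF hfun_holomorphic[OF h(2)]] r(2) by (auto simp: rm_def)
  have L: "laurent_expansion (\<lambda>u. hfun ap bp dp u * hfun am bm dm (inverse u)) (convolution c (\<lambda>n. d (- n)))"
    by (rule laurent_expansion_mult[OF c laurent_expansion_reflect[OF d]])
  have "laurent_expansion (\<lambda>u. Phi u \<omega>) (convolution c (\<lambda>n. d (- n)))"
  \<comment> \<open>Half of \<open>rm\<close> leaves room for the inversion: (1 + rm) (1 - rm / 2)
    \<ge> 1 because \<open>rm \<le> 1\<close>, so 1 / |u| stays in the disc of the minus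
    half.\<close>
  proof (rule laurent_expansion_cong[OF L, of "min rp (rm / 2)"])
    fix u assume u: "1 - min rp (rm / 2) < cmod u" "cmod u < 1 + min rp (rm / 2)"
    have "1 \<le> (1 + rm) * (1 - rm / 2)"
    proof -
      have "rm * rm \<le> rm * 1" using r by (intro mult_left_mono) auto
      then show ?thesis by (simp add: algebra_simps)
    qed
    also have "\<dots> \<le> (1 + rm) * cmod u" using u r by (intro mult_left_mono) auto
    finally have "1 \<le> (1 + rm) * cmod u" .
    moreover have "0 < cmod u" using u r by linarith
    ultimately have "inverse (cmod u) \<le> 1 + rm" by (simp add: field_simps)
    then have "cmod (inverse u) \<le> 1 + rm" by (simp only: norm_inverse)
    then show "hfun ap bp dp u * hfun am bm dm (inverse u) = Phi u \<omega>"
      unfolding \<omega> using u by (intro Phi_hfun[symmetric] h) (auto simp: rp_def rm_def)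
  qed (use r in auto)
  moreover from this have "phi_hat \<omega> = convolution c (\<lambda>n. d (- n))"
    unfolding phi_hat_def by (intro the_equality laurent_unique)
  ultimately show ?thesis by simp
qed

lemma phi_hat_eqI: "laurent_expansion (\<lambda>u. Phi u \<omega>) c \<Longrightarrow> phi_hat \<omega> = c"
  unfolding phi_hat_def by (intro the_equality laurent_unique)

lemma Phi_hfun_circle:
  assumes "(ap, bp, am, bm, dp, dm) \<in> Omega" "cmod u = 1"
  shows "Phi u (ap, bp, am, bm, dp, dm) = hfun ap bp dp u * hfun am bm dm (inverse u)"
proof -
  note h = Omega_admissible[OF assms(1)]
  show ?thesis
    by (rule Phi_hfun[OF h]) (use h assms(2) in \<open>auto simp: admissible_def norm_inverse\<close>)
qed

lemma norm_Phi_circle: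
  assumes "\<omega> \<in> Omega" "cmod u = 1"
  shows "cmod (Phi u \<omega>) \<le> 1"
proof -
  obtain ap bp am bm dp dm where \<omega>: "\<omega> = (ap, bp, am, bm, dp, dm)" by (metis prod_cases6)
  note h = Omega_admissible[OF assms(1)[unfolded \<omega>]]
  have "cmod (hfun ap bp dp u) * cmod (hfun am bm dm (inverse u)) \<le> 1"
    by (intro mult_le_one norm_hfun_circle h) (auto simp: assms(2) norm_inverse)
  then show ?thesis using Phi_hfun_circle[OF assms(1)[unfolded \<omega>] assms(2)] by (simp add: \<omega> norm_mult)
qed

subsection \<open>Continuity in \<open>\<omega>\<close>\<close>

text \<open>The sums \<open>\<Sum> (\<alpha>\<^sub>i + \<beta>\<^sub>i)\<close> are not continuous, but moving them from the exponential factor into the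
  product makes the factors \<open>1 + O((\<alpha>\<^sub>i + \<beta>\<^sub>i)\<^sup>2)\<close>, and \<open>\<alpha>\<^sub>i + \<beta>\<^sub>i \<le> \<delta> / i\<close> by monotonicity.\<close>

lemma hfun_regularized:
  assumes h: "admissible a b d" and z: "cmod z = 1"
  shows "hfun a b d z = exp (of_real d * (z - 1)) *
    (\<Prod>i. gfac (a i) (b i) z * exp (- of_real (a i + b i) * (z - 1)))"
proof -
  have s: "summable (\<lambda>i. a i + b i)" using h by (simp add: admissible_def)
  then have s': "(\<lambda>i. - of_real (a i + b i) * (z - 1)) sums (- of_real (\<Sum>i. a i + b i) * (z - 1))"
    by (intro sums_mult2 sums_minus sums_of_real summable_sums)
  have cp: "convergent_prod (\<lambda>i. gfac (a i) (b i) z)"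
    by (intro prodinf_LIMSEQ(1) gfac_summable[OF h] circle_in_annulus[OF z]) (use h in \<open>simp add: admissible_def\<close>)
  have ce: "convergent_prod (\<lambda>i. exp (- of_real (a i + b i) * (z - 1)))"
    using sums_imp_has_prod_exp[OF s'] unfolding convergent_prod_def by blast
  have "(\<Prod>i. exp (- of_real (a i + b i) * (z - 1))) = exp (- of_real (\<Sum>i. a i + b i) * (z - 1))"
    using prodinf_exp[OF sums_summable[OF s']] sums_unique[OF s'] by simp
  then have "(\<Prod>i. gfac (a i) (b i) z * exp (- of_real (a i + b i) * (z - 1))) =
      (\<Prod>i. gfac (a i) (b i) z) * exp (- of_real (\<Sum>i. a i + b i) * (z - 1))"
    using prodinf_mult[OF cp ce] by simp
  then show ?thesis
    by (simp add: hfun_def exp_add[symmetric] algebra_simps)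
qed

text \<open>With x = z - 1, s = a + b and R the second order remainder of exp (- s x), the first
  order terms cancel and the numerator becomes (1 + b x) R - b s x^2. On the circle |x| \<le> 2, so
  |1 + b x| \<le> 3 and |R| \<le> 4 exp (2 D) s^2, whence the constants 12 exp (2 D) and 4.\<close>

lemma regularized_factor_bound:
  assumes "0 \<le> a" "0 \<le> b" "b \<le> 1" "a + b \<le> D" "cmod z = 1"
  shows "cmod (gfac a b z * exp (- of_real (a + b) * (z - 1)) - 1) \<le> (4 + 12 * exp (2 * D)) * (a + b)\<^sup>2"
proof -
  define x where "x = z - 1"
  define s where "s = a + b"
  define y where "y = - complex_of_real s * x"
  define R where "R = exp y - (1 + y)"
  have s: "0 \<le> s" "b \<le> s" "s \<le> D" using assms by (auto simp: s_def)
  have x: "cmod x \<le> 2" unfolding x_def using norm_triangle_ineq4[of z 1] assms by simp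
  have y: "cmod y \<le> 2 * s"
    unfolding y_def norm_mult using x s by (simp add: mult.commute mult_left_mono)
  have x2: "cmod x ^ 2 \<le> 4" using power_mono[OF x, of 2] by simp
  have R: "cmod R \<le> exp (2 * D) * (4 * s\<^sup>2)"
  proof -
    have "cmod R \<le> exp \<bar>Re y\<bar> * (cmod y)\<^sup>2"
      using Taylor_exp[of y 1] by (simp add: R_def atMost_Suc power2_eq_square add.commute)
    also have "\<dots> \<le> exp (2 * D) * (2 * s)\<^sup>2"
      using abs_Re_le_cmod[of y] y s by (intro mult_mono power_mono) auto
    finally show ?thesis by (simp add: power_mult_distrib)
  qed
  have den: "1 \<le> cmod (1 - of_real a * x)"
  proof -
    have "1 = cmod (of_real (1 + a)) - cmod (of_real a * z)"
      using assms by (simp only: norm_of_real norm_mult, simp?)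
    also have "\<dots> \<le> cmod (of_real (1 + a) - of_real a * z)" by (rule norm_triangle_ineq2)
    also have "of_real (1 + a) - of_real a * z = 1 - of_real a * x" by (simp add: x_def algebra_simps)
    finally show ?thesis .
  qed
  then have ne: "1 - of_real a * x \<noteq> 0" by auto
  define n where "n = (1 + of_real b * x) * R - of_real (b * s) * x\<^sup>2"
  have "exp y = R + 1 + y" by (simp add: R_def)
  then have "(1 + of_real b * x) * exp y - (1 - of_real a * x) =
      (1 + of_real b * x) * (R + 1 + y) - (1 - of_real a * x)" by simp
  also have "\<dots> = n"
    unfolding n_def y_def s_def by (simp add: algebra_simps power2_eq_square)
  finally have "gfac a b z * exp y - 1 = n / (1 - of_real a * x)"
    using ne by (simp add: gfac_def x_def[symmetric] diff_divide_distrib[symmetric] field_simps)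
  then have "cmod (gfac a b z * exp y - 1) = cmod n / cmod (1 - of_real a * x)" by (simp add: norm_divide)
  also have "\<dots> \<le> cmod n" using den by (simp add: divide_le_eq mult_le_cancel_left1)
  also have "cmod n \<le> cmod ((1 + of_real b * x) * R) + cmod (of_real (b * s) * x\<^sup>2)"
    unfolding n_def by (rule norm_triangle_ineq4)
  also have "\<dots> \<le> 3 * (exp (2 * D) * (4 * s\<^sup>2)) + s\<^sup>2 * 4"
  proof (rule add_mono)
    have "cmod (1 + of_real b * x) \<le> cmod 1 + cmod (of_real b * x)" by (rule norm_triangle_ineq)
    also have "\<dots> \<le> 1 + 1 * 2"
      unfolding norm_mult using assms x by (intro add_mono mult_mono) auto
    finally show "cmod ((1 + of_real b * x) * R) \<le> 3 * (exp (2 * D) * (4 * s\<^sup>2))"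
      unfolding norm_mult using R by (intro mult_mono) auto
    have "b * s \<le> s * s" using s by (intro mult_right_mono) auto
    then show "cmod (of_real (b * s) * x\<^sup>2) \<le> s\<^sup>2 * 4"
      unfolding norm_mult norm_power norm_of_real
      using s assms x2 by (intro mult_mono) (auto simp: power2_eq_square)
  qed
  finally show ?thesis by (simp add: y_def s_def x_def algebra_simps)
qed

lemma admissible_decay:
  assumes h: "admissible a b d"
  shows "a i + b i \<le> d / real (Suc i)"
proof -
  have "real (Suc i) * (a i + b i) = (\<Sum>j<Suc i. a i + b i)" by simp
  also have "\<dots> \<le> (\<Sum>j<Suc i. a j + b j)"
    using h by (intro sum_mono add_mono) (auto simp: admissible_def decseq_def)
  also have "\<dots> \<le> (\<Sum>j. a j + b j)"
    using h by (intro sum_le_suminf) (auto simp: admissible_def)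
  also have "\<dots> \<le> d" using h by (simp add: admissible_def)
  finally show ?thesis by (simp add: field_simps)
qed

lemma hfun_tendsto:
  assumes h: "\<And>k. admissible (a k) (b k) (d k)" "admissible a' b' d'"
    and lim: "\<And>i. (\<lambda>k. a k i) \<longlonglongrightarrow> a' i" "\<And>i. (\<lambda>k. b k i) \<longlonglongrightarrow> b' i" "d \<longlonglongrightarrow> d'"
    and z: "cmod z = 1"
  shows "(\<lambda>k. hfun (a k) (b k) (d k) z) \<longlonglongrightarrow> hfun a' b' d' z"
proof -
  have "Bseq d" using lim(3) by (intro convergent_imp_Bseq convergentI)
  then obtain D0 where D0: "\<And>k. norm (d k) \<le> D0" by (auto simp: Bseq_def)
  define D where "D = max D0 d'"
  have D: "d k \<le> D" "d' \<le> D" for k using D0[of k] by (auto simp: D_def)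
  \<comment> \<open>\<open>D\<close> bounds all the totals at once, so a_i + b_i \<le> D / (i + 1)
    turns the quadratic estimate into a summable majorant independent of k.\<close>
  define M where "M i = (4 + 12 * exp (2 * D)) * (D\<^sup>2 * inverse (real (Suc i) ^ 2))" for i
  have "summable (\<lambda>i. inverse (real (Suc i) ^ 2))"
    using inverse_power_summable[of 2, where 'a = real] by (subst summable_Suc_iff) simp
  then have sumM: "summable M" unfolding M_def by (intro summable_mult)
  have bound: "cmod (gfac (a i) (b i) z * exp (- of_real (a i + b i) * (z - 1)) - 1) \<le> M i"
    if h: "admissible a b d" and "d \<le> D" for a b d i
  proof -
    have ab: "0 \<le> a i" "0 \<le> b i" "b i \<le> 1" using h admissible_le_one[OF h] by (auto simp: admissible_def)
    have le: "a i + b i \<le> D / real (Suc i)"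
      using admissible_decay[OF h, of i] divide_right_mono[OF \<open>d \<le> D\<close>, of "real (Suc i)"] by linarith
    have D0: "0 \<le> D"
    proof (rule ccontr)
      assume "\<not> 0 \<le> D"
      then have "D / real (Suc i) < 0" by (simp add: divide_neg_pos)
      then show False using le ab by linarith
    qed
    have "D / real (Suc i) \<le> D / 1" using D0 by (intro divide_left_mono) auto
    then have "a i + b i \<le> D" using le by simp
    then have "cmod (gfac (a i) (b i) z * exp (- of_real (a i + b i) * (z - 1)) - 1) \<le>
        (4 + 12 * exp (2 * D)) * (a i + b i)\<^sup>2"
      by (rule regularized_factor_bound[OF ab _ z])
    also have "\<dots> \<le> (4 + 12 * exp (2 * D)) * (D / real (Suc i))\<^sup>2"
      using ab le by (intro mult_left_mono power_mono) (auto intro: add_nonneg_nonneg)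
    also have "\<dots> = M i" by (simp add: M_def power_divide field_simps)
    finally show ?thesis .
  qed
  have "(\<lambda>k. \<Prod>i. gfac (a k i) (b k i) z * exp (- of_real (a k i + b k i) * (z - 1))) \<longlonglongrightarrow>
      (\<Prod>i. gfac (a' i) (b' i) z * exp (- of_real (a' i + b' i) * (z - 1)))"
  proof (rule tendsto_prodinf[OF bound[OF h(1) D(1)] bound[OF h(2) D(2)] sumM])
    fix i
    have "0 \<le> a' 0" "0 \<le> a' i" "a' i \<le> a' 0" using h(2) by (auto simp: admissible_def decseq_def)
    then have "1 - of_real (a' i) * (z - 1) \<noteq> 0"
      using gfac_denominator[of "a' i" "a' 0" z] circle_in_annulus[OF z, of "a' 0"] by auto
    then show "(\<lambda>k. gfac (a k i) (b k i) z * exp (- of_real (a k i + b k i) * (z - 1))) \<longlonglongrightarrow>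
        gfac (a' i) (b' i) z * exp (- of_real (a' i + b' i) * (z - 1))"
      unfolding gfac_def by (intro tendsto_intros lim)
  qed
  then have "(\<lambda>k. exp (of_real (d k) * (z - 1)) *
      (\<Prod>i. gfac (a k i) (b k i) z * exp (- of_real (a k i + b k i) * (z - 1)))) \<longlonglongrightarrow>
      exp (of_real d' * (z - 1)) * (\<Prod>i. gfac (a' i) (b' i) z * exp (- of_real (a' i + b' i) * (z - 1)))"
    by (intro tendsto_intros lim)
  then show ?thesis by (simp only: hfun_regularized[OF h(1) z] hfun_regularized[OF h(2) z])
qed

lemma tendsto_coordinate:
  fixes f :: "'b \<Rightarrow> nat \<Rightarrow> real"
  assumes "(f \<longlongrightarrow> g) F"
  shows "((\<lambda>k. f k i) \<longlongrightarrow> g i) F"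
proof -
  have "isCont (\<lambda>x::nat \<Rightarrow> real. x i) g"
  proof -
    have "continuous_on UNIV (\<lambda>x::nat \<Rightarrow> real. x i)" by (rule continuous_on_product_coordinates)
    then show ?thesis
      using continuous_on_eq_continuous_at[OF open_UNIV, of "\<lambda>x::nat \<Rightarrow> real. x i"] by blast
  qed
  from isCont_tendsto_compose[OF this assms] show ?thesis .
qed

lemma phi_hat_tendsto:
  assumes "\<And>k. x k \<in> Omega" "\<omega> \<in> Omega" "x \<longlonglongrightarrow> \<omega>"
  shows "(\<lambda>k. phi_hat (x k) n) \<longlonglongrightarrow> phi_hat \<omega> n"
proof (rule laurent_coeff_tendsto[OF Phi_laurent[OF assms(1)] Phi_laurent[OF assms(2)]])
  show "cmod (Phi u (x k)) \<le> 1" if "cmod u = 1" for k u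
    by (rule norm_Phi_circle[OF assms(1) that])
  fix u :: complex assume u: "cmod u = 1"
  obtain ap bp am bm dp dm where \<omega>: "\<omega> = (ap, bp, am, bm, dp, dm)" by (metis prod_cases6)
  define AP BP AM BM DP DM where "AP k = fst (x k)" and "BP k = fst (snd (x k))"
    and "AM k = fst (snd (snd (x k)))" and "BM k = fst (snd (snd (snd (x k))))"
    and "DP k = fst (snd (snd (snd (snd (x k)))))" and "DM k = snd (snd (snd (snd (snd (x k)))))" for k
  have x: "x k = (AP k, BP k, AM k, BM k, DP k, DM k)" for k
    by (simp add: AP_def BP_def AM_def BM_def DP_def DM_def)
  have lim: "AP \<longlonglongrightarrow> ap" "BP \<longlonglongrightarrow> bp" "AM \<longlonglongrightarrow> am" "BM \<longlonglongrightarrow> bm" "DP \<longlonglongrightarrow> dp" "DM \<longlonglongrightarrow> dm"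
    using tendsto_fst[OF assms(3)] tendsto_fst[OF tendsto_snd[OF assms(3)]]
      tendsto_fst[OF tendsto_snd[OF tendsto_snd[OF assms(3)]]]
      tendsto_fst[OF tendsto_snd[OF tendsto_snd[OF tendsto_snd[OF assms(3)]]]]
      tendsto_fst[OF tendsto_snd[OF tendsto_snd[OF tendsto_snd[OF tendsto_snd[OF assms(3)]]]]]
      tendsto_snd[OF tendsto_snd[OF tendsto_snd[OF tendsto_snd[OF tendsto_snd[OF assms(3)]]]]]
    by (simp_all add: \<omega> AP_def[abs_def] BP_def[abs_def] AM_def[abs_def] BM_def[abs_def] DP_def[abs_def] DM_def[abs_def])
  have h: "admissible (AP k) (BP k) (DP k)" "admissible (AM k) (BM k) (DM k)" for k
    using Omega_admissible assms(1)[of k] x[of k] by auto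
  note h' = Omega_admissible[OF assms(2)[unfolded \<omega>]]
  have "(\<lambda>k. hfun (AP k) (BP k) (DP k) u * hfun (AM k) (BM k) (DM k) (inverse u)) \<longlonglongrightarrow>
      hfun ap bp dp u * hfun am bm dm (inverse u)"
    by (intro tendsto_mult hfun_tendsto h h' tendsto_coordinate lim) (auto simp: u norm_inverse)
  moreover have "Phi u (x k) = hfun (AP k) (BP k) (DP k) u * hfun (AM k) (BM k) (DM k) (inverse u)" for k
    using Phi_hfun_circle[OF assms(1)[of k, unfolded x] u] by (simp add: x)
  ultimately show "(\<lambda>k. Phi u (x k)) \<longlonglongrightarrow> Phi u \<omega>"
    using Phi_hfun_circle[OF assms(2)[unfolded \<omega>] u] by (simp add: \<omega>)
qed

section \<open>Total positivity of the Laurent coefficients\<close>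

text \<open>Nonnegativity of the minors with consecutive columns. For n_i = \<lambda>_i - i these
  are the determinants that evaluate the \<sigma> of \<lambda>, and strict decrease of n is weak
  decrease of \<lambda>.\<close>

definition tp :: "(int \<Rightarrow> real) \<Rightarrow> bool" where
  "tp c \<longleftrightarrow> (\<forall>N n. (\<forall>i j. i < j \<longrightarrow> j < N \<longrightarrow> n j < n i) \<longrightarrow> 0 \<le> detm N (\<lambda>i j. c (n i + int j)))"

lemma tpD: "tp c \<Longrightarrow> (\<And>i j. i < j \<Longrightarrow> j < N \<Longrightarrow> n j < n i) \<Longrightarrow> 0 \<le> detm N (\<lambda>i j. c (n i + int j))"
  by (simp add: tp_def)

lemma tp_weak:
  assumes "tp c" and n: "\<And>i j. i < j \<Longrightarrow> j < N \<Longrightarrow> n j \<le> n i"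
  shows "0 \<le> detm N (\<lambda>i j. c (n i + int j))"
proof (cases "\<exists>i j. i < j \<and> j < N \<and> n i = n j")
  case True
  then obtain i j where ij: "i < j" "j < N" "n i = n j" by blast
  have "detm N (\<lambda>i j. c (n i + int j)) = 0"
    by (rule detm_identical_rows[of i _ j]) (use ij in auto)
  then show ?thesis by simp
next
  case False
  have "n j < n i" if "i < j" "j < N" for i j
    using n[OF that] False that by (metis order.not_eq_order_implies_strict)
  then show ?thesis by (rule tpD[OF assms(1)])
qed

lemma detm_scale_rows: "detm n (\<lambda>i j. w i * f i j) = (\<Prod>i<n. w i) * detm n f"
  unfolding detm_leibniz
  by (simp add: prod.distrib sum_distrib_left lessThan_atLeast0 mult_ac)

text \<open>Each row mixes the shifts by 0 and by 1 with nonnegative weights. In the multilinear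
  expansion strictly decreasing shifts remain weakly decreasing, and coinciding rows contribute
  zero.\<close>

lemma tp_beta:
  assumes c: "tp c" and b: "0 \<le> b" "b \<le> 1"
  shows "tp (\<lambda>n. (1 - b) * c n + b * c (n - 1))"
  unfolding tp_def
proof (intro allI impI)
  fix N :: nat and n :: "nat \<Rightarrow> int" assume n: "\<forall>i j. i < j \<longrightarrow> j < N \<longrightarrow> n j < n i"
  define w where "w k = (if k = 0 then 1 - b else b)" for k :: int
  have "detm N (\<lambda>i j. (1 - b) * c (n i + int j) + b * c (n i + int j - 1)) =
      detm N (\<lambda>i j. \<Sum>k\<in>{0, 1}. w k * c (n i - k + int j))"
    by (rule detm_cong) (simp add: w_def algebra_simps)
  also have "\<dots> = (\<Sum>xs\<in>boxes N (\<lambda>_. {0, 1}). detm N (\<lambda>i j. w (xs ! i) * c (n i - xs ! i + int j)))"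
    by (rule detm_multilinear) simp
  also have "\<dots> \<ge> 0"
  proof (rule sum_nonneg)
    fix xs :: "int list" assume xs: "xs \<in> boxes N (\<lambda>_. {0, 1})"
    have "0 \<le> detm N (\<lambda>i j. c ((n i - xs ! i) + int j))"
    proof (rule tp_weak[OF c])
      fix i j assume ij: "i < j" "j < N"
      then have "xs ! i \<in> {0, 1}" "xs ! j \<in> {0, 1}" using xs by (auto simp: boxes_def)
      then show "n j - xs ! j \<le> n i - xs ! i" using n ij by fastforce
    qed
    moreover have "0 \<le> (\<Prod>i<N. w (xs ! i))"
      by (rule prod_nonneg) (use b in \<open>simp add: w_def\<close>)
    ultimately show "0 \<le> detm N (\<lambda>i j. w (xs ! i) * c (n i - xs ! i + int j))"
      by (simp add: detm_scale_rows)
  qed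
  finally show "0 \<le> detm N (\<lambda>i j. (1 - b) * c (n i + int j) + b * c (n i + int j - 1))" .
qed

lemma tendsto_detm:
  fixes f :: "'b \<Rightarrow> nat \<Rightarrow> nat \<Rightarrow> 'a :: real_normed_field"
  assumes "\<And>i j. i < n \<Longrightarrow> j < n \<Longrightarrow> ((\<lambda>k. f k i j) \<longlongrightarrow> g i j) F"
  shows "((\<lambda>k. detm n (f k)) \<longlongrightarrow> detm n g) F"
  unfolding detm_leibniz
proof (intro tendsto_sum tendsto_mult tendsto_const tendsto_prod)
  fix p i assume "p \<in> {p. p permutes {0..<n}}" "i \<in> {0..<n}"
  then show "((\<lambda>k. f k i (p i)) \<longlongrightarrow> g i (p i)) F"
    by (intro assms) (auto dest: permutes_in_image)
qed

lemma tp_limit: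
  assumes "\<And>k. tp (c k)" "\<And>n. (\<lambda>k. c k n) \<longlonglongrightarrow> d n"
  shows "tp d"
  unfolding tp_def
proof (intro allI impI)
  fix N :: nat and n :: "nat \<Rightarrow> int" assume n: "\<forall>i j. i < j \<longrightarrow> j < N \<longrightarrow> n j < n i"
  have "(\<lambda>k. detm N (\<lambda>i j. c k (n i + int j))) \<longlonglongrightarrow> detm N (\<lambda>i j. d (n i + int j))"
    by (intro tendsto_detm assms)
  then show "0 \<le> detm N (\<lambda>i j. d (n i + int j))"
    by (rule LIMSEQ_le_const) (use assms(1) n in \<open>auto simp: tp_def\<close>)
qed

text \<open>Subtracting from every row a multiple of the next one turns the geometric sums into finite ones
  over consecutive, disjoint ranges; only the last row needs a limit.\<close>

lemma tp_alpha:
  assumes c: "tp c" and r: "0 \<le> r" "r < 1" and B: "\<And>n. \<bar>d n\<bar> \<le> B"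
    and rec: "\<And>n. d n = (1 - r) * c n + r * d (n - 1)"
  shows "tp d"
  unfolding tp_def
proof (intro allI impI)
  fix N :: nat and n :: "nat \<Rightarrow> int" assume n: "\<forall>i j. i < j \<longrightarrow> j < N \<longrightarrow> n j < n i"
  have iter: "d x = (\<Sum>k<q. (1 - r) * r ^ k * c (x - int k)) + r ^ q * d (x - int q)" for x q
  proof (induction q)
    case (Suc q)
    have "d (x - int q) = (1 - r) * c (x - int q) + r * d (x - int (Suc q))"
      using rec[of "x - int q"] by (simp add: algebra_simps)
    then have "r ^ q * d (x - int q) =
        r ^ q * ((1 - r) * c (x - int q) + r * d (x - int (Suc q)))" by simp
    also have "\<dots> = (1 - r) * r ^ q * c (x - int q) + r ^ Suc q * d (x - int (Suc q))"
      by (simp only: power_Suc distrib_left mult_ac)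
    finally show ?case using Suc.IH by (simp only: sum.lessThan_Suc add.assoc)
  qed simp
  \<comment> \<open>The gap to the next row: iterating the recursion that often expresses row i by
    finitely many values of c plus a multiple of row i + 1. The last row has no successor and is cut
    off at K.\<close>
  define q where "q K i = (if Suc i < N then nat (n i - n (Suc i)) else K)" for K i
  have D: "0 \<le> detm N (\<lambda>i j. \<Sum>k\<in>{..<q K i}. (1 - r) * r ^ k * c (n i - int k + int j))" for K
  proof -
    have "detm N (\<lambda>i j. \<Sum>k\<in>{..<q K i}. (1 - r) * r ^ k * c (n i - int k + int j)) =
        (\<Sum>xs\<in>boxes N (\<lambda>i. {..<q K i}). detm N (\<lambda>i j. (1 - r) * r ^ (xs ! i) * c (n i - int (xs ! i) + int j)))"
      by (rule detm_multilinear) simp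
    also have "\<dots> \<ge> 0"
    proof (rule sum_nonneg)
      fix xs assume xs: "xs \<in> boxes N (\<lambda>i. {..<q K i})"
      have "0 \<le> detm N (\<lambda>i j. c ((n i - int (xs ! i)) + int j))"
      proof (rule tpD[OF c])
        fix i j assume ij: "i < j" "j < N"
        have "n j \<le> n (Suc i)"
        proof (cases "j = Suc i")
          case False
          then have "Suc i < j" using ij by simp
          then have "n j < n (Suc i)" using n ij(2) by blast
          then show ?thesis by simp
        qed simp
        moreover have "int (xs ! i) < n i - n (Suc i)"
        proof -
          have "i < N" "Suc i < N" using ij by auto
          have "xs ! i < q K i" using xs \<open>i < N\<close> by (simp add: boxes_def)
          then have "xs ! i < nat (n i - n (Suc i))" using \<open>Suc i < N\<close> by (simp add: q_def)
          then show ?thesis by linarith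
        qed
        ultimately show "n j - int (xs ! j) < n i - int (xs ! i)" by simp
      qed
      moreover have "0 \<le> (\<Prod>i<N. (1 - r) * r ^ (xs ! i))"
        by (rule prod_nonneg) (use r in auto)
      ultimately show "0 \<le> detm N (\<lambda>i j. (1 - r) * r ^ (xs ! i) * c (n i - int (xs ! i) + int j))"
        by (simp add: detm_scale_rows)
    qed
    finally show ?thesis .
  qed
  define A where "A i j = d (n i + int j)" for i j
  define w where "w i = - (r ^ nat (n i - n (Suc i)))" for i
  have "(\<lambda>K. detm N (\<lambda>i j. \<Sum>k\<in>{..<q K i}. (1 - r) * r ^ k * c (n i - int k + int j))) \<longlonglongrightarrow>
      detm N (\<lambda>i j. A i j + (if Suc i < N then w i * A (Suc i) j else 0))"
  proof (rule tendsto_detm)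
    fix i j assume i: "i < N"
    have eq: "(\<Sum>k\<in>{..<q K i}. (1 - r) * r ^ k * c (n i - int k + int j)) =
        A i j - r ^ q K i * d (n i + int j - int (q K i))" for K
      using iter[of "n i + int j" "q K i"] by (simp add: A_def algebra_simps)
    show "(\<lambda>K. \<Sum>k\<in>{..<q K i}. (1 - r) * r ^ k * c (n i - int k + int j)) \<longlonglongrightarrow>
        A i j + (if Suc i < N then w i * A (Suc i) j else 0)"
    proof (cases "Suc i < N")
      case True
      then have "n (Suc i) < n i" using n by blast
      have e: "q K i = nat (n i - n (Suc i))" for K using True by (simp add: q_def)
      have "n i + int j - int (nat (n i - n (Suc i))) = n (Suc i) + int j"
        using \<open>n (Suc i) < n i\<close> by simp
      then have "A i j - r ^ q K i * d (n i + int j - int (q K i)) =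
          A i j + (if Suc i < N then w i * A (Suc i) j else 0)" for K
        unfolding e using True by (simp only: A_def w_def if_True, simp?)
      then show ?thesis by (simp only: eq tendsto_const)
    next
      case False
      \<comment> \<open>Boundedness of d removes the remainder of the last row in the limit.\<close>
      have "(\<lambda>K. r ^ K * d (n i + int j - int K)) \<longlonglongrightarrow> 0"
      proof (rule Lim_null_comparison)
        show "\<forall>\<^sub>F K in sequentially. norm (r ^ K * d (n i + int j - int K)) \<le> r ^ K * B"
          using r B by (intro always_eventually allI) (simp add: abs_mult mult_left_mono)
        have "(\<lambda>K. r ^ K * B) \<longlonglongrightarrow> 0 * B"
          using r by (intro tendsto_mult tendsto_const LIMSEQ_power_zero) auto
        then show "(\<lambda>K. r ^ K * B) \<longlonglongrightarrow> 0" by simp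
      qed
      then show ?thesis unfolding eq using False tendsto_diff[OF tendsto_const, of "\<lambda>K. r ^ K * d (n i + int j - int K)" 0 _ "A i j"]
        by (simp add: q_def)
    qed
  qed
  then have "0 \<le> detm N (\<lambda>i j. A i j + (if Suc i < N then w i * A (Suc i) j else 0))"
    by (rule LIMSEQ_le_const) (use D in blast)
  then show "0 \<le> detm N (\<lambda>i j. d (n i + int j))"
    by (simp only: detm_add_next_row) (simp add: A_def)
qed

text \<open>Conjugation by the reversal matrix E, an involution, so the sign of its determinant
  cancels.\<close>

lemma detm_reverse: "detm n (\<lambda>i j. f (n - 1 - i) (n - 1 - j)) = detm n f"
proof -
  define E :: "nat \<Rightarrow> nat \<Rightarrow> 'a" where "E i j = (if j = n - 1 - i then 1 else 0)" for i j
  have left: "(\<Sum>k<n. E i k * g k j) = g (n - 1 - i) j" if "i < n" for i j and g :: "nat \<Rightarrow> nat \<Rightarrow> 'a"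
  proof -
    have "(\<Sum>k<n. E i k * g k j) = (\<Sum>k<n. if k = n - 1 - i then g (n - 1 - i) j else 0)"
      by (rule sum.cong) (auto simp: E_def)
    then show ?thesis using that by simp
  qed
  have right: "(\<Sum>k<n. g i k * E k j) = g i (n - 1 - j)" if "j < n" for i j and g :: "nat \<Rightarrow> nat \<Rightarrow> 'a"
  proof -
    have "(\<Sum>k<n. g i k * E k j) = (\<Sum>k<n. if k = n - 1 - j then g i (n - 1 - j) else 0)"
      by (rule sum.cong) (use that in \<open>auto simp: E_def\<close>)
    then show ?thesis using that by simp
  qed
  have "detm n E * detm n E = detm n (\<lambda>i j. \<Sum>k<n. E i k * E k j)" by (rule detm_mult[symmetric])
  also have "\<dots> = detm n (\<lambda>i j. if i = j then 1 else 0)"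
    by (rule detm_cong) (simp only: left, auto simp: E_def)
  also have "\<dots> = 1" by (subst detm_upper_triangular) auto
  finally have EE: "detm n E * detm n E = 1" .
  have "detm n (\<lambda>i j. f (n - 1 - i) (n - 1 - j)) = detm n (\<lambda>i j. \<Sum>k<n. E i k * (\<Sum>l<n. f k l * E l j))"
    by (rule detm_cong) (simp add: left right)
  also have "\<dots> = detm n E * (detm n f * detm n E)" by (simp only: detm_mult)
  also have "\<dots> = (detm n E * detm n E) * detm n f" by (simp only: mult_ac)
  finally show ?thesis by (simp only: EE mult_1)
qed

text \<open>Negating the argument makes the row shifts increase and the columns run backwards;
  reversing both orders restores the required form, and the offset N - 1 in \<open>m\<close>
  renumbers the columns from 0.\<close>

lemma tp_reflect:
  assumes "tp c"
  shows "tp (\<lambda>n. c (- n))"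
  unfolding tp_def
proof (intro allI impI)
  fix N :: nat and n :: "nat \<Rightarrow> int" assume n: "\<forall>i j. i < j \<longrightarrow> j < N \<longrightarrow> n j < n i"
  define m where "m i = - n (N - 1 - i) - int (N - 1)" for i
  have "detm N (\<lambda>i j. c (- (n i + int j))) = detm N (\<lambda>i j. c (m (N - 1 - i) + int (N - 1 - j)))"
    by (rule detm_cong) (auto simp: m_def of_nat_diff algebra_simps)
  also have "\<dots> = detm N (\<lambda>i j. c (m i + int j))"
    by (rule detm_reverse[of N "\<lambda>i j. c (m i + int j)"])
  also have "\<dots> \<ge> 0"
  proof (rule tpD[OF assms])
    fix i j assume "i < j" "j < N"
    then have "n (N - 1 - i) < n (N - 1 - j)" using n by auto
    then show "m j < m i" by (simp add: m_def)
  qed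
  finally show "0 \<le> detm N (\<lambda>i j. c (- (n i + int j)))" .
qed

text \<open>If row 0 starts at a positive argument it vanishes; otherwise strict decrease forces n_i
  \<le> - i, and the matrix is upper triangular with diagonal entries 0 or 1.\<close>

lemma tp_delta: "tp (\<lambda>n. if n = 0 then 1 else 0)"
  unfolding tp_def
proof (intro allI impI)
  fix N :: nat and n :: "nat \<Rightarrow> int" assume n: "\<forall>i j. i < j \<longrightarrow> j < N \<longrightarrow> n j < n i"
  let ?c = "\<lambda>n::int. if n = 0 then 1 else 0 :: real"
  show "0 \<le> detm N (\<lambda>i j. ?c (n i + int j))"
  proof (cases "N > 0 \<and> n 0 > 0")
    case True
    have "detm N (\<lambda>i j. ?c (n i + int j)) = 0"
      unfolding detm_leibniz
    proof (rule sum.neutral, rule ballI)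
      fix p
      have "(\<Prod>i = 0..<N. ?c (n i + int (p i))) = 0"
        by (rule prod_zero) (use True in \<open>auto intro!: bexI[of _ 0]\<close>)
      then show "of_int (sign p) * (\<Prod>i = 0..<N. ?c (n i + int (p i))) = 0" by simp
    qed
    then show ?thesis by simp
  next
    case False
    have le: "n i \<le> - int i" if "i < N" for i
      using that
    proof (induction i)
      case (Suc i)
      then have "n (Suc i) < n i" "n i \<le> - int i" using n by auto
      then show ?case by simp
    qed (use False in simp)
    have "detm N (\<lambda>i j. ?c (n i + int j)) = (\<Prod>i<N. ?c (n i + int i))"
    proof (rule detm_upper_triangular)
      fix i j :: nat assume "j < i" "i < N"
      then show "?c (n i + int j) = 0" using le[of i] by simp
    qed
    also have "\<dots> \<ge> 0" by (rule prod_nonneg) simp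
    finally show ?thesis .
  qed
qed

text \<open>The bound on the circle lets the Laurent coefficients pass to pointwise limits by dominated
  convergence.\<close>

definition tp_function :: "(complex \<Rightarrow> complex) \<Rightarrow> bool" where
  "tp_function f \<longleftrightarrow> (\<exists>c. laurent_expansion f (\<lambda>n. of_real (c n)) \<and> tp c) \<and> (\<forall>u. cmod u = 1 \<longrightarrow> cmod (f u) \<le> 1)"

lemma laurent_expansion_linear:
  assumes "laurent_expansion f c"
  shows "laurent_expansion (\<lambda>u. f u * (p + q * u)) (\<lambda>n. p * c n + q * c (n - 1))"
proof -
  define d where "d n = (if n = 0 then p else if n = 1 then q else 0)" for n :: int
  have "laurent_expansion (\<lambda>u. p + q * u) d"
    unfolding laurent_expansion_def
  proof (intro exI[of _ 1] conjI allI impI)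
    fix u :: complex
    show "((\<lambda>n. d n * u powi n) has_sum p + q * u) UNIV"
      by (rule has_sum_finite_neutralI[of "{0, 1}"]) (auto simp: d_def)
  qed simp
  from laurent_expansion_mult[OF assms this]
  have "laurent_expansion (\<lambda>u. f u * (p + q * u)) (convolution c d)" .
  moreover have "convolution c d = (\<lambda>n. p * c n + q * c (n - 1))"
  proof
    fix n
    have "((\<lambda>k. c (n - k) * d k) has_sum p * c n + q * c (n - 1)) UNIV"
      by (rule has_sum_finite_neutralI[of "{0, 1}"]) (auto simp: d_def)
    then show "convolution c d n = p * c n + q * c (n - 1)" unfolding convolution_def by (rule infsumI)
  qed
  ultimately show ?thesis by simp
qed

lemma tp_function_one: "tp_function (\<lambda>u. 1)"
proof -
  have "laurent_expansion (\<lambda>u. 1) (\<lambda>n. of_real (if n = 0 then 1 else 0))"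
    unfolding laurent_expansion_def
  proof (intro exI[of _ 1] conjI allI impI)
    fix u :: complex
    show "((\<lambda>n. of_real (if n = 0 then 1 else 0) * u powi n) has_sum 1) UNIV"
      by (rule has_sum_finite_neutralI[of "{0}"]) auto
  qed simp
  then show ?thesis
    unfolding tp_function_def using tp_delta
    by (intro conjI exI[of _ "\<lambda>n. if n = 0 then 1 else 0"]) auto
qed

lemma tp_function_reflect:
  assumes "tp_function f"
  shows "tp_function (\<lambda>u. f (inverse u))"
proof -
  obtain c where c: "laurent_expansion f (\<lambda>n. of_real (c n))" "tp c" using assms by (auto simp: tp_function_def)
  have "laurent_expansion (\<lambda>u. f (inverse u)) (\<lambda>n. of_real (c (- n)))"
    using laurent_expansion_reflect[OF c(1)] .
  then show ?thesis
    unfolding tp_function_def using tp_reflect[OF c(2)] assms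
    by (intro conjI exI[of _ "\<lambda>n. c (- n)"]) (auto simp: tp_function_def norm_inverse)
qed

text \<open>An expansion of \<open>g\<close> is assumed because a pointwise limit on the circle need
  not have one; its coefficients are then limits of real numbers, hence real.\<close>

lemma tp_function_limit:
  assumes f: "\<And>k. tp_function (f k)" and g: "laurent_expansion g d"
    and lim: "\<And>u. cmod u = 1 \<Longrightarrow> (\<lambda>k. f k u) \<longlonglongrightarrow> g u"
  shows "tp_function g"
proof -
  have "\<exists>c. laurent_expansion (f k) (\<lambda>n. of_real (c n)) \<and> tp c" for k
    using f[of k] by (simp add: tp_function_def)
  then obtain c where c: "\<And>k. laurent_expansion (f k) (\<lambda>n. of_real (c k n))" "\<And>k. tp (c k)" by metis
  have le: "cmod (f k u) \<le> 1" if "cmod u = 1" for k u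
    using f[of k] that by (simp add: tp_function_def)
  have tend: "(\<lambda>k. complex_of_real (c k n)) \<longlonglongrightarrow> d n" for n
    by (rule laurent_coeff_tendsto[OF c(1) g le lim])
  have Re: "(\<lambda>k. c k n) \<longlonglongrightarrow> Re (d n)" for n
    using tendsto_Re[OF tend[of n]] by simp
  have d: "d = (\<lambda>n. of_real (Re (d n)))"
  proof
    fix n
    have "(\<lambda>k. 0 :: real) \<longlonglongrightarrow> Im (d n)" using tendsto_Im[OF tend[of n]] by simp
    then have "Im (d n) = 0" by (simp add: LIMSEQ_const_iff)
    then show "d n = of_real (Re (d n))" by (simp add: complex_eq_iff)
  qed
  have "tp (\<lambda>n. Re (d n))" by (rule tp_limit[OF c(2) Re])
  moreover have "laurent_expansion g (\<lambda>n. of_real (Re (d n)))" using g d by simp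
  moreover have "cmod (g u) \<le> 1" if "cmod u = 1" for u
    by (rule LIMSEQ_le_const2[OF tendsto_norm[OF lim[OF that]]]) (use le[OF that] in blast)
  ultimately show ?thesis
    unfolding tp_function_def by (intro conjI exI[of _ "\<lambda>n. Re (d n)"]) auto
qed

lemma tp_function_beta:
  assumes "tp_function f" "0 \<le> b" "b \<le> 1"
  shows "tp_function (\<lambda>u. f u * (1 + of_real b * (u - 1)))"
proof -
  obtain c where c: "laurent_expansion f (\<lambda>n. of_real (c n))" "tp c" using assms by (auto simp: tp_function_def)
  have "laurent_expansion (\<lambda>u. f u * (of_real (1 - b) + of_real b * u))
      (\<lambda>n. of_real (1 - b) * of_real (c n) + of_real b * of_real (c (n - 1)))"
    by (rule laurent_expansion_linear[OF c(1)])
  moreover have "(\<lambda>u. f u * (of_real (1 - b) + of_real b * u)) = (\<lambda>u. f u * (1 + of_real b * (u - 1)))"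
    by (simp add: algebra_simps)
  ultimately have "laurent_expansion (\<lambda>u. f u * (1 + of_real b * (u - 1)))
      (\<lambda>n. of_real ((1 - b) * c n + b * c (n - 1)))" by simp
  moreover have "cmod (f u * (1 + of_real b * (u - 1))) \<le> 1" if "cmod u = 1" for u
    using norm_gfac_circle[of 0 b u] assms that
    by (auto simp: tp_function_def norm_mult gfac_def intro!: mult_le_one)
  ultimately show ?thesis
    unfolding tp_function_def using tp_beta[OF c(2) assms(2,3)]
    by (intro conjI exI[of _ "\<lambda>n. (1 - b) * c n + b * c (n - 1)"]) auto
qed

text \<open>Multiplying back by the denominator (1 + a) - a u shows that c n is (1 + a) e n - a e (n
  - 1), which is the recursion of \<open>tp_alpha\<close> with r = a / (1 + a).\<close>

lemma tp_function_alpha: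
  assumes f: "tp_function f" and a: "0 \<le> a"
  shows "tp_function (\<lambda>u. f u / (1 - of_real a * (u - 1)))"
proof -
  obtain c where c: "laurent_expansion f (\<lambda>n. of_real (c n))" "tp c" using f by (auto simp: tp_function_def)
  define \<rho> where "\<rho> = 1 + 1 / (2 * (1 + a))"
  have \<rho>: "1 < \<rho>" using a by (simp add: \<rho>_def)
  have ne: "1 - of_real a * (u - 1) \<noteq> 0" if "cmod u < \<rho>" for u
    using gfac_denominator[of a a u] a that by (auto simp: \<rho>_def)
  have "(\<lambda>u. 1 / (1 - of_real a * (u - 1))) holomorphic_on ball 0 \<rho>"
    by (intro holomorphic_intros) (use ne in auto)
  then obtain h where h: "laurent_expansion (\<lambda>u. 1 / (1 - of_real a * (u - 1))) h"
    using laurent_expansion_holomorphic[OF _ \<rho>] by blast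
  define e where "e = convolution (\<lambda>n. of_real (c n)) h"
  have e: "laurent_expansion (\<lambda>u. f u / (1 - of_real a * (u - 1))) e"
    using laurent_expansion_mult[OF c(1) h] by (simp add: e_def)
  have "laurent_expansion f (\<lambda>n. of_real (1 + a) * e n + (- of_real a) * e (n - 1))"
  proof (rule laurent_expansion_cong[OF laurent_expansion_linear[OF e], of "\<rho> - 1"])
    fix u assume "cmod u < 1 + (\<rho> - 1)"
    then have "1 - of_real a * (u - 1) \<noteq> 0" by (intro ne) simp
    moreover have "of_real (1 + a) + - of_real a * u = 1 - of_real a * (u - 1)" by (simp add: algebra_simps)
    ultimately show "f u / (1 - of_real a * (u - 1)) * (of_real (1 + a) + - of_real a * u) = f u"
      by (simp only: times_divide_eq_left nonzero_mult_div_cancel_right not_False_eq_True)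
  qed (use \<rho> in simp)
  then have ce: "of_real (c n) = of_real (1 + a) * e n + (- of_real a) * e (n - 1)" for n
    by (rule fun_cong[OF laurent_unique[OF c(1)]])
  define r where "r = a / (1 + a)"
  have r: "0 \<le> r" "r < 1" "1 - r = 1 / (1 + a)" using a by (auto simp: r_def field_simps)
  have rec: "e n = of_real (1 - r) * of_real (c n) + of_real r * e (n - 1)" for n
  proof -
    have ne: "of_real (1 + a) \<noteq> (0 :: complex)" using a by (simp only: of_real_eq_0_iff, simp?)
    have "of_real (1 - r) * of_real (c n) + of_real r * e (n - 1) =
        (of_real (c n) + of_real a * e (n - 1)) / of_real (1 + a)"
      unfolding r(3) unfolding r_def by (simp only: of_real_divide add_divide_distrib, simp?)
    also have "\<dots> = e n" unfolding ce using ne by simp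
    finally show ?thesis ..
  qed
  obtain B where B: "0 \<le> B" "\<And>n. n \<in> UNIV \<Longrightarrow> cmod (e n) \<le> B"
    using summable_on_bounded_terms[OF laurent_abs_summable[OF e]] by auto
  \<comment> \<open>The imaginary parts solve the homogeneous recursion and are bounded by B;
    iterating it backwards gives the bound \<open>r ^ K * B\<close> for every K.\<close>
  have Im: "Im (e n) = 0" for n
  proof -
    have step: "Im (e n) = r * Im (e (n - 1))" for n
      using arg_cong[OF rec[of n], of Im] by simp
    have iter: "Im (e n) = r ^ K * Im (e (n - int K))" for K
    proof (induction K)
      case (Suc K)
      have "n - int K - 1 = n - int (Suc K)" by simp
      then have "Im (e (n - int K)) = r * Im (e (n - int (Suc K)))"
        using step[of "n - int K"] by (simp only:)
      then show ?case using Suc by simp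
    qed simp
    have "\<bar>Im (e n)\<bar> \<le> r ^ K * B" for K
    proof -
      have "\<bar>Im (e n)\<bar> = r ^ K * \<bar>Im (e (n - int K))\<bar>"
        unfolding iter[of K] abs_mult using r(1) by simp
      also have "\<dots> \<le> r ^ K * B"
        using r(1) abs_Im_le_cmod[of "e (n - int K)"] B(2)[of "n - int K"] by (intro mult_left_mono) auto
      finally show ?thesis .
    qed
    moreover have "(\<lambda>K. r ^ K * B) \<longlonglongrightarrow> 0 * B"
      using r by (intro tendsto_mult tendsto_const LIMSEQ_power_zero) auto
    ultimately have "\<bar>Im (e n)\<bar> \<le> 0 * B" by (intro LIMSEQ_le_const) auto
    then show ?thesis by simp
  qed
  have e_real: "e = (\<lambda>n. of_real (Re (e n)))" by (simp add: fun_eq_iff complex_eq_iff Im)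
  have "tp (\<lambda>n. Re (e n))"
  proof (rule tp_alpha[OF c(2) r(1,2)])
    show "\<bar>Re (e n)\<bar> \<le> B" for n using abs_Re_le_cmod[of "e n"] B(2)[of n] by simp
    show "Re (e n) = (1 - r) * c n + r * Re (e (n - 1))" for n
      using arg_cong[OF rec[of n], of Re] by simp
  qed
  moreover have "laurent_expansion (\<lambda>u. f u / (1 - of_real a * (u - 1))) (\<lambda>n. of_real (Re (e n)))"
    using e e_real by simp
  moreover have "cmod (f u / (1 - of_real a * (u - 1))) \<le> 1" if "cmod u = 1" for u
  proof -
    have "cmod (f u * gfac a 0 u) \<le> 1"
      unfolding norm_mult using f norm_gfac_circle[of a 0 u] a that
      by (intro mult_le_one) (auto simp: tp_function_def)
    then show ?thesis by (simp add: gfac_def)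
  qed
  ultimately show ?thesis
    unfolding tp_function_def by (intro conjI exI[of _ "\<lambda>n. Re (e n)"]) auto
qed

lemma tp_function_gfac:
  assumes "tp_function f" "0 \<le> a" "0 \<le> b" "b \<le> 1"
  shows "tp_function (\<lambda>u. f u * gfac a b u)"
  using tp_function_alpha[OF tp_function_beta[OF assms(1,3,4)] assms(2)] by (simp add: gfac_def)

text \<open>The exponential is the limit of the powers (1 + (g / m) (u - 1))^m, whose factors are
  covered by \<open>tp_function_beta\<close> as soon as g \<le> m.\<close>

lemma tp_function_exp:
  assumes f: "tp_function f" and g: "0 \<le> g"
  shows "tp_function (\<lambda>u. f u * exp (of_real g * (u - 1)))"
proof -
  \<comment> \<open>The offset makes \<open>b k\<close> at most 1 for every k, including k =
    0.\<close>
  define K where "K = nat \<lceil>g\<rceil> + 1"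
  define b where "b k = g / real (k + K)" for k
  have "g \<le> real K" unfolding K_def by linarith
  then have b: "0 \<le> b k" "b k \<le> 1" for k
    using g by (auto simp: b_def K_def divide_le_eq_1)
  obtain c where c: "laurent_expansion f (\<lambda>n. of_real (c n))" using f by (auto simp: tp_function_def)
  have "(\<lambda>u. exp (of_real g * (u - 1))) holomorphic_on ball 0 2" by (intro holomorphic_intros)
  then obtain h where "laurent_expansion (\<lambda>u. exp (of_real g * (u - 1))) h"
    using laurent_expansion_holomorphic[of _ 2] by auto
  note L = laurent_expansion_mult[OF c this]
  show ?thesis
  proof (rule tp_function_limit[OF _ L])
    have "tp_function (\<lambda>u. f u * (1 + of_real (b k) * (u - 1)) ^ m)" for k m
    proof (induction m)
      case (Suc m)
      from tp_function_beta[OF Suc b[of k]] show ?case by (simp add: mult_ac)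
    qed (use f in simp)
    then show "tp_function (\<lambda>u. f u * (1 + of_real (b k) * (u - 1)) ^ (k + K))" for k .
    fix u :: complex assume u: "cmod u = 1"
    have b0: "b \<longlonglongrightarrow> 0"
      unfolding b_def
      by (rule LIMSEQ_ignore_initial_segment[of "\<lambda>n. g / real n"]) (rule lim_const_over_n)
    have "(\<lambda>k. (1 + of_real (b k) * (u - 1)) ^ (k + K) - exp (of_real g * (u - 1))) \<longlonglongrightarrow> 0"
    proof (rule Lim_null_comparison)
      show "\<forall>\<^sub>F k in sequentially. norm ((1 + of_real (b k) * (u - 1)) ^ (k + K) - exp (of_real g * (u - 1))) \<le>
          (4 * exp 2 * g) * b k"
      proof (intro always_eventually allI)
        fix k
        define y where "y = of_real (b k) * (u - 1)"
        have bg: "real (k + K) * b k = g" by (simp add: b_def K_def)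
        have "of_nat (k + K) * y = of_real g * (u - 1)"
          unfolding y_def bg[symmetric] by simp
        then have e: "exp (of_real g * (u - 1)) = exp y ^ (k + K)"
          by (metis exp_of_nat_mult)
        have "cmod (u - 1) \<le> 2" using norm_triangle_ineq4[of u 1] u by simp
        then have y: "cmod y \<le> 2 * b k"
          unfolding y_def norm_mult using b[of k] by (simp add: mult.commute mult_left_mono)
        have "cmod (1 + y) \<le> 1"
          using norm_gfac_circle[of 0 "b k" u] b[of k] u by (simp add: gfac_def y_def)
        moreover have "cmod (exp y) \<le> 1" unfolding y_def by (rule norm_exp_circle[OF b(1) u])
        \<comment> \<open>Both bases lie in the closed unit disc, so their m-th powers differ by at
          most m times the difference of the bases. That difference is of order b^2 and m b = g, so
          a factor b tending to 0 is left.\<close>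
        ultimately have "cmod ((1 + y) ^ (k + K) - exp y ^ (k + K)) \<le> of_nat (k + K) * cmod (1 + y - exp y)"
          by (rule norm_power_diff)
        also have "cmod (1 + y - exp y) \<le> exp \<bar>Re y\<bar> * (cmod y)\<^sup>2"
          using Taylor_exp[of y 1] by (simp add: atMost_Suc power2_eq_square add.commute norm_minus_commute)
        also have "\<dots> \<le> exp 2 * (2 * b k)\<^sup>2"
          using abs_Re_le_cmod[of y] y b[of k] by (intro mult_mono power_mono) auto
        finally have "cmod ((1 + y) ^ (k + K) - exp y ^ (k + K)) \<le> of_nat (k + K) * (exp 2 * (2 * b k)\<^sup>2)"
          by (simp add: mult_left_mono)
        also have "\<dots> = (4 * exp 2 * (real (k + K) * b k)) * b k" by (simp add: power2_eq_square)
        finally show "norm ((1 + of_real (b k) * (u - 1)) ^ (k + K) - exp (of_real g * (u - 1))) \<le>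
            (4 * exp 2 * g) * b k"
          unfolding e bg unfolding y_def .
      qed
      show "(\<lambda>k. (4 * exp 2 * g) * b k) \<longlonglongrightarrow> 0" by (rule tendsto_mult_right_zero[OF b0])
    qed
    then have "(\<lambda>k. (1 + of_real (b k) * (u - 1)) ^ (k + K)) \<longlonglongrightarrow> exp (of_real g * (u - 1))"
      by (rule LIM_zero_cancel)
    then show "(\<lambda>k. f u * (1 + of_real (b k) * (u - 1)) ^ (k + K)) \<longlonglongrightarrow> f u * exp (of_real g * (u - 1))"
      by (intro tendsto_mult tendsto_const)
  qed
qed

text \<open>The factor f is arbitrary so that the second half of \<Phi> can be multiplied onto the
  first one, with one elementary factor at a time.\<close>

lemma tp_function_hfun:
  assumes f: "tp_function f" and h: "admissible a b d"
  shows "tp_function (\<lambda>u. f u * hfun a b d u)"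
proof -
  let ?g = "d - (\<Sum>i. a i + b i)"
  obtain c where c: "laurent_expansion f (\<lambda>n. of_real (c n))" using f by (auto simp: tp_function_def)
  have "1 < 1 + 1 / (2 * (1 + a 0))" using h by (simp add: admissible_def add_pos_nonneg)
  then obtain e where e: "laurent_expansion (hfun a b d) e"
    using laurent_expansion_holomorphic[OF hfun_holomorphic[OF h]] by blast
  note L = laurent_expansion_mult[OF c e]
  show ?thesis
  proof (rule tp_function_limit[OF _ L])
    show "tp_function (\<lambda>u. f u * (exp (of_real ?g * (u - 1)) * (\<Prod>i<n. gfac (a i) (b i) u)))" for n
    proof (induction n)
      case 0
      then show ?case using tp_function_exp[OF f, of ?g] h by (simp add: admissible_def)
    next
      case (Suc n)
      have "tp_function (\<lambda>u. f u * (exp (of_real ?g * (u - 1)) * (\<Prod>i<n. gfac (a i) (b i) u)) * gfac (a n) (b n) u)"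
        by (rule tp_function_gfac[OF Suc]) (use h admissible_le_one[OF h] in \<open>auto simp: admissible_def\<close>)
      then show ?case by (simp add: mult_ac)
    qed
    show "(\<lambda>n. f u * (exp (of_real ?g * (u - 1)) * (\<Prod>i<n. gfac (a i) (b i) u))) \<longlonglongrightarrow> f u * hfun a b d u"
      if "cmod u = 1" for u
      by (intro tendsto_mult tendsto_const hfun_partial_products[OF h that])
  qed
qed

text \<open>The plus half is reflected to a function of 1 / u, multiplied by the minus half as a
  function of u, and the product is reflected back; so both halves enter through the same
  multiplication lemma.\<close>

lemma phi_hat_tp:
  assumes "\<omega> \<in> Omega"
  obtains c where "phi_hat \<omega> = (\<lambda>n. of_real (c n))" "tp c"
proof -
  obtain ap bp am bm dp dm where \<omega>: "\<omega> = (ap, bp, am, bm, dp, dm)" by (metis prod_cases6)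
  note h = Omega_admissible[OF assms[unfolded \<omega>]]
  have "tp_function (\<lambda>u. 1 * hfun ap bp dp u)" by (rule tp_function_hfun[OF tp_function_one h(1)])
  then have "tp_function (\<lambda>u. hfun ap bp dp (inverse u))" using tp_function_reflect by fastforce
  from tp_function_reflect[OF tp_function_hfun[OF this h(2)]]
  have 1: "tp_function (\<lambda>u. hfun ap bp dp u * hfun am bm dm (inverse u))" by simp
  have "tp_function (\<lambda>u. Phi u \<omega>)"
  proof (rule tp_function_limit[OF 1 Phi_laurent[OF assms]])
    fix u :: complex assume "cmod u = 1"
    then show "(\<lambda>k. hfun ap bp dp u * hfun am bm dm (inverse u)) \<longlonglongrightarrow> Phi u \<omega>"
      using Phi_hfun_circle[OF assms[unfolded \<omega>]] by (simp add: \<omega>)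
  qed
  then obtain c where c: "laurent_expansion (\<lambda>u. Phi u \<omega>) (\<lambda>n. of_real (c n))" "tp c"
    by (auto simp: tp_function_def)
  show ?thesis by (rule that[OF phi_hat_eqI[OF c(1)] c(2)])
qed

lemma sigma_hat_nonneg:
  assumes "\<omega> \<in> Omega" "l \<in> signatures"
  obtains s where "sigma_hat l \<omega> = of_real s" "0 \<le> s"
proof -
  obtain c where c: "phi_hat \<omega> = (\<lambda>n. of_real (c n))" "tp c" using phi_hat_tp[OF assms(1)] .
  have "sigma_hat l \<omega> = of_real (detm (length l) (\<lambda>i j. c (l ! i - int i + int j)))"
    unfolding sigma_hat_def c(1) jacobi_trudi_detm detm_leibniz by simp
  moreover have "0 \<le> detm (length l) (\<lambda>i j. c ((l ! i - int i) + int j))"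
  proof (rule tpD[OF c(2)])
    fix i j assume ij: "i < j" "j < length l"
    then have "l ! j \<le> l ! i" using assms(2) by (auto simp: signatures_iff signatures_of_iff)
    then show "l ! j - int j < l ! i - int i" using ij by simp
  qed
  ultimately show ?thesis by (rule that)
qed

section \<open>The homomorphism into the functions on \<open>\<Omega>\<close>\<close>

lemma bnorm_component: "component_norm N \<psi> \<le> bnorm \<psi>"
  unfolding bnorm_def using sum_le_suminf[of "\<lambda>N. component_norm N \<psi>" "{N}"] by simp

lemma component_norm_upper:
  assumes "l \<in> signatures_of N" "component_norm N \<psi> < \<infinity>"
  shows "cmod (sigma_coeff \<psi> l) \<le> enn2real (component_norm N \<psi>) * Dim l"
proof -
  have D: "Dim l > 0" using assms(1) by (intro Dim_pos) (auto simp: signatures_def)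
  have "ennreal (cmod (sigma_coeff \<psi> l) / Dim l) \<le> component_norm N \<psi>"
    unfolding component_norm_def by (rule SUP_upper[OF assms(1)])
  then have "enn2real (ennreal (cmod (sigma_coeff \<psi> l) / Dim l)) \<le> enn2real (component_norm N \<psi>)"
    using assms(2) by (intro enn2real_mono) auto
  then have "cmod (sigma_coeff \<psi> l) / Dim l \<le> enn2real (component_norm N \<psi>)"
    using D by simp
  then show ?thesis using D by (simp add: field_simps)
qed

lemma component_norm_le:
  assumes "\<And>l. l \<in> signatures_of N \<Longrightarrow> cmod (sigma_coeff \<psi> l) \<le> C * Dim l"
  shows "component_norm N \<psi> \<le> ennreal C"
  unfolding component_norm_def
proof (rule SUP_least)
  fix l assume l: "l \<in> signatures_of N"
  have "Dim l > 0" using l by (intro Dim_pos) (auto simp: signatures_def)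
  then have "cmod (sigma_coeff \<psi> l) / Dim l \<le> C" using assms[OF l] by (simp add: field_simps)
  then show "ennreal (cmod (sigma_coeff \<psi> l) / Dim l) \<le> ennreal C" by (rule ennreal_leI)
qed

lemma bnorm_finite_sum:
  assumes "\<And>l. d < length l \<Longrightarrow> sigma_coeff \<psi> l = 0"
  shows "bnorm \<psi> = (\<Sum>N\<le>d. component_norm N \<psi>)"
  unfolding bnorm_def
proof (rule suminf_finite)
  fix N assume "N \<notin> {..d}"
  then have "component_norm N \<psi> \<le> ennreal 0"
    by (intro component_norm_le) (auto simp: assms dest: signatures_of_length)
  then show "component_norm N \<psi> = 0" by simp
qed simp

text \<open>The degree is bounded, so the sum over degrees has finitely many nonzero terms and a
  single constant controls all of them.\<close>

lemma finite_norm_iff: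
  "\<psi> \<in> finite_norm \<longleftrightarrow> (\<exists>C. \<forall>l\<in>signatures. cmod (sigma_coeff \<psi> l) \<le> C * Dim l)"
proof
  assume \<psi>: "\<psi> \<in> finite_norm"
  show "\<exists>C. \<forall>l\<in>signatures. cmod (sigma_coeff \<psi> l) \<le> C * Dim l"
  proof (intro exI[of _ "enn2real (bnorm \<psi>)"] ballI)
    fix l assume l: "l \<in> signatures"
    have fin: "bnorm \<psi> < \<infinity>" using \<psi> by (simp add: finite_norm_def)
    have "component_norm (length l) \<psi> < \<infinity>" using bnorm_component fin by (rule le_less_trans)
    then have "cmod (sigma_coeff \<psi> l) \<le> enn2real (component_norm (length l) \<psi>) * Dim l"
      using l by (intro component_norm_upper) (simp add: signatures_iff)
    also have "\<dots> \<le> enn2real (bnorm \<psi>) * Dim l"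
      using Dim_pos[OF l] fin by (intro mult_right_mono enn2real_mono bnorm_component) auto
    finally show "cmod (sigma_coeff \<psi> l) \<le> enn2real (bnorm \<psi>) * Dim l" .
  qed
next
  assume "\<exists>C. \<forall>l\<in>signatures. cmod (sigma_coeff \<psi> l) \<le> C * Dim l"
  then obtain C where C: "\<And>l. l \<in> signatures \<Longrightarrow> cmod (sigma_coeff \<psi> l) \<le> C * Dim l" by blast
  obtain d where d: "\<And>l. d < length l \<Longrightarrow> sigma_coeff \<psi> l = 0"
    using sigma_coeff_bounded_degree[of \<psi>] by blast
  have "bnorm \<psi> = (\<Sum>N\<le>d. component_norm N \<psi>)" by (rule bnorm_finite_sum) (rule d)
  also have "\<dots> \<le> (\<Sum>N\<le>d. ennreal C)"
    by (intro sum_mono component_norm_le C) (auto simp: signatures_def)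
  also have "\<dots> < \<infinity>" by (induction d) (auto simp: less_top simp del: sum_constant)
  finally show "\<psi> \<in> finite_norm" by (simp add: finite_norm_def)
qed

lemma finite_normE:
  assumes "\<psi> \<in> finite_norm"
  obtains C where "0 \<le> C" "\<And>l. l \<in> signatures \<Longrightarrow> cmod (sigma_coeff \<psi> l) \<le> C * Dim l"
proof -
  obtain C where C: "\<And>l. l \<in> signatures \<Longrightarrow> cmod (sigma_coeff \<psi> l) \<le> C * Dim l"
    using assms by (auto simp: finite_norm_iff)
  have "0 \<le> C" using order.trans[OF norm_ge_zero C[of "[]"]] by simp
  then show ?thesis using C by (rule that)
qed

lemma finite_norm_slow:
  assumes "\<psi> \<in> finite_norm"
  shows "slow \<psi>"
proof -
  obtain C where C: "0 \<le> C" "\<And>l. l \<in> signatures \<Longrightarrow> cmod (sigma_coeff \<psi> l) \<le> C * Dim l"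
    using finite_normE[OF assms] by blast
  obtain d where d: "\<And>l. d < length l \<Longrightarrow> sigma_coeff \<psi> l = 0"
    using sigma_coeff_bounded_degree[of \<psi>] by blast
  have "slow_family (sigma_coeff \<psi>)"
  proof (rule slow_familyI[OF d])
    fix N and r :: real assume r: "0 < r" "r < 1"
    obtain B where B: "0 \<le> B" "\<And>v. v \<in> signatures_of N \<Longrightarrow> Dim v \<le> B * (1 / r) ^ absum (mset v)"
      using Dim_subexponential[OF r] by blast
    have "cmod (sigma_coeff \<psi> v) \<le> (C * B) * (1 / r) ^ absum (mset v)" if v: "v \<in> signatures_of N" for v
    proof -
      have "cmod (sigma_coeff \<psi> v) \<le> C * Dim v" using v by (intro C) (auto simp: signatures_def)
      also have "\<dots> \<le> C * (B * (1 / r) ^ absum (mset v))" by (intro mult_left_mono B v C)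
      finally show ?thesis by simp
    qed
    then show "\<exists>C. \<forall>v\<in>signatures_of N. cmod (sigma_coeff \<psi> v) \<le> C * (1 / r) ^ absum (mset v)" by blast
  qed
  then show ?thesis using expands_sigma_coeff by (rule slowI)
qed

lemma hat_ev:
  assumes "slow \<psi>" "\<omega> \<in> Omega"
  shows "(\<lambda>l. sigma_coeff \<psi> l * sigma_hat l \<omega>) abs_summable_on signatures"
    and "hat \<psi> \<omega> = ev (phi_hat \<omega>) \<psi>"
  using ev_expansion(2,3)[OF slow_family_sigma_coeff[OF assms(1)] expands_sigma_coeff
      laurent_decaying[OF Phi_laurent[OF assms(2)]]]
  by (simp_all add: hat_def sigma_hat_def)

text \<open>Stated for slow series, a class closed under products to which all elements of finite
  norm belong.\<close>

lemma hat_mult: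
  assumes "slow \<psi>" "slow \<theta>" "\<omega> \<in> Omega"
  shows "hat (\<psi> * \<theta>) \<omega> = hat \<psi> \<omega> * hat \<theta> \<omega>"
  using ev_mult[OF assms(1,2) laurent_decaying[OF Phi_laurent[OF assms(3)]]]
  by (simp add: hat_ev(2) assms slow_mult)

lemma hat_add:
  assumes "slow \<psi>" "slow \<theta>" "\<omega> \<in> Omega"
  shows "hat (\<psi> + \<theta>) \<omega> = hat \<psi> \<omega> + hat \<theta> \<omega>"
  unfolding hat_def
  by (simp add: distrib_right infsum_add abs_summable_summable[OF hat_ev(1)[OF assms(1,3)]]
      abs_summable_summable[OF hat_ev(1)[OF assms(2,3)]])

lemma hat_bscale: "hat (bscale z \<psi>) \<omega> = z * hat \<psi> \<omega>"
  unfolding hat_def by (simp add: mult.assoc infsum_cmult_right')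

lemma phi_power_finite_norm: "phi ^ N \<in> finite_norm"
  unfolding finite_norm_iff
proof (intro exI[of _ 1] ballI)
  fix l assume "l \<in> signatures"
  then show "cmod (sigma_coeff (phi ^ N) l) \<le> 1 * Dim l"
    using Dim_pos[of l] by (simp add: sigma_coeff_phi_power)
qed

lemma Phi_one: "Phi 1 \<omega> = 1"
proof -
  obtain ap bp am bm dp dm where \<omega>: "\<omega> = (ap, bp, am, bm, dp, dm)" by (metis prod_cases6)
  show ?thesis by (simp add: \<omega> Phi_def)
qed

lemma hat_phi:
  assumes "\<omega> \<in> Omega"
  shows "hat phi \<omega> = 1"
proof -
  have "(phi_hat \<omega> has_sum 1) UNIV"
    using laurent_expansion_circle[OF Phi_laurent[OF assms], of 1] by (simp add: Phi_one)
  then have "infsum (phi_hat \<omega>) UNIV = 1" by (rule infsumI)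
  moreover have "slow phi" using finite_norm_slow[OF phi_power_finite_norm[of 1]] by simp
  ultimately show ?thesis by (simp add: hat_ev(2) assms ev_phi)
qed

lemma hat_one:
  assumes "\<omega> \<in> Omega"
  shows "hat 1 \<omega> = 1"
  using hat_ev(2)[OF finite_norm_slow[OF phi_power_finite_norm[of 0]] assms] by simp

lemma hat_phi_power:
  assumes "\<omega> \<in> Omega"
  shows "hat (phi ^ N) \<omega> = 1"
proof (induction N)
  case (Suc N)
  have "slow phi" using finite_norm_slow[OF phi_power_finite_norm[of 1]] by simp
  then show ?case
    using hat_mult[OF _ finite_norm_slow[OF phi_power_finite_norm[of N]] assms, of phi] Suc hat_phi[OF assms]
    by simp
qed (simp add: hat_one assms)

text \<open>For fixed \<open>\<omega>\<close> the numbers \<open>Dim \<lambda> \<sigma>\<^sub>\<lambda>(\<omega>)\<close> form a probability distribution on the signatures of length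
  \<open>N\<close>, since \<open>\<phi>\<^sup>N = \<Sum> Dim \<lambda> \<sigma>\<^sub>\<lambda>\<close> and \<open>\<phi>\<close> evaluates to \<open>\<Phi>(1; \<omega>) = 1\<close>.\<close>

definition coherent :: "point \<Rightarrow> int list \<Rightarrow> real" where
  "coherent \<omega> l = Dim l * Re (sigma_hat l \<omega>)"

lemma coherent_nonneg:
  assumes "\<omega> \<in> Omega" "l \<in> signatures"
  shows "0 \<le> coherent \<omega> l" "of_real (Dim l) * sigma_hat l \<omega> = of_real (coherent \<omega> l)"
proof -
  obtain s where s: "sigma_hat l \<omega> = of_real s" "0 \<le> s" using sigma_hat_nonneg[OF assms] .
  then show "0 \<le> coherent \<omega> l" using Dim_pos[OF assms(2)] by (simp add: coherent_def)
  show "of_real (Dim l) * sigma_hat l \<omega> = of_real (coherent \<omega> l)" by (simp add: coherent_def s)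
qed

lemma coherent_has_sum:
  assumes "\<omega> \<in> Omega"
  shows "(coherent \<omega> has_sum 1) (signatures_of N)"
proof -
  have "((\<lambda>l. sigma_coeff (phi ^ N) l * sigma_hat l \<omega>) has_sum hat (phi ^ N) \<omega>) signatures"
    unfolding hat_def
    by (rule has_sum_infsum[OF abs_summable_summable[OF hat_ev(1)[OF finite_norm_slow[OF phi_power_finite_norm] assms]]])
  then have "((\<lambda>l. sigma_coeff (phi ^ N) l * sigma_hat l \<omega>) has_sum 1) signatures"
    by (simp add: hat_phi_power[OF assms])
  also have "?this \<longleftrightarrow> ((\<lambda>l. complex_of_real (coherent \<omega> l)) has_sum 1) (signatures_of N)"
  proof (rule has_sum_cong_neutral)
    fix l assume "l \<in> signatures_of N - signatures"
    then show "complex_of_real (coherent \<omega> l) = 0" by (auto simp only: signatures_def)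
  next
    fix l assume "l \<in> signatures - signatures_of N"
    then show "sigma_coeff (phi ^ N) l * sigma_hat l \<omega> = 0" by (simp add: sigma_coeff_phi_power)
  next
    fix l assume "l \<in> signatures \<inter> signatures_of N"
    then show "sigma_coeff (phi ^ N) l * sigma_hat l \<omega> = of_real (coherent \<omega> l)"
      using coherent_nonneg(2)[OF assms, of l] by (simp add: sigma_coeff_phi_power)
  qed
  finally have "((\<lambda>l. complex_of_real (coherent \<omega> l)) has_sum of_real 1) (signatures_of N)" by simp
  then show ?thesis by (simp only: has_sum_of_real_iff)
qed

text \<open>In each degree the value is the mean of the ratios of coefficient and \<open>Dim\<close>
  under the probability distribution, hence at most the norm of that component.\<close>

lemma hat_bound:
  assumes \<psi>: "\<psi> \<in> finite_norm" and \<omega>: "\<omega> \<in> Omega"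
  shows "ennreal (cmod (hat \<psi> \<omega>)) \<le> bnorm \<psi>"
proof -
  obtain d where d: "\<And>l. d < length l \<Longrightarrow> sigma_coeff \<psi> l = 0"
    using sigma_coeff_bounded_degree[of \<psi>] by blast
  let ?f = "\<lambda>l. sigma_coeff \<psi> l * sigma_hat l \<omega>"
  let ?C = "\<lambda>N. enn2real (component_norm N \<psi>)"
  have fin: "component_norm N \<psi> < \<infinity>" for N
    using bnorm_component[of N \<psi>] \<psi> by (auto simp: finite_norm_def intro: le_less_trans)
  have sum: "?f abs_summable_on signatures" by (rule hat_ev(1)[OF finite_norm_slow[OF \<psi>] \<omega>])
  have sub: "signatures_of N \<subseteq> signatures" for N by (auto simp: signatures_def)
  have sumN: "?f abs_summable_on signatures_of N" for N by (rule summable_on_subset[OF sum sub])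
  have "hat \<psi> \<omega> = infsum ?f (\<Union>N\<in>{..d}. signatures_of N)"
    unfolding hat_def
  proof (rule infsum_cong_neutral)
    fix l assume "l \<in> signatures - (\<Union>N\<in>{..d}. signatures_of N)"
    then have "d < length l" by (auto simp: signatures_iff not_less[symmetric])
    then show "?f l = 0" by (simp add: d)
  next
    fix l assume "l \<in> (\<Union>N\<in>{..d}. signatures_of N) - signatures"
    then show "?f l = 0" by (auto simp only: signatures_def)
  qed simp
  also have "\<dots> = (\<Sum>N\<in>{..d}. infsum ?f (signatures_of N))"
    by (rule sum_infsum[symmetric])
      (auto simp: abs_summable_summable[OF sumN] signatures_of_iff)
  finally have "cmod (hat \<psi> \<omega>) \<le> (\<Sum>N\<in>{..d}. cmod (infsum ?f (signatures_of N)))"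
    by (simp only: norm_sum)
  also have "\<dots> \<le> (\<Sum>N\<in>{..d}. ?C N)"
  proof (rule sum_mono)
    fix N
    have le: "norm (?f l) \<le> ?C N * coherent \<omega> l" if l: "l \<in> signatures_of N" for l
    proof -
      have ls: "l \<in> signatures" using l sub by blast
      have D: "0 < Dim l" by (rule Dim_pos[OF ls])
      have "cmod (sigma_hat l \<omega>) * Dim l = coherent \<omega> l"
        using arg_cong[OF coherent_nonneg(2)[OF \<omega> ls], of cmod] coherent_nonneg(1)[OF \<omega> ls] D
        by (simp add: norm_mult mult.commute)
      then have "(?C N * Dim l) * cmod (sigma_hat l \<omega>) = ?C N * coherent \<omega> l"
        by (simp only: mult.assoc mult.commute[of "cmod (sigma_hat l \<omega>)"])
      moreover have "norm (?f l) \<le> (?C N * Dim l) * cmod (sigma_hat l \<omega>)"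
        unfolding norm_mult by (intro mult_right_mono component_norm_upper[OF l fin]) simp
      ultimately show ?thesis by linarith
    qed
    have hs: "((\<lambda>l. ?C N * coherent \<omega> l) has_sum ?C N * 1) (signatures_of N)"
      by (rule has_sum_cmult_right[OF coherent_has_sum[OF \<omega>]])
    have "cmod (infsum ?f (signatures_of N)) \<le> (\<Sum>\<^sub>\<infinity>l\<in>signatures_of N. norm (?f l))"
      by (rule norm_infsum_bound[OF sumN])
    also have "\<dots> \<le> (\<Sum>\<^sub>\<infinity>l\<in>signatures_of N. ?C N * coherent \<omega> l)"
      by (rule infsum_mono[OF sumN has_sum_imp_summable[OF hs] le])
    also have "\<dots> = ?C N" using infsumI[OF hs] by simp
    finally show "cmod (infsum ?f (signatures_of N)) \<le> ?C N" .
  qed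
  finally have "ennreal (cmod (hat \<psi> \<omega>)) \<le> ennreal (\<Sum>N\<le>d. ?C N)" by (rule ennreal_leI)
  also have "\<dots> = (\<Sum>N\<le>d. ennreal (?C N))" by (simp add: sum_ennreal)
  also have "\<dots> = (\<Sum>N\<le>d. component_norm N \<psi>)"
    using fin by (intro sum.cong refl ennreal_enn2real) auto
  also have "\<dots> = bnorm \<psi>" by (rule bnorm_finite_sum[OF d, symmetric])
  finally show ?thesis .
qed

text \<open>No mass escapes: a finite set carrying almost the whole limit mass eventually carries
  almost the whole mass of \<open>p k\<close>, because the totals agree. So the sums outside it are
  small, uniformly for all large k.\<close>

lemma scheffe:
  fixes p :: "nat \<Rightarrow> 'a \<Rightarrow> real" and b :: "'a \<Rightarrow> complex"
  assumes p: "\<And>k. (p k has_sum T) S" "\<And>k l. l \<in> S \<Longrightarrow> 0 \<le> p k l"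
    and q: "(q has_sum T) S" "\<And>l. l \<in> S \<Longrightarrow> 0 \<le> q l"
    and lim: "\<And>l. l \<in> S \<Longrightarrow> (\<lambda>k. p k l) \<longlonglongrightarrow> q l"
    and b: "\<And>l. l \<in> S \<Longrightarrow> cmod (b l) \<le> C" and C: "0 \<le> C"
  shows "(\<lambda>k. \<Sum>\<^sub>\<infinity>l\<in>S. b l * of_real (p k l)) \<longlonglongrightarrow> (\<Sum>\<^sub>\<infinity>l\<in>S. b l * of_real (q l))"
proof (rule tendstoI)
  fix e :: real assume e: "0 < e"
  have tail: "dist (\<Sum>\<^sub>\<infinity>l\<in>S. b l * of_real (r l)) (\<Sum>l\<in>F. b l * of_real (r l)) \<le> C * (T - sum r F)"
    if r: "(r has_sum T) S" "\<And>l. l \<in> S \<Longrightarrow> 0 \<le> r l" and F: "finite F" "F \<subseteq> S" for r F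
  proof -
    let ?h = "\<lambda>l. b l * of_real (r l)"
    have nh: "norm (?h l) \<le> C * r l" if "l \<in> S" for l
      using b[OF that] r(2)[OF that] by (simp add: norm_mult mult_right_mono)
    have Cr: "((\<lambda>l. C * r l) has_sum C * T) S" by (rule has_sum_cmult_right[OF r(1)])
    have ab: "?h abs_summable_on S"
      by (rule summable_on_comparison_test[OF has_sum_imp_summable[OF Cr] nh]) auto
    have sub: "S - F \<subseteq> S" by blast
    have abF: "?h abs_summable_on (S - F)" by (rule summable_on_subset[OF ab sub])
    have S: "F \<union> (S - F) = S" using F(2) by blast
    have "infsum ?h (F \<union> (S - F)) = infsum ?h F + infsum ?h (S - F)"
      by (rule infsum_Un_disjoint) (use F(1) abs_summable_summable[OF abF] in auto)
    then have "infsum ?h S = sum ?h F + infsum ?h (S - F)" using F(1) unfolding S by simp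
    then have "infsum ?h S - sum ?h F = infsum ?h (S - F)" by simp
    then have "dist (infsum ?h S) (sum ?h F) = norm (infsum ?h (S - F))" by (simp add: dist_norm)
    also have "\<dots> \<le> (\<Sum>\<^sub>\<infinity>l\<in>S - F. norm (?h l))" by (rule norm_infsum_bound[OF abF])
    also have "\<dots> \<le> (\<Sum>\<^sub>\<infinity>l\<in>S - F. C * r l)"
      by (rule infsum_mono[OF abF summable_on_subset[OF has_sum_imp_summable[OF Cr] sub] nh]) blast
    also have "\<dots> = C * T - C * sum r F"
    proof -
      have "infsum (\<lambda>l. C * r l) (F \<union> (S - F)) = infsum (\<lambda>l. C * r l) F + infsum (\<lambda>l. C * r l) (S - F)"
        by (rule infsum_Un_disjoint)
          (use F(1) summable_on_subset[OF has_sum_imp_summable[OF Cr] sub] in auto)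
      then have "C * T = sum (\<lambda>l. C * r l) F + infsum (\<lambda>l. C * r l) (S - F)"
        using infsumI[OF Cr] F(1) unfolding S by simp
      then show ?thesis by (simp add: sum_distrib_left)
    qed
    finally show ?thesis by (simp add: right_diff_distrib)
  qed
  \<comment> \<open>The tails cost C \<epsilon> for \<open>q\<close> and 2 C \<epsilon> for
    \<open>p k\<close>, the finite part e / 4; the denominator C + 1 also covers C = 0.\<close>
  define \<epsilon> where "\<epsilon> = e / 4 / (C + 1)"
  have \<epsilon>: "0 < \<epsilon>" using e C by (simp add: \<epsilon>_def)
  have C\<epsilon>: "C * \<epsilon> * 3 < 3 / 4 * e"
  proof -
    have "C * \<epsilon> < (C + 1) * \<epsilon>" using \<epsilon> by (intro mult_strict_right_mono) auto
    also have "\<dots> = e / 4"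
    proof -
      have "x * (e / 4 / x) = e / 4" if "x \<noteq> 0" for x using that by simp
      then show ?thesis using C by (simp only: \<epsilon>_def)
    qed
    finally show ?thesis by simp
  qed
  have "eventually (\<lambda>F. dist (sum q F) T < \<epsilon>) (finite_subsets_at_top S)"
    using q(1) \<epsilon> unfolding has_sum_def by (rule tendstoD)
  then obtain F where F: "finite F" "F \<subseteq> S" "dist (sum q F) T < \<epsilon>"
    unfolding eventually_finite_subsets_at_top by blast
  have "(\<lambda>k. sum (p k) F) \<longlonglongrightarrow> sum q F" by (intro tendsto_sum lim) (use F in blast)
  then have ev1: "eventually (\<lambda>k. dist (sum (p k) F) (sum q F) < \<epsilon>) sequentially"
    using \<epsilon> by (rule tendstoD)
  have "(\<lambda>k. \<Sum>l\<in>F. b l * of_real (p k l)) \<longlonglongrightarrow> (\<Sum>l\<in>F. b l * of_real (q l))"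
    by (intro tendsto_sum tendsto_mult tendsto_const tendsto_of_real lim) (use F in blast)
  then have ev2: "eventually (\<lambda>k. dist (\<Sum>l\<in>F. b l * of_real (p k l)) (\<Sum>l\<in>F. b l * of_real (q l)) < e / 4) sequentially"
    using e by (intro tendstoD) auto
  from ev1 ev2 show "eventually (\<lambda>k. dist (\<Sum>\<^sub>\<infinity>l\<in>S. b l * of_real (p k l)) (\<Sum>\<^sub>\<infinity>l\<in>S. b l * of_real (q l)) < e) sequentially"
  proof eventually_elim
    case (elim k)
    have "C * (T - sum q F) \<le> C * \<epsilon>"
      using F(3) C by (intro mult_left_mono) (auto simp: dist_real_def)
    then have 1: "dist (\<Sum>\<^sub>\<infinity>l\<in>S. b l * of_real (q l)) (\<Sum>l\<in>F. b l * of_real (q l)) \<le> C * \<epsilon>"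
      using tail[OF q F(1,2)] by linarith
    have "C * (T - sum (p k) F) \<le> C * (2 * \<epsilon>)"
      using F(3) elim(1) C by (intro mult_left_mono) (auto simp: dist_real_def)
    then have 2: "dist (\<Sum>\<^sub>\<infinity>l\<in>S. b l * of_real (p k l)) (\<Sum>l\<in>F. b l * of_real (p k l)) \<le> C * (2 * \<epsilon>)"
      using tail[OF p F(1,2), of k] by linarith
    show ?case
      using 1 2 elim(2) C\<epsilon>
        dist_triangle[of "\<Sum>\<^sub>\<infinity>l\<in>S. b l * of_real (p k l)" "\<Sum>\<^sub>\<infinity>l\<in>S. b l * of_real (q l)" "\<Sum>l\<in>F. b l * of_real (p k l)"]
        dist_triangle2[of "\<Sum>l\<in>F. b l * of_real (p k l)" "\<Sum>\<^sub>\<infinity>l\<in>S. b l * of_real (q l)" "\<Sum>l\<in>F. b l * of_real (q l)"]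
      by (simp add: dist_commute)
  qed
qed

lemma sigma_hat_tendsto:
  assumes "\<And>k. x k \<in> Omega" "\<omega> \<in> Omega" "x \<longlonglongrightarrow> \<omega>"
  shows "(\<lambda>k. sigma_hat l (x k)) \<longlonglongrightarrow> sigma_hat l \<omega>"
  unfolding sigma_hat_def jacobi_trudi_detm
  by (intro tendsto_detm phi_hat_tendsto assms)

lemma hat_continuous:
  assumes \<psi>: "\<psi> \<in> finite_norm"
  shows "continuous_on Omega (hat \<psi>)"
  \<comment> \<open>Sequences suffice because the product topology of countably many real
    coordinates is metrizable.\<close>
  unfolding continuous_on_sequentially
proof (intro allI ballI impI)
  fix x \<omega> assume \<omega>: "\<omega> \<in> Omega" and "(\<forall>k. x k \<in> Omega) \<and> x \<longlonglongrightarrow> \<omega>"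
  then have x: "\<And>k. x k \<in> Omega" "x \<longlonglongrightarrow> \<omega>" by auto
  obtain C where C: "0 \<le> C" "\<And>l. l \<in> signatures \<Longrightarrow> cmod (sigma_coeff \<psi> l) \<le> C * Dim l"
    using finite_normE[OF \<psi>] by blast
  obtain d where d: "\<And>l. d < length l \<Longrightarrow> sigma_coeff \<psi> l = 0"
    using sigma_coeff_bounded_degree[of \<psi>] by blast
  define S where "S = (\<Union>N\<in>{..d}. signatures_of N)"
  have sub: "l \<in> signatures" if "l \<in> S" for l using that by (auto simp: S_def signatures_def)
  define b where "b l = sigma_coeff \<psi> l / of_real (Dim l)" for l
  have hat: "hat \<psi> \<xi> = (\<Sum>\<^sub>\<infinity>l\<in>S. b l * of_real (coherent \<xi> l))" if "\<xi> \<in> Omega" for \<xi>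
    unfolding hat_def
  proof (rule infsum_cong_neutral)
    fix l assume "l \<in> signatures - S"
    then have "d < length l" by (auto simp: S_def signatures_iff not_less[symmetric])
    then show "sigma_coeff \<psi> l * sigma_hat l \<xi> = 0" by (simp add: d)
  next
    fix l assume "l \<in> S - signatures"
    then show "b l * of_real (coherent \<xi> l) = 0" using sub by blast
  next
    fix l assume "l \<in> signatures \<inter> S"
    then have "l \<in> signatures" by blast
    then show "sigma_coeff \<psi> l * sigma_hat l \<xi> = b l * of_real (coherent \<xi> l)"
      using coherent_nonneg(2)[OF that, of l] Dim_pos[of l] by (simp add: b_def flip: coherent_nonneg(2)[OF that])
  qed
  \<comment> \<open>Each degree up to d contributes mass one, so all degrees together form a single
    measure of constant total mass.\<close>
  have total: "(coherent \<xi> has_sum (\<Sum>N\<in>{..d}. 1)) S" if "\<xi> \<in> Omega" for \<xi>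
    unfolding S_def
    by (rule sum_has_sum) (auto simp: signatures_of_iff intro: coherent_has_sum[OF that])
  have "(\<lambda>k. \<Sum>\<^sub>\<infinity>l\<in>S. b l * of_real (coherent (x k) l)) \<longlonglongrightarrow> (\<Sum>\<^sub>\<infinity>l\<in>S. b l * of_real (coherent \<omega> l))"
  proof (rule scheffe[OF total[OF x(1)] _ total[OF \<omega>]])
    show "0 \<le> coherent (x k) l" "0 \<le> coherent \<omega> l" if "l \<in> S" for k l
      by (rule coherent_nonneg(1)[OF _ sub[OF that]], rule x \<omega>)+
    show "(\<lambda>k. coherent (x k) l) \<longlonglongrightarrow> coherent \<omega> l" for l
      unfolding coherent_def by (intro tendsto_mult tendsto_const tendsto_Re sigma_hat_tendsto x \<omega>)
    show "cmod (b l) \<le> C" if "l \<in> S" for l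
      using C(2)[OF sub[OF that]] Dim_pos[OF sub[OF that]] by (simp add: b_def norm_divide field_simps)
  qed (rule C(1))
  then show "(hat \<psi> \<circ> x) \<longlonglongrightarrow> hat \<psi> \<omega>" by (simp add: o_def hat x \<omega>)
qed

section \<open>The kernel\<close>

lemma finite_norm_add:
  assumes "\<psi> \<in> finite_norm" "\<theta> \<in> finite_norm"
  shows "\<psi> + \<theta> \<in> finite_norm"
proof -
  obtain C where C: "\<And>l. l \<in> signatures \<Longrightarrow> cmod (sigma_coeff \<psi> l) \<le> C * Dim l"
    using assms(1) by (auto simp: finite_norm_iff)
  obtain D where D: "\<And>l. l \<in> signatures \<Longrightarrow> cmod (sigma_coeff \<theta> l) \<le> D * Dim l"
    using assms(2) by (auto simp: finite_norm_iff)
  have "cmod (sigma_coeff (\<psi> + \<theta>) l) \<le> (C + D) * Dim l" if "l \<in> signatures" for l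
    unfolding sigma_coeff_add distrib_right
    using norm_triangle_ineq[of "sigma_coeff \<psi> l" "sigma_coeff \<theta> l"] C[OF that] D[OF that] by linarith
  then show ?thesis by (auto simp: finite_norm_iff)
qed

lemma finite_norm_uminus: "\<psi> \<in> finite_norm \<Longrightarrow> - \<psi> \<in> finite_norm"
  by (simp add: finite_norm_iff)

lemma finite_norm_diff: "\<psi> \<in> finite_norm \<Longrightarrow> \<theta> \<in> finite_norm \<Longrightarrow> \<psi> - \<theta> \<in> finite_norm"
  unfolding diff_conv_add_uminus by (intro finite_norm_add finite_norm_uminus)

lemma finite_norm_zero: "0 \<in> finite_norm"
  by (auto simp: finite_norm_iff intro!: exI[of _ 0])

lemma finite_norm_sum: "(\<And>i. i \<in> I \<Longrightarrow> f i \<in> finite_norm) \<Longrightarrow> sum f I \<in> finite_norm"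
  by (induction I rule: infinite_finite_induct) (auto intro: finite_norm_zero finite_norm_add)

lemma finite_norm_phi_mult:
  assumes "\<psi> \<in> finite_norm"
  shows "phi * \<psi> \<in> finite_norm"
proof -
  obtain C where C: "0 \<le> C" "\<And>l. l \<in> signatures \<Longrightarrow> cmod (sigma_coeff \<psi> l) \<le> C * Dim l"
    using finite_normE[OF assms] by blast
  have "cmod (sigma_coeff (phi * \<psi>) v) \<le> C * Dim v" if v: "v \<in> signatures" for v
  proof (cases "length v")
    case 0
    then have "{l. interlaces l v} = {}" by (auto simp: interlaces_def)
    then show ?thesis using C(1) Dim_pos[OF v] by (simp add: sigma_coeff_phi_mult)
  next
    case (Suc N)
    have "cmod (sigma_coeff (phi * \<psi>) v) \<le> (\<Sum>l | interlaces l v. C * Dim l)"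
      unfolding sigma_coeff_phi_mult by (rule sum_norm_le) (auto intro: C interlaces_signature)
    also have "\<dots> = C * Dim v"
      using v Suc by (simp add: sum_distrib_left[symmetric] Dim_branching signatures_iff)
    finally show ?thesis .
  qed
  then show ?thesis by (auto simp: finite_norm_iff)
qed

lemma finite_norm_phi_power_mult: "\<psi> \<in> finite_norm \<Longrightarrow> phi ^ n * \<psi> \<in> finite_norm"
  by (induction n) (simp_all add: mult.assoc finite_norm_phi_mult)

lemma finite_norm_phi_minus_one_mult: "\<psi> \<in> finite_norm \<Longrightarrow> \<psi> * (phi - 1) \<in> finite_norm"
  using finite_norm_diff[OF finite_norm_phi_mult, of \<psi> \<psi>] by (simp add: algebra_simps)

lemma hat_phi_minus_one_mult:
  assumes "\<psi> \<in> finite_norm" "\<omega> \<in> Omega"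
  shows "hat (\<psi> * (phi - 1)) \<omega> = 0"
proof -
  have 1: "1 \<in> finite_norm" using phi_power_finite_norm[of 0] by simp
  have p: "phi \<in> finite_norm" using phi_power_finite_norm[of 1] by simp
  have d: "phi - 1 \<in> finite_norm" by (intro finite_norm_diff p 1)
  have "hat phi \<omega> = hat (phi - 1) \<omega> + hat 1 \<omega>"
    using hat_add[OF finite_norm_slow[OF d] finite_norm_slow[OF 1] assms(2)] by simp
  then have "hat (phi - 1) \<omega> = 0" by (simp add: hat_phi hat_one assms(2))
  then show ?thesis using hat_mult[OF finite_norm_slow[OF assms(1)] finite_norm_slow[OF d] assms(2)] by simp
qed

subsection \<open>Homogeneous elements of the kernel\<close>

text \<open>The generating function of a sum of L independent Bernoulli variables with success
  probabilities b_i.\<close>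

definition bernoulli_poly :: "nat \<Rightarrow> (nat \<Rightarrow> real) \<Rightarrow> real poly" where
  "bernoulli_poly L b = (\<Prod>i<L. [:1 - b i, b i:])"

definition window_msets :: "nat \<Rightarrow> nat \<Rightarrow> nat multiset set" where
  "window_msets N L = {M. size M = N \<and> set_mset M \<subseteq> {..L}}"

text \<open>The order matches the one demanded in \<Omega> and puts the smallest parameter last,
  where it can tend to 0; positivity keeps the top coefficient of the polynomial nonzero.\<close>

definition parameters :: "nat \<Rightarrow> (nat \<Rightarrow> real) \<Rightarrow> bool" where
  "parameters L b \<longleftrightarrow> (\<forall>i<L. 0 < b i \<and> b i < 1) \<and> (\<forall>i j. i \<le> j \<longrightarrow> j < L \<longrightarrow> b j \<le> b i)"

definition mon_poly :: "real poly \<Rightarrow> nat multiset \<Rightarrow> complex" where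
  "mon_poly p = mon (\<lambda>n. of_real (poly.coeff p n))"

lemma finite_window_msets: "finite (window_msets N L)"
proof (rule finite_subset)
  show "window_msets N L \<subseteq> mset ` {xs. set xs \<subseteq> {..L} \<and> length xs = N}"
  proof
    fix M assume M: "M \<in> window_msets N L"
    obtain xs where "M = mset xs" by (metis ex_mset)
    then show "M \<in> mset ` {xs. set xs \<subseteq> {..L} \<and> length xs = N}"
      using M by (auto simp: window_msets_def)
  qed
  show "finite (mset ` {xs. set xs \<subseteq> {..L} \<and> length xs = N})"
    by (intro finite_imageI finite_lists_length_eq) simp
qed

lemma degree_bernoulli_poly: "degree (bernoulli_poly L b) \<le> L"
proof -
  have "degree (bernoulli_poly L b) \<le> (\<Sum>i<L. degree [:1 - b i, b i:])"
    unfolding bernoulli_poly_def by (rule degree_prod_sum_le[unfolded o_def]) simp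
  also have "\<dots> \<le> (\<Sum>i<L. 1)" by (rule sum_mono) simp
  finally show ?thesis by simp
qed

lemma coeff_bernoulli_poly_Suc:
  "poly.coeff (bernoulli_poly (Suc L) b) n =
    (1 - b L) * poly.coeff (bernoulli_poly L b) n +
    b L * (if n = 0 then 0 else poly.coeff (bernoulli_poly L b) (n - 1))"
proof -
  have "bernoulli_poly (Suc L) b = [:1 - b L, b L:] * bernoulli_poly L b"
    by (simp add: bernoulli_poly_def mult.commute)
  then show ?thesis by (simp add: coeff_pCons')
qed

lemma top_coeff_bernoulli_poly: "poly.coeff (bernoulli_poly L b) L = (\<Prod>i<L. b i)"
proof (induction L)
  case (Suc L)
  have "poly.coeff (bernoulli_poly L b) (Suc L) = 0"
    using degree_bernoulli_poly[of L b] by (intro coeff_eq_0) simp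
  then show ?case using Suc by (simp add: coeff_bernoulli_poly_Suc mult.commute)
qed (simp add: bernoulli_poly_def)

lemma bernoulli_poly_eval:
  "(\<Sum>m\<le>L. of_real (poly.coeff (bernoulli_poly L b) m) * u ^ m) =
    (\<Prod>i<L. complex_of_real (1 - b i) + of_real (b i) * u)"
proof (induction L)
  case (Suc L)
  let ?c = "\<lambda>m. complex_of_real (poly.coeff (bernoulli_poly L b) m)"
  have top: "?c (Suc L) = 0"
    using degree_bernoulli_poly[of L b] by (simp add: coeff_eq_0)
  have "(\<Sum>m\<le>Suc L. of_real (poly.coeff (bernoulli_poly (Suc L) b) m) * u ^ m) =
      (\<Sum>m\<le>Suc L. of_real (1 - b L) * (?c m * u ^ m) +
        of_real (b L) * (if m = 0 then 0 else ?c (m - 1) * u ^ m))"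
    by (rule sum.cong) (auto simp: coeff_bernoulli_poly_Suc algebra_simps)
  also have "\<dots> = of_real (1 - b L) * (\<Sum>m\<le>Suc L. ?c m * u ^ m) +
      of_real (b L) * (\<Sum>m\<le>Suc L. if m = 0 then 0 else ?c (m - 1) * u ^ m)"
    by (simp only: sum.distrib sum_distrib_left)
  also have "(\<Sum>m\<le>Suc L. ?c m * u ^ m) = (\<Sum>m\<le>L. ?c m * u ^ m)" using top by simp
  also have "(\<Sum>m\<le>Suc L. if m = 0 then 0 else ?c (m - 1) * u ^ m) = u * (\<Sum>m\<le>L. ?c m * u ^ m)"
    by (subst sum.atMost_Suc_shift) (simp add: sum_distrib_left mult_ac)
  also have "of_real (1 - b L) * (\<Sum>m\<le>L. ?c m * u ^ m) + of_real (b L) * (u * (\<Sum>m\<le>L. ?c m * u ^ m)) =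
      (\<Prod>i<Suc L. complex_of_real (1 - b i) + of_real (b i) * u)"
    unfolding Suc by (simp add: algebra_simps)
  finally show ?case .
qed (simp add: bernoulli_poly_def)

lemma tendsto_mon:
  fixes c :: "nat \<Rightarrow> 'b \<Rightarrow> complex"
  assumes "\<And>n. (\<lambda>k. c k n) \<longlonglongrightarrow> d n"
  shows "(\<lambda>k. mon (c k) M) \<longlonglongrightarrow> mon d M"
  by (induction M) (auto intro!: tendsto_intros assms)

text \<open>Letting the smallest parameter tend to 0 kills the monomials without the top variable, and the
  top coefficient, which does not vanish, can be cancelled from the others.\<close>

lemma window_identity:
  assumes "\<And>b. parameters L b \<Longrightarrow> (\<Sum>M\<in>window_msets N L. f M * mon_poly (bernoulli_poly L b) M) = 0"
    and "M \<in> window_msets N L"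
  shows "f M = 0"
  using assms
proof (induction L arbitrary: N f M)
  case 0
  have M: "M = replicate_mset N 0" if "M \<in> window_msets N 0" for M
    using that set_mset_subset_singletonD[of M 0] by (auto simp: window_msets_def)
  then have "window_msets N 0 = {replicate_mset N 0}"
    by (auto simp: window_msets_def split: if_splits)
  moreover have "mon_poly (bernoulli_poly 0 b) (replicate_mset k 0) = 1" for k b
    by (induction k) (simp_all add: mon_poly_def bernoulli_poly_def)
  ultimately have "f (replicate_mset N 0) = 0"
    using "0.prems"(1)[of "\<lambda>_. 0"] by (simp add: parameters_def)
  then show ?case using M[OF "0.prems"(2)] by simp
next
  case (Suc L)
  note IH_L = Suc.IH
  show ?case
    using Suc.prems
  proof (induction N arbitrary: f M)
    case 0
    have "window_msets 0 (Suc L) = {{#}}" by (auto simp: window_msets_def)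
    moreover have "parameters (Suc L) (\<lambda>_. 1 / 2)" by (simp add: parameters_def)
    ultimately show ?case using "0.prems"(1)[of "\<lambda>_. 1 / 2"] "0.prems"(2) by (simp add: mon_poly_def)
  next
    case (Suc N)
    have low: "f M = 0" if "M \<in> window_msets (Suc N) L" for M
    proof (rule IH_L[OF _ that])
      fix b assume b: "parameters L b"
      \<comment> \<open>The new parameter has to stay below all given ones: \<tau> is the smallest
        of them, or 1 if there are none, and the inverses start at 1 / 2 so that \<open>t k\<close>
        remains strictly below \<tau>.\<close>
      define \<tau> where "\<tau> = (if L = 0 then 1 else b (L - 1))"
      have \<tau>: "0 < \<tau>" "\<tau> \<le> 1" "\<And>i. i < L \<Longrightarrow> \<tau> \<le> b i"
        using b by (auto simp: \<tau>_def parameters_def less_imp_le)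
      define t where "t k = \<tau> * inverse (real (k + 2))" for k
      have t: "0 < t k" "t k < \<tau>" for k
      proof -
        show "0 < t k" unfolding t_def using \<tau>(1) by (intro mult_pos_pos) auto
        have "inverse (real (k + 2)) < 1" by (simp add: inverse_eq_divide)
        then have "\<tau> * inverse (real (k + 2)) < \<tau> * 1" using \<tau>(1) by (rule mult_strict_left_mono)
        then show "t k < \<tau>" by (simp add: t_def)
      qed
      have "t \<longlonglongrightarrow> \<tau> * 0"
        unfolding t_def
        by (intro tendsto_mult tendsto_const LIMSEQ_ignore_initial_segment[OF lim_inverse_n])
      then have t0: "t \<longlonglongrightarrow> 0" by simp
      have eq: "bernoulli_poly L (b(L := s)) = bernoulli_poly L b" for s
        unfolding bernoulli_poly_def by (rule prod.cong) auto
      have lim: "(\<lambda>k. of_real (poly.coeff (bernoulli_poly (Suc L) (b(L := t k))) n)) \<longlonglongrightarrow>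
          (of_real (poly.coeff (bernoulli_poly L b) n) :: complex)" for n
      proof -
        have "(\<lambda>k. (1 - t k) * poly.coeff (bernoulli_poly L b) n +
            t k * (if n = 0 then 0 else poly.coeff (bernoulli_poly L b) (n - 1))) \<longlonglongrightarrow>
            (1 - 0) * poly.coeff (bernoulli_poly L b) n +
            0 * (if n = 0 then 0 else poly.coeff (bernoulli_poly L b) (n - 1))"
          by (intro tendsto_intros t0)
        then show ?thesis
          unfolding coeff_bernoulli_poly_Suc eq by (intro tendsto_of_real) simp
      qed
      have par: "parameters (Suc L) (b(L := t k))" for k
        unfolding parameters_def
      proof (intro conjI allI impI)
        fix i assume "i < Suc L"
        then show "0 < (b(L := t k)) i" "(b(L := t k)) i < 1"
          using b t[of k] \<tau>(2) by (auto simp: parameters_def less_Suc_eq)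
      next
        fix i j assume "i \<le> j" "j < Suc L"
        then show "(b(L := t k)) j \<le> (b(L := t k)) i"
          using b t(2)[of k] \<tau>(3)[of i] by (auto simp: parameters_def less_Suc_eq)
      qed
      have "(\<lambda>k. \<Sum>M\<in>window_msets (Suc N) (Suc L). f M * mon_poly (bernoulli_poly (Suc L) (b(L := t k))) M) \<longlonglongrightarrow>
          (\<Sum>M\<in>window_msets (Suc N) (Suc L). f M * mon_poly (bernoulli_poly L b) M)"
        unfolding mon_poly_def by (intro tendsto_sum tendsto_mult tendsto_const tendsto_mon lim)
      then have "(\<Sum>M\<in>window_msets (Suc N) (Suc L). f M * mon_poly (bernoulli_poly L b) M) = 0"
        by (simp add: Suc.prems(1)[OF par] LIMSEQ_const_iff)
      also have "(\<Sum>M\<in>window_msets (Suc N) (Suc L). f M * mon_poly (bernoulli_poly L b) M) =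
          (\<Sum>M\<in>window_msets (Suc N) L. f M * mon_poly (bernoulli_poly L b) M)"
      proof (rule sum.mono_neutral_right[OF finite_window_msets])
        show "window_msets (Suc N) L \<subseteq> window_msets (Suc N) (Suc L)"
          by (auto simp: window_msets_def)
        have "mon_poly (bernoulli_poly L b) M = 0" if "Suc L \<in># M" for M
        proof -
          obtain M' where "M = add_mset (Suc L) M'" using \<open>Suc L \<in># M\<close> by (metis insert_DiffM)
          then show ?thesis
            using degree_bernoulli_poly[of L b] by (simp add: mon_poly_def coeff_eq_0)
        qed
        moreover have "Suc L \<in># M" if "M \<in> window_msets (Suc N) (Suc L) - window_msets (Suc N) L" for M
        proof (rule ccontr)
          assume n: "Suc L \<notin># M"
          have "set_mset M \<subseteq> {..L}"
          proof
            fix x assume "x \<in># M"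
            then have "x \<le> Suc L" "x \<noteq> Suc L" using that n by (auto simp: window_msets_def)
            then show "x \<in> {..L}" by simp
          qed
          then show False using that by (auto simp: window_msets_def)
        qed
        ultimately show "\<forall>M\<in>window_msets (Suc N) (Suc L) - window_msets (Suc N) L.
            f M * mon_poly (bernoulli_poly L b) M = 0" by simp
      qed
      finally show "(\<Sum>M\<in>window_msets (Suc N) L. f M * mon_poly (bernoulli_poly L b) M) = 0" .
    qed
    \<comment> \<open>By \<open>low\<close> only monomials containing the top variable survive;
      dividing by it lowers the degree, so the inner induction applies with the same number of
      parameters.\<close>
    have high: "f (add_mset (Suc L) M) = 0" if "M \<in> window_msets N (Suc L)" for M
    proof (rule Suc.IH[OF _ that])
      fix b assume b: "parameters (Suc L) b"
      let ?m = "mon_poly (bernoulli_poly (Suc L) b)"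
      have "0 = (\<Sum>M\<in>window_msets (Suc N) (Suc L). f M * ?m M)" by (simp add: Suc.prems(1)[OF b])
      also have "\<dots> = (\<Sum>M\<in>add_mset (Suc L) ` window_msets N (Suc L). f M * ?m M)"
      proof (rule sum.mono_neutral_right[OF finite_window_msets])
        show "add_mset (Suc L) ` window_msets N (Suc L) \<subseteq> window_msets (Suc N) (Suc L)"
          by (auto simp: window_msets_def)
        show "\<forall>M\<in>window_msets (Suc N) (Suc L) - add_mset (Suc L) ` window_msets N (Suc L). f M * ?m M = 0"
        proof
          fix M assume M: "M \<in> window_msets (Suc N) (Suc L) - add_mset (Suc L) ` window_msets N (Suc L)"
          have "Suc L \<notin># M"
          proof
            assume "Suc L \<in># M"
            then obtain M' where M': "M = add_mset (Suc L) M'" by (metis insert_DiffM)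
            then have "M' \<in> window_msets N (Suc L)" using M by (auto simp: window_msets_def)
            then show False using M M' by blast
          qed
          have "set_mset M \<subseteq> {..L}"
          proof
            fix x assume "x \<in># M"
            then have "x \<le> Suc L" "x \<noteq> Suc L" using M \<open>Suc L \<notin># M\<close> by (auto simp: window_msets_def)
            then show "x \<in> {..L}" by simp
          qed
          then have "f M = 0" using M by (intro low) (auto simp: window_msets_def)
          then show "f M * ?m M = 0" by simp
        qed
      qed
      also have "\<dots> = (\<Sum>M\<in>window_msets N (Suc L). f (add_mset (Suc L) M) * ?m (add_mset (Suc L) M))"
        by (subst sum.reindex) (auto simp: inj_on_def)
      also have "\<dots> = of_real (\<Prod>i<Suc L. b i) * (\<Sum>M\<in>window_msets N (Suc L). f (add_mset (Suc L) M) * ?m M)"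
        unfolding sum_distrib_left
        by (rule sum.cong) (simp_all add: mon_poly_def top_coeff_bernoulli_poly mult_ac del: prod.lessThan_Suc)
      finally have "of_real (\<Prod>i<Suc L. b i) * (\<Sum>M\<in>window_msets N (Suc L). f (add_mset (Suc L) M) * ?m M) = 0" ..
      moreover have "(\<Prod>i<Suc L. b i) \<noteq> 0" using b by (auto simp: parameters_def prod_zero_iff simp del: prod.lessThan_Suc)
      ultimately show "(\<Sum>M\<in>window_msets N (Suc L). f (add_mset (Suc L) M) * ?m M) = 0"
        by (simp only: mult_eq_0_iff of_real_eq_0_iff) simp
    qed
    show ?case
    proof (cases "Suc L \<in># M")
      case True
      then obtain M' where M': "M = add_mset (Suc L) M'" by (metis insert_DiffM)
      then have "M' \<in> window_msets N (Suc L)" using Suc.prems(2) by (auto simp: window_msets_def)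
      then show ?thesis unfolding M' by (rule high)
    next
      case False
      have "set_mset M \<subseteq> {..L}"
      proof
        fix x assume "x \<in># M"
        then have "x \<le> Suc L" "x \<noteq> Suc L" using Suc.prems(2) False by (auto simp: window_msets_def)
        then show "x \<in> {..L}" by simp
      qed
      then show ?thesis using Suc.prems(2) by (intro low) (auto simp: window_msets_def)
    qed
  qed
qed

text \<open>A product of \<open>L\<close> factors \<open>1 - b + b u\<close>, divided by \<open>u\<^sup>k\<close>, is some \<open>\<Phi>(u; \<omega>)\<close>: the \<open>k\<close> factors
  with the largest \<open>b\<close> are rewritten as \<open>1 + (1 - b) (1/u - 1)\<close>.\<close>

lemma bernoulli_point:
  assumes b: "parameters L b" and k: "k \<le> L"
  obtains \<omega> where "\<omega> \<in> Omega"
    "phi_hat \<omega> = (\<lambda>n. if - int k \<le> n then of_real (poly.coeff (bernoulli_poly L b) (nat (n + int k))) else 0)"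
proof -
  define bp where "bp i = (if i < L - k then b (k + i) else 0)" for i
  \<comment> \<open>The k largest parameters go into the minus half, in reverse order so that the
    numbers 1 - b_i decrease.\<close>
  define bm where "bm i = (if i < k then 1 - b (k - 1 - i) else 0)" for i
  define \<omega> where "\<omega> = (\<lambda>_::nat. 0 :: real, bp, \<lambda>_::nat. 0 :: real, bm, \<Sum>i. bp i, \<Sum>i. bm i)"
  have b': "\<And>i. i < L \<Longrightarrow> 0 < b i" "\<And>i. i < L \<Longrightarrow> b i < 1" "\<And>i j. i \<le> j \<Longrightarrow> j < L \<Longrightarrow> b j \<le> b i"
    using b by (auto simp: parameters_def)
  have "decseq bp"
    unfolding decseq_def bp_def using b' less_imp_le[OF b'(1)] by auto
  moreover have "decseq bm"
    unfolding decseq_def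
  proof (intro allI impI)
    fix i j :: nat assume "i \<le> j"
    then show "bm j \<le> bm i"
      using b'(3)[of "k - 1 - j" "k - 1 - i"] less_imp_le[OF b'(2), of "k - 1 - i"] k
      by (auto simp: bm_def)
  qed
  moreover have "0 \<le> bp i" "0 \<le> bm i" for i
    using b' k by (auto simp: bp_def bm_def less_imp_le)
  moreover have "summable bp" by (rule summable_finite[of "{..<L}"]) (auto simp: bp_def)
  moreover have "summable bm" by (rule summable_finite[of "{..<k}"]) (auto simp: bm_def)
  \<comment> \<open>If neither half is empty, the entries are \<open>b k\<close> and
    \<open>1 - b (k - 1)\<close>, and the condition is again the monotonicity of b.\<close>
  moreover have "bp 0 + bm 0 \<le> 1"
    using b'(1)[of "k - 1"] b'(2)[of k] b'(3)[of "k - 1" k] k by (auto simp: bp_def bm_def)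
  ultimately have \<omega>: "\<omega> \<in> Omega"
    unfolding Omega_def \<omega>_def by (auto simp: decseq_const)
  let ?p = "bernoulli_poly L b"
  let ?c = "\<lambda>n. if - int k \<le> n then complex_of_real (poly.coeff ?p (nat (n + int k))) else 0"
  have Phi: "Phi u \<omega> = (\<Sum>m\<le>L. of_real (poly.coeff ?p m) * u ^ m) / u ^ k" if u: "u \<noteq> 0" for u
  proof -
    let ?g = "\<lambda>i. complex_of_real (1 - b i) + of_real (b i) * u"
    have "Phi u \<omega> = (\<Prod>i. (1 + of_real (bp i) * (u - 1)) * (1 + of_real (bm i) * (inverse u - 1)))"
      by (simp add: \<omega>_def Phi_def)
    also have "\<dots> = (\<Prod>i<L. (1 + of_real (bp i) * (u - 1)) * (1 + of_real (bm i) * (inverse u - 1)))"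
      by (rule prodinf_finite) (use k in \<open>auto simp: bp_def bm_def\<close>)
    also have "\<dots> = (\<Prod>i<L. 1 + of_real (bp i) * (u - 1)) * (\<Prod>i<L. 1 + of_real (bm i) * (inverse u - 1))"
      by (rule prod.distrib)
    also have "(\<Prod>i<L. 1 + of_real (bp i) * (u - 1)) = (\<Prod>i<L - k. 1 + of_real (bp i) * (u - 1))"
      by (rule prod.mono_neutral_right) (auto simp: bp_def)
    also have "\<dots> = (\<Prod>i=k..<L. ?g i)"
      by (rule prod.reindex_bij_witness[where i = "\<lambda>i. i - k" and j = "\<lambda>i. k + i"])
        (use k in \<open>auto simp: bp_def algebra_simps\<close>)
    also have "(\<Prod>i<L. 1 + of_real (bm i) * (inverse u - 1)) = (\<Prod>i<k. 1 + of_real (bm i) * (inverse u - 1))"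
      by (rule prod.mono_neutral_right) (use k in \<open>auto simp: bm_def\<close>)
    also have "\<dots> = (\<Prod>i<k. ?g i / u)"
      by (rule prod.reindex_bij_witness[where i = "\<lambda>i. k - 1 - i" and j = "\<lambda>i. k - 1 - i"])
        (use u in \<open>auto simp: bm_def field_simps\<close>)
    also have "\<dots> = (\<Prod>i<k. ?g i) / u ^ k" by (simp add: prod_dividef)
    also have "(\<Prod>i=k..<L. ?g i) * ((\<Prod>i<k. ?g i) / u ^ k) = (\<Prod>i<L. ?g i) / u ^ k"
    proof -
      have "{..<L} = {..<k} \<union> {k..<L}" "{..<k} \<inter> {k..<L} = {}" using k by auto
      then have "(\<Prod>i<L. ?g i) = (\<Prod>i<k. ?g i) * (\<Prod>i=k..<L. ?g i)" by (simp only: prod.union_disjoint finite_lessThan finite_atLeastLessThan)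
      then show ?thesis by (simp add: mult.commute)
    qed
    also have "(\<Prod>i<L. ?g i) = (\<Sum>m\<le>L. of_real (poly.coeff ?p m) * u ^ m)"
      by (rule bernoulli_poly_eval[symmetric])
    finally show ?thesis .
  qed
  have "laurent_expansion (\<lambda>u. Phi u \<omega>) ?c"
    unfolding laurent_expansion_def
  proof (intro exI[of _ 1] conjI allI impI)
    fix u :: complex assume "1 - 1 < cmod u \<and> cmod u < 1 + 1"
    then have u: "u \<noteq> 0" by auto
    show "((\<lambda>n. ?c n * u powi n) has_sum Phi u \<omega>) UNIV"
    proof (rule has_sum_finite_neutralI)
      show "?c n * u powi n = 0" if "n \<in> UNIV - (\<lambda>m. int m - int k) ` {..L}" for n
      proof (cases "- int k \<le> n")
        case True
        then have "n = int (nat (n + int k)) - int k" by simp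
        then have "nat (n + int k) \<notin> {..L}" using that by blast
        then show ?thesis using degree_bernoulli_poly[of L b] by (simp add: coeff_eq_0)
      qed simp
      have "(\<Sum>n\<in>(\<lambda>m. int m - int k) ` {..L}. ?c n * u powi n) =
          (\<Sum>m\<le>L. of_real (poly.coeff ?p m) * u powi (int m - int k))"
        by (subst sum.reindex) (auto simp: inj_on_def)
      also have "\<dots> = (\<Sum>m\<le>L. of_real (poly.coeff ?p m) * u ^ m / u ^ k)"
        by (simp add: power_int_diff u)
      finally show "Phi u \<omega> = (\<Sum>n\<in>(\<lambda>m. int m - int k) ` {..L}. ?c n * u powi n)"
        by (simp add: Phi[OF u] sum_divide_distrib)
    qed auto
  qed simp
  then show ?thesis by (intro that[OF \<omega>] phi_hat_eqI)
qed

lemma mon_image_mset: "mon c (image_mset g M) = mon (\<lambda>x. c (g x)) M"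
  by (induction M) simp_all

text \<open>The letters of a given monomial lie in a window from - k to k. At points whose Laurent
  coefficients vanish outside this window, evaluation is a finite sum over the monomials in it, all
  of the same degree D by homogeneity, and \<open>window_identity\<close> separates these.\<close>

lemma homogeneous_kernel:
  assumes slow: "slow \<eta>" and homog: "\<And>M. size M \<noteq> D \<Longrightarrow> coeff \<eta> M = 0"
    and zero: "\<And>\<omega>. \<omega> \<in> Omega \<Longrightarrow> hat \<eta> \<omega> = 0"
  shows "\<eta> = 0"
proof (rule bseries_eqI)
  fix M0
  show "coeff \<eta> M0 = coeff 0 M0"
  proof (cases "size M0 = D")
    case True
    define k where "k = nat (Max (insert 0 (abs ` set_mset M0)))"
    \<comment> \<open>Shifting by k moves the window to 0, ..., 2 k, the exponents of a polynomial
      of degree at most 2 k.\<close>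
    define L where "L = 2 * k"
    have bd: "\<bar>x\<bar> \<le> int k" if "x \<in># M0" for x
    proof -
      have "\<bar>x\<bar> \<le> Max (insert 0 (abs ` set_mset M0))" by (rule Max_ge) (use that in auto)
      then show ?thesis unfolding k_def by simp
    qed
    have kL: "k \<le> L" by (simp add: L_def)
    define g where "g n = int n - int k" for n
    define f where "f M = coeff \<eta> (image_mset g M)" for M
    have inj: "inj (image_mset g)" by (rule multiset.inj_map) (auto simp: inj_def g_def)
    have "f M = 0" if "M \<in> window_msets D L" for M
    proof (rule window_identity[OF _ that])
      fix b assume b: "parameters L b"
      obtain \<omega> where \<omega>: "\<omega> \<in> Omega"
        "phi_hat \<omega> = (\<lambda>n. if - int k \<le> n then of_real (poly.coeff (bernoulli_poly L b) (nat (n + int k))) else 0)"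
        using bernoulli_point[OF b, of k] kL by blast
      have "((\<lambda>M. coeff \<eta> M * mon (phi_hat \<omega>) M) has_sum
          (\<Sum>M\<in>window_msets D L. f M * mon_poly (bernoulli_poly L b) M)) UNIV"
      proof (rule has_sum_finite_neutralI)
        show "finite (image_mset g ` window_msets D L)" by (intro finite_imageI finite_window_msets)
        have "mon (phi_hat \<omega>) (image_mset g M) = mon_poly (bernoulli_poly L b) M" for M
          unfolding mon_image_mset mon_poly_def by (simp add: \<omega>(2) g_def)
        then show "(\<Sum>M\<in>window_msets D L. f M * mon_poly (bernoulli_poly L b) M) =
            (\<Sum>M\<in>image_mset g ` window_msets D L. coeff \<eta> M * mon (phi_hat \<omega>) M)"
          by (subst sum.reindex) (auto simp: f_def intro: inj_on_subset[OF inj])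
        fix M assume M: "M \<in> UNIV - image_mset g ` window_msets D L"
        show "coeff \<eta> M * mon (phi_hat \<omega>) M = 0"
        proof (cases "size M = D \<and> (\<forall>x\<in>#M. - int k \<le> x \<and> x + int k \<le> int L)")
          case True
          let ?h = "\<lambda>x. nat (x + int k)"
          have "image_mset g (image_mset ?h M) = M"
          proof -
            have "image_mset (\<lambda>x. g (?h x)) M = image_mset (\<lambda>x. x) M"
              by (rule image_mset_cong) (use True in \<open>auto simp: g_def\<close>)
            then show ?thesis by (simp add: image_mset.compositionality o_def)
          qed
          moreover have "image_mset ?h M \<in> window_msets D L"
            using True by (auto simp: window_msets_def nat_le_iff)
          ultimately show ?thesis using M by (metis DiffD2 image_eqI)
        next
          case False
          show ?thesis
          proof (cases "size M = D")
            case True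
            then obtain x where x: "x \<in># M" "\<not> (- int k \<le> x \<and> x + int k \<le> int L)" using False by blast
            have "phi_hat \<omega> x = 0"
              using x(2) degree_bernoulli_poly[of L b] by (auto simp: \<omega>(2) intro!: coeff_eq_0)
            then have "mon (phi_hat \<omega>) M = 0"
              using x(1) by (metis insert_DiffM mon_simps(2) mult_zero_left)
            then show ?thesis by simp
          qed (simp add: homog)
        qed
      qed auto
      then have "ev (phi_hat \<omega>) \<eta> = (\<Sum>M\<in>window_msets D L. f M * mon_poly (bernoulli_poly L b) M)"
        unfolding ev_def by (rule infsumI)
      then show "(\<Sum>M\<in>window_msets D L. f M * mon_poly (bernoulli_poly L b) M) = 0"
        using zero[OF \<omega>(1)] hat_ev(2)[OF slow \<omega>(1)] by simp
    qed
    note f0 = this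
    let ?h = "\<lambda>x. nat (x + int k)"
    have ge: "0 \<le> x + int k" if "x \<in># M0" for x using bd[OF that] by linarith
    have "image_mset (\<lambda>x. g (?h x)) M0 = image_mset (\<lambda>x. x) M0"
      by (rule image_mset_cong) (use ge in \<open>auto simp: g_def\<close>)
    then have "image_mset g (image_mset ?h M0) = M0" by (simp add: image_mset.compositionality o_def)
    moreover have "image_mset ?h M0 \<in> window_msets D L"
      using True bd by (auto simp: window_msets_def L_def nat_le_iff abs_le_iff)
    ultimately show ?thesis using f0[of "image_mset ?h M0"] by (simp add: f_def)
  qed (simp add: homog)
qed

subsection \<open>Homogenization\<close>

lift_definition hcomp :: "nat \<Rightarrow> bseries \<Rightarrow> bseries" is "\<lambda>N f M. if size M = N then f M else 0"
  by auto

lemma coeff_hcomp [simp]: "coeff (hcomp N \<psi>) M = (if size M = N then coeff \<psi> M else 0)"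
  by (simp add: hcomp.rep_eq)

lemma sigma_coeff_hcomp: "sigma_coeff (hcomp N \<psi>) l = (if length l = N then sigma_coeff \<psi> l else 0)"
proof -
  have "expands (hcomp N \<psi>) (\<lambda>l. if length l = N then sigma_coeff \<psi> l else 0)"
    unfolding expands_def
  proof (intro conjI allI impI)
    fix M
    have "(\<Sum>v\<in>support M. (if length v = N then sigma_coeff \<psi> v else 0) * coeff (sigma v) M) =
        (\<Sum>v\<in>support M. if size M = N then sigma_coeff \<psi> v * coeff (sigma v) M else 0)"
      by (rule sum.cong) (auto simp: support_length)
    then show "coeff (hcomp N \<psi>) M =
        (\<Sum>v\<in>support M. (if length v = N then sigma_coeff \<psi> v else 0) * coeff (sigma v) M)"
      using coeff_sigma_expansion[of \<psi> M] by simp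
  qed (simp add: sigma_coeff_outside)
  from sigma_coeff_eqI[OF this] show ?thesis by simp
qed

lemma finite_norm_hcomp:
  assumes "\<psi> \<in> finite_norm"
  shows "hcomp N \<psi> \<in> finite_norm"
proof -
  obtain C where C: "0 \<le> C" "\<And>l. l \<in> signatures \<Longrightarrow> cmod (sigma_coeff \<psi> l) \<le> C * Dim l"
    using finite_normE[OF assms] by blast
  then have "cmod (sigma_coeff (hcomp N \<psi>) l) \<le> C * Dim l" if "l \<in> signatures" for l
    using C(2)[OF that] Dim_pos[OF that] by (simp add: sigma_coeff_hcomp)
  then show ?thesis by (auto simp: finite_norm_iff)
qed

definition homogenize :: "nat \<Rightarrow> bseries \<Rightarrow> bseries" where
  "homogenize D \<psi> = (\<Sum>k\<le>D. phi ^ (D - k) * hcomp k \<psi>)"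

lemma sum_hcomp:
  assumes "\<And>M. D < size M \<Longrightarrow> coeff \<psi> M = 0"
  shows "(\<Sum>k\<le>D. hcomp k \<psi>) = \<psi>"
proof (rule bseries_eqI)
  fix M
  show "coeff (\<Sum>k\<le>D. hcomp k \<psi>) M = coeff \<psi> M"
    using assms[of M] by (cases "size M \<le> D") (simp_all add: coeff_sum)
qed

text \<open>The quotient of 1 - \<phi>^m by 1 - \<phi> is a geometric sum, so the multiplier y is
  built from components of \<psi> by multiplication with powers of \<phi>, which preserves finite
  norm.\<close>

lemma homogenize_remainder:
  assumes \<psi>: "\<psi> \<in> finite_norm" and deg: "\<And>M. D < size M \<Longrightarrow> coeff \<psi> M = 0"
  obtains y where "y \<in> finite_norm" "\<psi> - homogenize D \<psi> = y * (phi - 1)"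
proof (rule that)
  let ?y = "- (\<Sum>k\<le>D. \<Sum>j<D - k. phi ^ j * hcomp k \<psi>)"
  show "?y \<in> finite_norm"
    by (intro finite_norm_uminus finite_norm_sum finite_norm_phi_power_mult finite_norm_hcomp \<psi>)
  have "\<psi> - homogenize D \<psi> = (\<Sum>k\<le>D. (1 - phi ^ (D - k)) * hcomp k \<psi>)"
    using sum_hcomp[of D \<psi>] deg by (simp add: homogenize_def left_diff_distrib sum_subtractf)
  also have "\<dots> = (\<Sum>k\<le>D. - (\<Sum>j<D - k. phi ^ j * hcomp k \<psi>) * (phi - 1))"
  proof (rule sum.cong[OF refl])
    fix k
    have "1 - phi ^ (D - k) = (1 - phi) * (\<Sum>j<D - k. phi ^ j)" by (rule one_diff_power_eq)
    then have "(1 - phi ^ (D - k)) * hcomp k \<psi> = - ((\<Sum>j<D - k. phi ^ j) * hcomp k \<psi>) * (phi - 1)"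
      by (simp only:) (simp add: algebra_simps)
    then show "(1 - phi ^ (D - k)) * hcomp k \<psi> = - (\<Sum>j<D - k. phi ^ j * hcomp k \<psi>) * (phi - 1)"
      by (simp only: sum_distrib_right)
  qed
  also have "\<dots> = ?y * (phi - 1)"
    by (simp add: sum_distrib_right[symmetric] sum_negf)
  finally show "\<psi> - homogenize D \<psi> = ?y * (phi - 1)" .
qed

lemma coeff_phi_power_mult_homogeneous:
  assumes "\<And>M. size M \<noteq> k \<Longrightarrow> coeff \<psi> M = 0" "size M \<noteq> n + k"
  shows "coeff (phi ^ n * \<psi>) M = 0"
  using assms(2)
proof (induction n arbitrary: M)
  case (Suc n)
  have "coeff (phi ^ n * \<psi>) (M - {#x#}) = 0" if "x \<in># M" for x
  proof (rule Suc.IH)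
    have "size M = Suc (size (M - {#x#}))" using that by (metis insert_DiffM size_add_mset)
    then show "size (M - {#x#}) \<noteq> n + k" using Suc.prems by simp
  qed
  then show ?case by (simp add: mult.assoc coeff_phi_mult)
qed (use assms(1) in simp)

lemma homogenize_homogeneous: "size M \<noteq> D \<Longrightarrow> coeff (homogenize D \<psi>) M = 0"
  unfolding homogenize_def coeff_sum
  by (rule sum.neutral) (auto intro!: coeff_phi_power_mult_homogeneous[where k = k for k] split: if_splits)

text \<open>The degree k component of x enters once through \<phi> x, with the power D - k - 1, and
  once through x, with the power D - k; the extra factor \<phi> makes the two contributions
  cancel.\<close>

lemma homogenize_phi_minus_one_mult:
  assumes deg: "\<And>M. D \<le> size M \<Longrightarrow> coeff x M = 0"
  shows "homogenize D (x * (phi - 1)) = 0"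
proof -
  have h0: "hcomp 0 (x * (phi - 1)) = - hcomp 0 x"
    by (rule bseries_eqI) (simp add: right_diff_distrib mult.commute[of x] coeff_phi_mult)
  have hS: "hcomp (Suc k) (x * (phi - 1)) = phi * hcomp k x - hcomp (Suc k) x" for k
  proof (rule bseries_eqI)
    fix M :: "int multiset"
    have "size (M - {#n#}) = k \<longleftrightarrow> size M = Suc k" if "n \<in># M" for n
      using that by (metis Suc_inject insert_DiffM size_add_mset)
    then show "coeff (hcomp (Suc k) (x * (phi - 1))) M = coeff (phi * hcomp k x - hcomp (Suc k) x) M"
      by (simp add: right_diff_distrib mult.commute[of x] coeff_phi_mult)
  qed
  \<comment> \<open>The component of degree D has no partner in the telescoping sum, which is why
    the degree of x must lie below D.\<close>
  have top: "hcomp D x = 0" by (rule bseries_eqI) (simp add: deg)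
  have shift: "phi ^ (D - Suc k) * (phi * hcomp k x) = phi ^ (D - k) * hcomp k x" if "k < D" for k
  proof -
    have "D - k = Suc (D - Suc k)" using that by simp
    then show ?thesis by (simp add: mult_ac)
  qed
  have "homogenize D (x * (phi - 1)) = phi ^ D * hcomp 0 (x * (phi - 1)) +
      (\<Sum>k<D. phi ^ (D - Suc k) * hcomp (Suc k) (x * (phi - 1)))"
    by (simp add: homogenize_def sum.atMost_shift)
  also have "(\<Sum>k<D. phi ^ (D - Suc k) * hcomp (Suc k) (x * (phi - 1))) =
      (\<Sum>k<D. phi ^ (D - k) * hcomp k x) - (\<Sum>k<D. phi ^ (D - Suc k) * hcomp (Suc k) x)"
    unfolding hS by (simp add: right_diff_distrib sum_subtractf shift)
  also have "phi ^ D * hcomp 0 (x * (phi - 1)) = - (phi ^ D * hcomp 0 x)" by (simp add: h0)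
  also have "- (phi ^ D * hcomp 0 x) + ((\<Sum>k<D. phi ^ (D - k) * hcomp k x) -
      (\<Sum>k<D. phi ^ (D - Suc k) * hcomp (Suc k) x)) =
      (\<Sum>k<D. phi ^ (D - k) * hcomp k x) - (\<Sum>k\<le>D. phi ^ (D - k) * hcomp k x)"
    by (simp add: sum.atMost_shift)
  also have "\<dots> = 0" by (simp add: top flip: lessThan_Suc_atMost)
  finally show ?thesis .
qed

text \<open>The multiplier x may have infinite norm. As its multiple of \<phi> - 1 homogenizes to
  zero, this multiple equals its own remainder, whose multiplier y has finite norm.\<close>

lemma ideal_intersection:
  assumes "x * (phi - 1) \<in> finite_norm"
  shows "x * (phi - 1) \<in> principal_ideal finite_norm (phi - 1)"
proof -
  obtain d where d: "\<And>M. d < size M \<Longrightarrow> coeff x M = 0" using coeff_bounded_degree[of x] by blast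
  obtain e where e: "\<And>M. e < size M \<Longrightarrow> coeff (x * (phi - 1)) M = 0"
    using coeff_bounded_degree[of "x * (phi - 1)"] by blast
  define D where "D = Suc (max d e)"
  obtain y where y: "y \<in> finite_norm" "x * (phi - 1) - homogenize D (x * (phi - 1)) = y * (phi - 1)"
    by (rule homogenize_remainder[OF assms, of D]) (auto simp: D_def e)
  have "homogenize D (x * (phi - 1)) = 0"
    by (rule homogenize_phi_minus_one_mult) (simp add: D_def d)
  then have "x * (phi - 1) = y * (phi - 1)" using y(2) by simp
  then show ?thesis using y(1) by (auto simp: principal_ideal_def)
qed

lemma kernel_in_ideal:
  assumes \<psi>: "\<psi> \<in> finite_norm" and zero: "\<And>\<omega>. \<omega> \<in> Omega \<Longrightarrow> hat \<psi> \<omega> = 0"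
  shows "\<psi> \<in> principal_ideal finite_norm (phi - 1)"
proof -
  obtain D where D: "\<And>M. D < size M \<Longrightarrow> coeff \<psi> M = 0" using coeff_bounded_degree[of \<psi>] by blast
  obtain y where y: "y \<in> finite_norm" "\<psi> - homogenize D \<psi> = y * (phi - 1)"
    by (rule homogenize_remainder[OF \<psi> D])
  have h: "homogenize D \<psi> \<in> finite_norm"
    unfolding homogenize_def by (intro finite_norm_sum finite_norm_phi_power_mult finite_norm_hcomp \<psi>)
  have "homogenize D \<psi> = 0"
  proof (rule homogeneous_kernel[OF finite_norm_slow[OF h] homogenize_homogeneous])
    fix \<omega> assume \<omega>: "\<omega> \<in> Omega"
    have "hat \<psi> \<omega> = hat (homogenize D \<psi>) \<omega> + hat (y * (phi - 1)) \<omega>"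
      using hat_add[OF finite_norm_slow[OF h] finite_norm_slow[OF finite_norm_phi_minus_one_mult[OF y(1)]] \<omega>]
      by (simp flip: y(2))
    then show "hat (homogenize D \<psi>) \<omega> = 0"
      using zero[OF \<omega>] hat_phi_minus_one_mult[OF y(1) \<omega>] by simp
  qed
  then show ?thesis using y by (auto simp: principal_ideal_def)
qed

theorem proposition3p9:
  shows
    "(\<forall>\<psi>\<in>finite_norm.
        (\<forall>\<omega>\<in>Omega. (\<lambda>l. norm (sigma_coeff \<psi> l * sigma_hat l \<omega>)) summable_on signatures) \<and>
        bounded (hat \<psi> ` Omega) \<and>
        (SUP \<omega>\<in>Omega. ennreal (norm (hat \<psi> \<omega>))) \<le> bnorm \<psi>) \<and>
     ((\<forall>\<psi>\<in>finite_norm. bounded_continuous_on Omega (hat \<psi>)) \<and>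
      (\<forall>\<omega>\<in>Omega. hat 1 \<omega> = 1) \<and>
      (\<forall>\<psi>\<in>finite_norm. \<forall>\<theta>\<in>finite_norm. \<forall>\<omega>\<in>Omega. hat (\<psi> + \<theta>) \<omega> = hat \<psi> \<omega> + hat \<theta> \<omega>) \<and>
      (\<forall>\<psi>\<in>finite_norm. \<forall>\<theta>\<in>finite_norm. \<forall>\<omega>\<in>Omega. hat (\<psi> * \<theta>) \<omega> = hat \<psi> \<omega> * hat \<theta> \<omega>) \<and>
      (\<forall>c. \<forall>\<psi>\<in>finite_norm. \<forall>\<omega>\<in>Omega. hat (bscale c \<psi>) \<omega> = c * hat \<psi> \<omega>)) \<and>
     ({\<psi> \<in> finite_norm. \<forall>\<omega>\<in>Omega. hat \<psi> \<omega> = 0} = principal_ideal finite_norm (phi - 1) \<and>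
      principal_ideal finite_norm (phi - 1) = principal_ideal UNIV (phi - 1) \<inter> finite_norm)"
proof -
  have bdd: "bounded (hat \<psi> ` Omega)" if \<psi>: "\<psi> \<in> finite_norm" for \<psi>
  proof (rule boundedI)
    fix z assume "z \<in> hat \<psi> ` Omega"
    then obtain \<omega> where \<omega>: "\<omega> \<in> Omega" "z = hat \<psi> \<omega>" by blast
    have "enn2real (ennreal (cmod (hat \<psi> \<omega>))) \<le> enn2real (bnorm \<psi>)"
      using \<psi> by (intro enn2real_mono hat_bound \<omega>) (auto simp: finite_norm_def)
    then show "norm z \<le> enn2real (bnorm \<psi>)" by (simp add: \<omega>)
  qed
  have sub: "principal_ideal finite_norm (phi - 1) \<subseteq> {\<psi> \<in> finite_norm. \<forall>\<omega>\<in>Omega. hat \<psi> \<omega> = 0}"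
    by (auto simp: principal_ideal_def finite_norm_phi_minus_one_mult hat_phi_minus_one_mult)
  have ker: "{\<psi> \<in> finite_norm. \<forall>\<omega>\<in>Omega. hat \<psi> \<omega> = 0} = principal_ideal finite_norm (phi - 1)"
    using sub kernel_in_ideal by blast
  have int: "principal_ideal finite_norm (phi - 1) = principal_ideal UNIV (phi - 1) \<inter> finite_norm"
  proof (intro equalityI subsetI)
    fix \<psi> assume "\<psi> \<in> principal_ideal finite_norm (phi - 1)"
    then show "\<psi> \<in> principal_ideal UNIV (phi - 1) \<inter> finite_norm"
      using sub by (auto simp: principal_ideal_def)
  next
    fix \<psi> assume "\<psi> \<in> principal_ideal UNIV (phi - 1) \<inter> finite_norm"
    then show "\<psi> \<in> principal_ideal finite_norm (phi - 1)"
      using ideal_intersection by (auto simp: principal_ideal_def)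
  qed
  show ?thesis
    unfolding bounded_continuous_on_def
    using ker int bdd
    by (auto simp: hat_ev(1) finite_norm_slow hat_continuous hat_one hat_add hat_mult hat_bscale
        intro!: SUP_least hat_bound)
qed

end
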